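(* Let $d$ be a positive integer and let $G$ be a graph in which every nontrivial $\mathcal{R}_d$-component is minimally $\mathcal{R}_d$-connected. Then: (a) $G$ is $\mathcal{R}_{d+1}$-independent; (b) for every subgraph $G'=(V',E')$ of $G$ with $|V'|\ge d+2$ we have \[|E'|\le r_d(G')+|V'|-d-1\le (d+1)|V'|-\binom{d+2}{2},\] where the first inequality holds with equality if and only if $G'$ is a complete graph $K_{d+2}$.
   Context: All graphs are finite and simple. For a positive integer $k$, $\mathcal{R}_k(G)$ is the row matroid of the rigidity matrix $R(G,p)$ of a generic framework $p:V\to\mathbb{R}^k$ (coordinates algebraically independent over $\mathbb{Q}$; row of edge $xy$ has $p(x)-p(y)$ in the columns of $x$, $p(y)-p(x)$ in those of $y$, zeros elsewhere); $r_k(G)$ is its rank; $G$ is $\mathcal{R}_k$-independent if $E(G)$ is independent in $\mathcal{R}_k(G)$. $G$ is $\mathcal{R}_d$-connected if $\mathcal{R}_d(G)$ is a connected matroid (every two edges lie in a common circuit) and $G$ has no isolated vertices; an $\mathcal{R}_d$-connected graph with at least two edges is minimally $\mathcal{R}_d$-connected if $G-e$ is not $\mathcal{R}_d$-connected for every edge $e$. The $\mathcal{R}_d$-components of $G$ are the subgraphs edge-induced by the connected components of the matroid $\mathcal{R}_d(G)$; an $\mathcal{R}_d$-component is nontrivial if it has at least two edges. *)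

theory Defs
  imports Complex_Main "HOL-Library.Poly_Mapping"
begin

section \<open>Finite simple graphs\<close>

definition simple_graph :: "'a set \<Rightarrow> 'a set set \<Rightarrow> bool" where
  "simple_graph V E \<longleftrightarrow> finite V \<and> (\<forall>e\<in>E. e \<subseteq> V \<and> card e = 2)"

definition subgraph :: "'a set \<Rightarrow> 'a set set \<Rightarrow> 'a set \<Rightarrow> 'a set set \<Rightarrow> bool" where
  "subgraph V' E' V E \<longleftrightarrow> simple_graph V' E' \<and> V' \<subseteq> V \<and> E' \<subseteq> E"

definition complete_graph :: "nat \<Rightarrow> 'a set \<Rightarrow> 'a set set \<Rightarrow> bool" where
  "complete_graph n V E \<longleftrightarrow> finite V \<and> card V = n \<and> E = {e. e \<subseteq> V \<and> card e = 2}"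


section \<open>Matroids, given by a ground set and an independence predicate\<close>

definition matroid_circuit :: "('b set \<Rightarrow> bool) \<Rightarrow> 'b set \<Rightarrow> 'b set \<Rightarrow> bool" where
  "matroid_circuit indep S C \<longleftrightarrow> C \<subseteq> S \<and> \<not> indep C \<and> (\<forall>D. D \<subset> C \<longrightarrow> indep D)"

definition matroid_rank :: "('b set \<Rightarrow> bool) \<Rightarrow> 'b set \<Rightarrow> nat" where
  "matroid_rank indep S = Max (card ` {I. I \<subseteq> S \<and> indep I})"

definition matroid_connected :: "('b set \<Rightarrow> bool) \<Rightarrow> 'b set \<Rightarrow> bool" where
  "matroid_connected indep S \<longleftrightarrow>
     (\<forall>e\<in>S. \<forall>f\<in>S. e \<noteq> f \<longrightarrow> (\<exists>C. matroid_circuit indep S C \<and> e \<in> C \<and> f \<in> C))"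

text \<open>The connected components are the classes of the relation ``equal or in a common circuit'';
  in particular every coloop forms a component of its own.\<close>

definition matroid_components :: "('b set \<Rightarrow> bool) \<Rightarrow> 'b set \<Rightarrow> 'b set set" where
  "matroid_components indep S =
     S // {(e, f). e \<in> S \<and> f \<in> S \<and>
             (e = f \<or> (\<exists>C. matroid_circuit indep S C \<and> e \<in> C \<and> f \<in> C))}"


section \<open>Generic frameworks\<close>

text \<open>A polynomial with rational coefficients in variables indexed by \<open>'i\<close> is a finitely
  supported map from monomials to coefficients, a monomial being a finitely supported map from
  variables to exponents.\<close>

definition eval_rat_poly :: "('i \<Rightarrow> real) \<Rightarrow> (('i \<Rightarrow>\<^sub>0 nat) \<Rightarrow>\<^sub>0 rat) \<Rightarrow> real" where
  "eval_rat_poly x f =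
     (\<Sum>m\<in>Poly_Mapping.keys f. of_rat (Poly_Mapping.lookup f m) *
        (\<Prod>i\<in>Poly_Mapping.keys m. x i ^ Poly_Mapping.lookup m i))"

definition algebraically_independent_over_rat :: "'i set \<Rightarrow> ('i \<Rightarrow> real) \<Rightarrow> bool" where
  "algebraically_independent_over_rat I x \<longleftrightarrow>
     (\<forall>f. (\<forall>m\<in>Poly_Mapping.keys f. Poly_Mapping.keys m \<subseteq> I) \<longrightarrow> eval_rat_poly x f = 0 \<longrightarrow> f = 0)"

text \<open>A framework in $k$-dimensional space assigns to \<open>v\<close> the point with coordinates
  \<open>p v 0, \<dots>, p v (k - 1)\<close>; the values \<open>p v i\<close> with \<open>i \<ge> k\<close> or \<open>v\<close> not a vertex play no role.\<close>

definition generic_framework :: "nat \<Rightarrow> 'a set \<Rightarrow> ('a \<Rightarrow> nat \<Rightarrow> real) \<Rightarrow> bool" where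
  "generic_framework k V p \<longleftrightarrow>
     algebraically_independent_over_rat (V \<times> {..<k}) (\<lambda>(v, i). p v i)"


section \<open>The rigidity matroid\<close>

text \<open>Entry of the rigidity matrix in row \<open>e\<close> and column \<open>(v, i)\<close>. For an edge \<open>e = {v, w}\<close>
  the sum consists of the single term \<open>w\<close>.\<close>

definition rigidity_matrix :: "('a \<Rightarrow> nat \<Rightarrow> real) \<Rightarrow> 'a set \<Rightarrow> 'a \<times> nat \<Rightarrow> real" where
  "rigidity_matrix p e = (\<lambda>(v, i). if v \<in> e then (\<Sum>w\<in>e - {v}. p v i - p w i) else 0)"

text \<open>Linear independence of the family of rows indexed by \<open>F\<close>. For a generic \<open>p\<close> this does not
  depend on \<open>p\<close>, and the restriction of a generic framework to fewer vertices is again generic; so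
  all notions below carry the framework as a parameter, and it is shared by a graph and its
  subgraphs.\<close>

definition rigidity_indep :: "nat \<Rightarrow> ('a \<Rightarrow> nat \<Rightarrow> real) \<Rightarrow> 'a set \<Rightarrow> 'a set set \<Rightarrow> bool" where
  "rigidity_indep k p V F \<longleftrightarrow>
     (\<forall>c. (\<forall>j\<in>V \<times> {..<k}. (\<Sum>e\<in>F. c e * rigidity_matrix p e j) = 0) \<longrightarrow> (\<forall>e\<in>F. c e = 0))"

definition rigidity_rank :: "nat \<Rightarrow> ('a \<Rightarrow> nat \<Rightarrow> real) \<Rightarrow> 'a set \<Rightarrow> 'a set set \<Rightarrow> nat" where
  "rigidity_rank k p V E = matroid_rank (rigidity_indep k p V) E"

definition rigidity_connected :: "nat \<Rightarrow> ('a \<Rightarrow> nat \<Rightarrow> real) \<Rightarrow> 'a set \<Rightarrow> 'a set set \<Rightarrow> bool" where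
  "rigidity_connected k p V E \<longleftrightarrow>
     matroid_connected (rigidity_indep k p V) E \<and> (\<forall>v\<in>V. \<exists>e\<in>E. v \<in> e)"

definition minimally_rigidity_connected ::
    "nat \<Rightarrow> ('a \<Rightarrow> nat \<Rightarrow> real) \<Rightarrow> 'a set \<Rightarrow> 'a set set \<Rightarrow> bool" where
  "minimally_rigidity_connected k p V E \<longleftrightarrow>
     rigidity_connected k p V E \<and> card E \<ge> 2 \<and>
     (\<forall>e\<in>E. \<not> rigidity_connected k p V (E - {e}))"

definition rigidity_components ::
    "nat \<Rightarrow> ('a \<Rightarrow> nat \<Rightarrow> real) \<Rightarrow> 'a set \<Rightarrow> 'a set set \<Rightarrow> ('a set \<times> 'a set set) set" where
  "rigidity_components k p V E =
     (\<lambda>C. (\<Union>C, C)) ` matroid_components (rigidity_indep k p V) E"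

end

(*
For a framework x in R^d and a generic function h on the vertices, a stress w of x is a stress of
the framework (x, h) in R^(d+1) iff its stress matrix kills h. So E is independent in dimension
d + 1 iff w -> Omega_w h is injective on the stresses of x, and then (b) is a count, because all
vectors Omega_w h are orthogonal to the affine functions of x.

Independence. If the nontrivial components are minimally connected, the support of every stress
contains a series pair e, f, that is, w_f = c(x) w_e for all stresses w of x. A stress of (x, h) is a
stress of each of its projections to R^d, so c would take equal values on frameworks that differ in
one coordinate; changing the coordinates one at a time, c would be constant. But a projective
transformation of x multiplies c by a nonconstant factor.

Equality. If the count is tight and there are at least two independent stresses, each series pair
provides a non-affine vector in the kernel of all stress matrices that vanish at e. These vectors
diagonalize all stress matrices simultaneously, so there is a basis of stresses of rank one. Each is
supported on a complete graph with d + 2 vertices, two of these graphs share an edge g, and the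
deletion of g leaves them connected, contrary to minimality.
*)
theory Submission
  imports Defs
begin

section \<open>Linear independence\<close>

text \<open>The series ratio c(x) is compared at frameworks between x and its projective image that
  need not be generic. Therefore the properties that matter (a set of edges is independent, two
  ratios differ) are phrased as linear independence of rows whose entries are polynomials in the
  coordinates. Such a property is open, and if it holds at one real point, however special, it holds
  at every generic point.

  Stresses carry a set of coordinates, so one generic framework in dimension d + 1 supplies both
  projections that are compared, onto the first d and onto the last d coordinates.

  Minimal connectivity enters only through splits of the stress space. Splits are inherited by
  subgraphs, so (b) is proved for the whole graph alone.

  The non-affine kernel vectors are coordinates of infinitesimal motions: differentiating the
  equilibrium condition shows that, in generic position, every coordinate of a motion lies in the
  kernel of every stress matrix.\<close>

definition lin_indep :: "('g \<Rightarrow> 'j \<Rightarrow> real) \<Rightarrow> 'g set \<Rightarrow> 'j set \<Rightarrow> bool" where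
  "lin_indep r G J \<longleftrightarrow> (\<forall>c. (\<forall>j\<in>J. (\<Sum>g\<in>G. c g * r g j) = 0) \<longrightarrow> (\<forall>g\<in>G. c g = 0))"

lemma lin_indepD:
  assumes "lin_indep r G J" "\<And>j. j \<in> J \<Longrightarrow> (\<Sum>g\<in>G. c g * r g j) = 0" "g \<in> G"
  shows "c g = 0"
  using assms unfolding lin_indep_def by blast

lemma lin_indep_pivot:
  assumes "finite G" "e \<in> G" "lin_indep r G J"
  obtains j where "j \<in> J" "r e j \<noteq> 0"
proof -
  have "\<exists>j\<in>J. r e j \<noteq> 0"
  proof (rule ccontr)
    assume "\<not> (\<exists>j\<in>J. r e j \<noteq> 0)"
    then have "\<And>j. j \<in> J \<Longrightarrow> (\<Sum>g\<in>G. (if g = e then 1 else 0) * r g j) = 0"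
      using assms(1,2) by (simp add: if_distrib[of "\<lambda>x. x * _"] cong: if_cong)
    from lin_indepD[OF assms(3) this assms(2)] show False by simp
  qed
  then show thesis using that by blast
qed

text \<open>One step of Gaussian elimination without division: the rows are multiplied by the pivot,
  so their entries stay polynomial in the original ones, as \<open>lin_indep_open\<close>
  requires.\<close>

lemma lin_indep_eliminate:
  assumes "finite G" "e \<notin> G" "j \<in> J" "r e j \<noteq> 0"
  shows "lin_indep r (insert e G) J \<longleftrightarrow>
    lin_indep (\<lambda>g i. r e j * r g i - r g j * r e i) G (J - {j})" (is "?L \<longleftrightarrow> ?R")
proof
  assume L: ?L
  show ?R
    unfolding lin_indep_def
  proof (intro allI impI ballI)
    fix c g assume c: "\<forall>i\<in>J - {j}. (\<Sum>g\<in>G. c g * (r e j * r g i - r g j * r e i)) = 0" and g: "g \<in> G"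
    \<comment> \<open>The coefficient of \<open>e\<close> cancels column \<open>j\<close>; scaling
      the others by the pivot produces the eliminated rows in all columns.\<close>
    define c' where "c' h = (if h = e then - (\<Sum>g\<in>G. c g * r g j) else c h * r e j)" for h
    have s: "(\<Sum>h\<in>insert e G. c' h * r h i) = (\<Sum>g\<in>G. c g * (r e j * r g i - r g j * r e i))" for i
    proof -
      have "(\<Sum>h\<in>G. c' h * r h i) = (\<Sum>h\<in>G. c h * r e j * r h i)"
        using assms(2) by (intro sum.cong) (auto simp: c'_def)
      then show ?thesis
        using assms(1,2)
        by (simp add: c'_def sum_subtractf algebra_simps sum_distrib_left sum_distrib_right)
    qed
    have "(\<Sum>h\<in>insert e G. c' h * r h i) = 0" if "i \<in> J" for i
      unfolding s using c that by (cases "i = j") (auto simp: mult.commute)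
    from lin_indepD[OF L this, of g] show "c g = 0"
      using g assms(2,4) by (auto simp: c'_def split: if_splits)
  qed
next
  assume R: ?R
  show ?L
    unfolding lin_indep_def
  proof (intro allI impI)
    fix c assume c: "\<forall>i\<in>J. (\<Sum>g\<in>insert e G. c g * r g i) = 0"
    have *: "(\<Sum>g\<in>G. c g * r g i) = - c e * r e i" if "i \<in> J" for i
      using c that assms(1,2) by (simp add: eq_neg_iff_add_eq_0 add.commute)
    have "(\<Sum>g\<in>G. c g * (r e j * r g i - r g j * r e i)) = 0" if "i \<in> J - {j}" for i
    proof -
      have "(\<Sum>g\<in>G. c g * (r e j * r g i - r g j * r e i))
          = r e j * (\<Sum>g\<in>G. c g * r g i) - (\<Sum>g\<in>G. c g * r g j) * r e i"
        by (simp add: sum_subtractf algebra_simps sum_distrib_left sum_distrib_right)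
      then show ?thesis using that assms(3) by (simp add: *)
    qed
    then have z: "c g = 0" if "g \<in> G" for g using lin_indepD[OF R] that by blast
    then have "c e * r e j = 0" using *[OF assms(3)] by simp
    then show "\<forall>g\<in>insert e G. c g = 0" using z assms(4) by auto
  qed
qed

lemma lin_indep_card_le:
  assumes "finite G" "finite J" "lin_indep r G J"
  shows "card G \<le> card J"
  using assms
proof (induction G arbitrary: r J rule: finite_induct)
  case (insert e G)
  from lin_indep_pivot[OF _ _ insert.prems(2), of e] insert.hyps
  obtain j where j: "j \<in> J" "r e j \<noteq> 0" by auto
  have "card G \<le> card (J - {j})"
    using insert.IH[of "J - {j}"] insert.prems insert.hyps
      lin_indep_eliminate[where r = r and j = j, OF insert.hyps(1,2) j] by auto
  moreover have "card J > 0" using j insert.prems(1) card_gt_0_iff by blast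
  ultimately show ?case using insert.hyps j insert.prems(1) by simp
qed simp

text \<open>Independent rows make the linear map onto. In \<open>edge_motion\<close> this yields
  velocities with prescribed rates of change of the edge lengths.\<close>

lemma lin_indep_solvable:
  assumes "finite G" "finite J" "lin_indep r G J"
  shows "\<exists>y. \<forall>g\<in>G. (\<Sum>j\<in>J. r g j * y j) = b g"
  using assms
proof (induction G arbitrary: r J b rule: finite_induct)
  case (insert e G)
  from lin_indep_pivot[OF _ _ insert.prems(2), of e] insert.hyps
  obtain j where j: "j \<in> J" "r e j \<noteq> 0" by auto
  obtain y where y: "\<And>g. g \<in> G \<Longrightarrow>
      (\<Sum>i\<in>J - {j}. (r e j * r g i - r g j * r e i) * y i) = r e j * b g - r g j * b e"
    using insert.IH[of "J - {j}" "\<lambda>g i. r e j * r g i - r g j * r e i" "\<lambda>g. r e j * b g - r g j * b e"]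
      insert.prems insert.hyps lin_indep_eliminate[where r = r and j = j, OF insert.hyps(1,2) j] by auto
  define z where "z i = (if i = j then (b e - (\<Sum>i\<in>J - {j}. r e i * y i)) / r e j else y i)" for i
  have split: "(\<Sum>i\<in>J. r g i * z i) = r g j * z j + (\<Sum>i\<in>J - {j}. r g i * y i)" for g
  proof -
    have "(\<Sum>i\<in>J. r g i * z i) = r g j * z j + (\<Sum>i\<in>J - {j}. r g i * z i)"
      using j(1) insert.prems(1) by (rule sum.remove[rotated])
    also have "(\<Sum>i\<in>J - {j}. r g i * z i) = (\<Sum>i\<in>J - {j}. r g i * y i)"
      by (intro sum.cong) (auto simp: z_def)
    finally show ?thesis .
  qed
  have e: "(\<Sum>i\<in>J. r e i * z i) = b e"
    unfolding split using j(2) by (simp add: z_def)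
  have "(\<Sum>i\<in>J. r g i * z i) = b g" if g: "g \<in> G" for g
  proof -
    have "r e j * (\<Sum>i\<in>J - {j}. r g i * y i) - r g j * (\<Sum>i\<in>J - {j}. r e i * y i)
        = r e j * b g - r g j * b e"
      using y[OF g] by (simp add: sum_subtractf left_diff_distrib sum_distrib_left mult.assoc)
    moreover have "r e j * z j = b e - (\<Sum>i\<in>J - {j}. r e i * y i)"
      using j(2) by (simp add: z_def)
    then have "r e j * (r g j * z j) = r g j * b e - r g j * (\<Sum>i\<in>J - {j}. r e i * y i)"
      by (subst mult.left_commute) (simp only: right_diff_distrib)
    ultimately have "r e j * (\<Sum>i\<in>J. r g i * z i) = r e j * b g"
      unfolding split by (simp add: distrib_left)
    then show ?thesis using j(2) by simp
  qed
  with e show ?case by blast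
qed simp

lemma lin_indep_spans:
  assumes "finite G" "finite J" "lin_indep r G J" "card G = card J"
  shows "\<exists>c. \<forall>j\<in>J. t j = (\<Sum>g\<in>G. c g * r g j)"
proof -
  define s where "s = case_option t r"
  let ?H = "insert None (Some ` G)"
  have "card ?H = Suc (card J)" using assms by (simp add: card_image)
  then have "\<not> lin_indep s ?H J" using lin_indep_card_le[of ?H J s] assms by auto
  then obtain c where c: "\<And>j. j \<in> J \<Longrightarrow> (\<Sum>h\<in>?H. c h * s h j) = 0" and nz: "\<exists>h\<in>?H. c h \<noteq> 0"
    unfolding lin_indep_def by auto
  have eq: "c None * t j + (\<Sum>g\<in>G. c (Some g) * r g j) = 0" if "j \<in> J" for j
    using c[OF that] assms(1) by (simp add: s_def sum.reindex)
  have "c None \<noteq> 0"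
  proof
    assume "c None = 0"
    then have "c (Some g) = 0" if "g \<in> G" for g
      using lin_indepD[OF assms(3), of "\<lambda>g. c (Some g)"] eq that by simp
    then show False using nz \<open>c None = 0\<close> by auto
  qed
  then have "t j = (\<Sum>g\<in>G. - c (Some g) / c None * r g j)" if "j \<in> J" for j
    using eq[OF that]
    by (simp add: sum_divide_distrib[symmetric] sum_negf field_simps eq_neg_iff_add_eq_0)
  then show ?thesis by (intro exI[of _ "\<lambda>g. - c (Some g) / c None"]) blast
qed

text \<open>A vector common to both spans is orthogonal to itself, hence zero over the reals, so the
  two families together are independent.\<close>

lemma lin_indep_orthogonal_card:
  assumes "finite F" "finite I" "finite J" "lin_indep r F J" "lin_indep t I J"
    "\<And>g i. g \<in> F \<Longrightarrow> i \<in> I \<Longrightarrow> (\<Sum>j\<in>J. r g j * t i j) = 0"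
  shows "card F + card I \<le> card J"
proof -
  have "lin_indep (case_sum r t) (F <+> I) J"
    unfolding lin_indep_def
  proof (intro allI impI)
    fix c assume "\<forall>j\<in>J. (\<Sum>x\<in>F <+> I. c x * case_sum r t x j) = 0"
    then have c: "(\<Sum>g\<in>F. c (Inl g) * r g j) + (\<Sum>i\<in>I. c (Inr i) * t i j) = 0" if "j \<in> J" for j
      using that assms(1,2) by (simp add: sum.Plus)
    let ?U = "\<lambda>j. \<Sum>g\<in>F. c (Inl g) * r g j"
    have "(\<Sum>j\<in>J. ?U j * ?U j) = (\<Sum>j\<in>J. ?U j * - (\<Sum>i\<in>I. c (Inr i) * t i j))"
      using c by (intro sum.cong refl) (simp add: add_eq_0_iff2)
    also have "\<dots> = - (\<Sum>j\<in>J. \<Sum>g\<in>F. \<Sum>i\<in>I. c (Inl g) * c (Inr i) * (r g j * t i j))"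
      by (simp add: sum_negf sum_product mult_ac)
    also have "(\<Sum>j\<in>J. \<Sum>g\<in>F. \<Sum>i\<in>I. c (Inl g) * c (Inr i) * (r g j * t i j))
        = (\<Sum>g\<in>F. \<Sum>j\<in>J. \<Sum>i\<in>I. c (Inl g) * c (Inr i) * (r g j * t i j))"
      by (rule sum.swap)
    also have "\<dots> = (\<Sum>g\<in>F. \<Sum>i\<in>I. \<Sum>j\<in>J. c (Inl g) * c (Inr i) * (r g j * t i j))"
      by (intro sum.cong refl sum.swap)
    also have "\<dots> = 0"
      by (rule sum.neutral, rule ballI, rule sum.neutral, rule ballI)
        (simp add: sum_distrib_left[symmetric] assms(6))
    finally have "(\<Sum>j\<in>J. ?U j * ?U j) = 0" by simp
    then have U: "?U j = 0" if "j \<in> J" for j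
      using that assms(3) by (simp add: sum_nonneg_eq_0_iff)
    then have "\<forall>g\<in>F. c (Inl g) = 0" using lin_indepD[OF assms(4), of "\<lambda>g. c (Inl g)"] by blast
    moreover have "\<forall>i\<in>I. c (Inr i) = 0"
      using lin_indepD[OF assms(5), of "\<lambda>i. c (Inr i)"] c U by auto
    ultimately show "\<forall>x\<in>F <+> I. c x = 0" by auto
  qed
  from lin_indep_card_le[OF _ assms(3) this] show ?thesis
    using assms(1,2) by (simp add: card_Plus)
qed

text \<open>The class \<open>P\<close> will be the rational polynomials or the functions continuous at a point.\<close>

lemma lin_indep_open:
  fixes P :: "('x \<Rightarrow> real) \<Rightarrow> bool"
  assumes one: "P (\<lambda>x. 1)"
    and diff: "\<And>\<phi> \<psi>. P \<phi> \<Longrightarrow> P \<psi> \<Longrightarrow> P (\<lambda>x. \<phi> x - \<psi> x)"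
    and mult: "\<And>\<phi> \<psi>. P \<phi> \<Longrightarrow> P \<psi> \<Longrightarrow> P (\<lambda>x. \<phi> x * \<psi> x)"
    and "finite G" "\<And>g j. g \<in> G \<Longrightarrow> j \<in> J \<Longrightarrow> P (\<lambda>x. r x g j)" "lin_indep (r x0) G J"
  shows "\<exists>\<phi>. P \<phi> \<and> \<phi> x0 \<noteq> 0 \<and> (\<forall>x. \<phi> x \<noteq> 0 \<longrightarrow> lin_indep (r x) G J)"
  using assms(4-)
proof (induction G arbitrary: r J rule: finite_induct)
  case empty
  then show ?case using one by (intro exI[of _ "\<lambda>x. 1"]) (auto simp: lin_indep_def)
next
  case (insert e G)
  from lin_indep_pivot[OF _ _ insert.prems(2), of e] insert.hyps
  obtain j where j: "j \<in> J" "r x0 e j \<noteq> 0" by auto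
  have "\<exists>\<phi>. P \<phi> \<and> \<phi> x0 \<noteq> 0 \<and> (\<forall>x. \<phi> x \<noteq> 0 \<longrightarrow>
      lin_indep (\<lambda>g i. r x e j * r x g i - r x g j * r x e i) G (J - {j}))"
  proof (rule insert.IH)
    show "P (\<lambda>x. r x e j * r x g i - r x g j * r x e i)" if "g \<in> G" "i \<in> J - {j}" for g i
      using that j insert.prems(1) by (intro diff mult) auto
  qed (use lin_indep_eliminate[where r = "r x0" and j = j, OF insert.hyps(1,2) j] insert.prems in auto)
  then obtain \<phi> where \<phi>: "P \<phi>" "\<phi> x0 \<noteq> 0" "\<And>x. \<phi> x \<noteq> 0 \<Longrightarrow>
      lin_indep (\<lambda>g i. r x e j * r x g i - r x g j * r x e i) G (J - {j})" by auto
  \<comment> \<open>The witness is the product of the pivots found at \<open>x0\<close>: where none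
    of them vanishes, the same elimination succeeds.\<close>
  have "P (\<lambda>x. \<phi> x * r x e j)" using \<phi> j insert.prems by (auto intro!: mult)
  then show ?case using \<phi> j lin_indep_eliminate[where j = j, OF insert.hyps(1,2) j(1)]
    by (intro exI[of _ "\<lambda>x. \<phi> x * r x e j"]) auto
qed

lemma eventually_at_0_ex: "eventually P (at (0 :: real)) \<Longrightarrow> \<exists>t. P t"
  using eventually_happens[of P "at (0 :: real)"] by simp

lemma eventually_lin_indep:
  fixes r :: "real \<Rightarrow> 'g \<Rightarrow> 'j \<Rightarrow> real"
  assumes "finite G" "\<And>g j. g \<in> G \<Longrightarrow> j \<in> J \<Longrightarrow> isCont (\<lambda>t. r t g j) 0" "lin_indep (r 0) G J"
  shows "eventually (\<lambda>t. lin_indep (r t) G J) (at 0)"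
proof -
  have "\<exists>\<phi>::real \<Rightarrow> real. isCont \<phi> 0 \<and> \<phi> 0 \<noteq> 0 \<and> (\<forall>t. \<phi> t \<noteq> 0 \<longrightarrow> lin_indep (r t) G J)"
    by (rule lin_indep_open[where P = "\<lambda>\<phi>. isCont \<phi> 0"]) (use assms in auto)
  then obtain \<phi> :: "real \<Rightarrow> real" where \<phi>: "isCont \<phi> 0" "\<phi> 0 \<noteq> 0" "\<And>t. \<phi> t \<noteq> 0 \<Longrightarrow> lin_indep (r t) G J"
    by blast
  from \<phi>(1) have "(\<phi> \<longlongrightarrow> \<phi> 0) (at 0)" by (simp add: isCont_def)
  then have "eventually (\<lambda>t. \<phi> t \<noteq> 0) (at 0)" using \<phi>(2) by (rule tendsto_imp_eventually_ne)
  then show ?thesis by (rule eventually_mono) (rule \<phi>(3))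
qed

section \<open>Generic points\<close>

text \<open>With closure rules, matrix entries are recognised as polynomials by introduction;
  \<open>rat_poly_fun_eval\<close> makes the link with \<open>eval_rat_poly\<close>.\<close>

inductive rat_poly_fun :: "'i set \<Rightarrow> (('i \<Rightarrow> real) \<Rightarrow> real) \<Rightarrow> bool" for I where
  const: "rat_poly_fun I (\<lambda>x. of_rat a)"
| var: "i \<in> I \<Longrightarrow> rat_poly_fun I (\<lambda>x. x i)"
| add: "rat_poly_fun I \<phi> \<Longrightarrow> rat_poly_fun I \<psi> \<Longrightarrow> rat_poly_fun I (\<lambda>x. \<phi> x + \<psi> x)"
| mult: "rat_poly_fun I \<phi> \<Longrightarrow> rat_poly_fun I \<psi> \<Longrightarrow> rat_poly_fun I (\<lambda>x. \<phi> x * \<psi> x)"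

lemma rat_poly_fun_0: "rat_poly_fun I (\<lambda>x. 0)" and rat_poly_fun_1: "rat_poly_fun I (\<lambda>x. 1)"
  using rat_poly_fun.const[of I 0] rat_poly_fun.const[of I 1] by auto

lemma rat_poly_fun_diff:
  assumes "rat_poly_fun I \<phi>" "rat_poly_fun I \<psi>"
  shows "rat_poly_fun I (\<lambda>x. \<phi> x - \<psi> x)"
  using rat_poly_fun.add[OF assms(1) rat_poly_fun.mult[OF rat_poly_fun.const[of I "- 1"] assms(2)]]
  by (simp add: of_rat_minus)

lemma rat_poly_fun_sum:
  assumes "\<And>a. a \<in> A \<Longrightarrow> rat_poly_fun I (\<phi> a)"
  shows "rat_poly_fun I (\<lambda>x. \<Sum>a\<in>A. \<phi> a x)"
  using assms
  by (induction A rule: infinite_finite_induct) (auto intro: rat_poly_fun_0 rat_poly_fun.add)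

definition eval_monomial :: "('i \<Rightarrow> real) \<Rightarrow> ('i \<Rightarrow>\<^sub>0 nat) \<Rightarrow> real" where
  "eval_monomial x m = (\<Prod>i\<in>Poly_Mapping.keys m. x i ^ Poly_Mapping.lookup m i)"

lemma eval_monomial_superset:
  assumes "finite A" "Poly_Mapping.keys m \<subseteq> A"
  shows "eval_monomial x m = (\<Prod>i\<in>A. x i ^ Poly_Mapping.lookup m i)"
  unfolding eval_monomial_def using assms
  by (intro prod.mono_neutral_left) (auto simp: in_keys_iff)

lemma eval_monomial_add: "eval_monomial x (m + n) = eval_monomial x m * eval_monomial x n"
  using eval_monomial_superset[of "Poly_Mapping.keys m \<union> Poly_Mapping.keys n" _ x] keys_add[of m n]
  by (simp add: lookup_add power_add prod.distrib)

lemma eval_rat_poly_superset: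
  assumes "finite A" "Poly_Mapping.keys f \<subseteq> A"
  shows "eval_rat_poly x f = (\<Sum>m\<in>A. of_rat (Poly_Mapping.lookup f m) * eval_monomial x m)"
  unfolding eval_rat_poly_def eval_monomial_def[symmetric] using assms
  by (intro sum.mono_neutral_left) (auto simp: in_keys_iff)

lemma eval_rat_poly_add: "eval_rat_poly x (f + g) = eval_rat_poly x f + eval_rat_poly x g"
  using eval_rat_poly_superset[of "Poly_Mapping.keys f \<union> Poly_Mapping.keys g" _ x] keys_add[of f g]
  by (simp add: lookup_add of_rat_add distrib_right sum.distrib)

lemma eval_rat_poly_sum: "eval_rat_poly x (\<Sum>a\<in>A. f a) = (\<Sum>a\<in>A. eval_rat_poly x (f a))"
  by (induction A rule: infinite_finite_induct)
    (simp_all add: eval_rat_poly_add, simp_all add: eval_rat_poly_def)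

lemma eval_rat_poly_single:
  "eval_rat_poly x (Poly_Mapping.single m a) = of_rat a * eval_monomial x m"
  using eval_rat_poly_superset[of "{m}" "Poly_Mapping.single m a" x] by simp

lemma poly_mapping_sum_single:
  "(\<Sum>m\<in>Poly_Mapping.keys f. Poly_Mapping.single m (Poly_Mapping.lookup f m)) = f"
  by (rule poly_mapping_eqI) (auto simp: lookup_sum lookup_single when_def in_keys_iff)

lemma eval_rat_poly_mult: "eval_rat_poly x (f * g) = eval_rat_poly x f * eval_rat_poly x g"
proof -
  have "f * g = (\<Sum>m\<in>Poly_Mapping.keys f. Poly_Mapping.single m (Poly_Mapping.lookup f m))
      * (\<Sum>m\<in>Poly_Mapping.keys g. Poly_Mapping.single m (Poly_Mapping.lookup g m))"
    by (simp add: poly_mapping_sum_single)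
  then show ?thesis
    by (simp add: sum_product mult_single eval_rat_poly_sum eval_rat_poly_single eval_monomial_add
        of_rat_mult eval_rat_poly_def[of x f] eval_rat_poly_def[of x g] eval_monomial_def[symmetric]
        mult_ac)
qed

lemma rat_poly_fun_eval:
  assumes "rat_poly_fun I \<phi>"
  shows "\<exists>f. (\<forall>m\<in>Poly_Mapping.keys f. Poly_Mapping.keys m \<subseteq> I) \<and> (\<forall>x. \<phi> x = eval_rat_poly x f)"
  using assms
proof induction
  case (const a)
  then show ?case
    by (intro exI[of _ "Poly_Mapping.single 0 a"])
      (simp add: eval_rat_poly_single eval_monomial_def)
next
  case (var i)
  then show ?case
    by (intro exI[of _ "Poly_Mapping.single (Poly_Mapping.single i 1) 1"])
      (simp add: eval_rat_poly_single eval_monomial_def)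
next
  case (add \<phi> \<psi>)
  then obtain f g where fg: "\<forall>m\<in>Poly_Mapping.keys f. Poly_Mapping.keys m \<subseteq> I" "\<forall>x. \<phi> x = eval_rat_poly x f"
    "\<forall>m\<in>Poly_Mapping.keys g. Poly_Mapping.keys m \<subseteq> I" "\<forall>x. \<psi> x = eval_rat_poly x g" by blast
  have "\<forall>m\<in>Poly_Mapping.keys (f + g). Poly_Mapping.keys m \<subseteq> I"
    using fg(1,3) keys_add[of f g] by blast
  then show ?case using fg
    by (intro exI[of _ "f + g"]) (simp add: eval_rat_poly_add)
next
  case (mult \<phi> \<psi>)
  then obtain f g where fg: "\<forall>m\<in>Poly_Mapping.keys f. Poly_Mapping.keys m \<subseteq> I" "\<forall>x. \<phi> x = eval_rat_poly x f"
    "\<forall>m\<in>Poly_Mapping.keys g. Poly_Mapping.keys m \<subseteq> I" "\<forall>x. \<psi> x = eval_rat_poly x g" by blast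
  have "Poly_Mapping.keys m \<subseteq> I" if m: "m \<in> Poly_Mapping.keys (f * g)" for m
  proof -
    obtain a b where "m = a + b" "a \<in> Poly_Mapping.keys f" "b \<in> Poly_Mapping.keys g"
      using m keys_mult[of f g] by auto
    then show ?thesis using fg keys_add[of a b] by blast
  qed
  then show ?case using fg
    by (intro exI[of _ "f * g"]) (auto simp: eval_rat_poly_mult)
qed

text \<open>A function that is nonzero at some \<open>x0\<close> comes from a nonzero polynomial.
  Apart from the restriction to fewer vertices, genericity is used only through this fact.\<close>

lemma alg_indep_nonzero:
  assumes "algebraically_independent_over_rat I x" "rat_poly_fun I \<phi>" "\<phi> x0 \<noteq> 0"
  shows "\<phi> x \<noteq> 0"
proof -
  obtain f where f: "\<forall>m\<in>Poly_Mapping.keys f. Poly_Mapping.keys m \<subseteq> I" "\<And>x. \<phi> x = eval_rat_poly x f"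
    using rat_poly_fun_eval[OF assms(2)] by blast
  have "f \<noteq> 0" using f(2)[of x0] assms(3) by (auto simp: eval_rat_poly_def)
  then show ?thesis using assms(1) f unfolding algebraically_independent_over_rat_def by metis
qed

text \<open>The point \<open>x0\<close> may be as special as one likes: one convenient position
  certifies independence at every generic one.\<close>

lemma alg_indep_lin_indep:
  assumes "algebraically_independent_over_rat I x" "finite G"
    "\<And>g j. g \<in> G \<Longrightarrow> j \<in> J \<Longrightarrow> rat_poly_fun I (\<lambda>x. r x g j)" "lin_indep (r x0) G J"
  shows "lin_indep (r x) G J"
proof -
  have "\<exists>\<phi>. rat_poly_fun I \<phi> \<and> \<phi> x0 \<noteq> 0 \<and> (\<forall>x. \<phi> x \<noteq> 0 \<longrightarrow> lin_indep (r x) G J)"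
    by (rule lin_indep_open[where r = r and ?x0.0 = x0, OF rat_poly_fun_1 rat_poly_fun_diff rat_poly_fun.mult assms(2-4)])
  then show ?thesis using alg_indep_nonzero[OF assms(1)] by blast
qed

section \<open>Dependency spaces and connected matroids\<close>

definition support :: "('b \<Rightarrow> real) \<Rightarrow> 'b set" where
  "support \<omega> = {g. \<omega> g \<noteq> 0}"

definition restr :: "'b set \<Rightarrow> ('b \<Rightarrow> real) \<Rightarrow> 'b \<Rightarrow> real" where
  "restr A \<omega> g = (if g \<in> A then \<omega> g else 0)"

lemma in_support: "g \<in> support \<omega> \<longleftrightarrow> \<omega> g \<noteq> 0"
  by (simp add: support_def)

lemma support_diff: "support (\<lambda>g. \<omega> g - b * \<tau> g) \<subseteq> support \<omega> \<union> support \<tau>"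
  by (auto simp: support_def)

lemma matroid_circuit_cong:
  assumes "\<And>F. F \<subseteq> X \<Longrightarrow> P F \<longleftrightarrow> Q F"
  shows "matroid_circuit P X C \<longleftrightarrow> matroid_circuit Q X C"
proof -
  have "P C \<longleftrightarrow> Q C" "(\<forall>D. D \<subset> C \<longrightarrow> P D) \<longleftrightarrow> (\<forall>D. D \<subset> C \<longrightarrow> Q D)" if "C \<subseteq> X"
    using assms that by (auto dest!: psubset_imp_subset)
  then show ?thesis unfolding matroid_circuit_def by blast
qed

lemma matroid_connected_cong:
  assumes "\<And>F. F \<subseteq> X \<Longrightarrow> P F \<longleftrightarrow> Q F"
  shows "matroid_connected P X \<longleftrightarrow> matroid_connected Q X"
  unfolding matroid_connected_def using matroid_circuit_cong[of X P Q] assms by simp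

lemma matroid_rank_cong:
  assumes "\<And>F. F \<subseteq> X \<Longrightarrow> P F \<longleftrightarrow> Q F"
  shows "matroid_rank P X = matroid_rank Q X"
  unfolding matroid_rank_def using assms by (intro arg_cong[of _ _ Max] image_cong) auto

definition circuit_class :: "('b set \<Rightarrow> bool) \<Rightarrow> 'b set \<Rightarrow> 'b \<Rightarrow> 'b set" where
  "circuit_class ind X e = {f. f = e \<or> (\<exists>C. matroid_circuit ind X C \<and> e \<in> C \<and> f \<in> C)}"

text \<open>The linear dependencies of a family of vectors indexed by \<open>E\<close>.\<close>

locale dependency_space =
  fixes S :: "('b \<Rightarrow> real) set" and E :: "'b set"
  assumes finite_E: "finite E"
    and support_E: "\<omega> \<in> S \<Longrightarrow> support \<omega> \<subseteq> E"
    and zero: "(\<lambda>g. 0) \<in> S"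
    and lin: "\<omega> \<in> S \<Longrightarrow> \<tau> \<in> S \<Longrightarrow> (\<lambda>g. a * \<omega> g + b * \<tau> g) \<in> S"
begin

definition ind :: "'b set \<Rightarrow> bool" where
  "ind F \<longleftrightarrow> (\<forall>\<omega>\<in>S. support \<omega> \<subseteq> F \<longrightarrow> support \<omega> = {})"

text \<open>Deleting \<open>e\<close> disconnects \<open>A\<close> from the remaining elements, and \<open>e\<close> connects them again.\<close>

definition valid_split :: "'b \<Rightarrow> 'b set \<Rightarrow> bool" where
  "valid_split e A \<longleftrightarrow> A \<subseteq> E \<and> e \<notin> A \<and> (\<forall>\<omega>\<in>S. \<omega> e = 0 \<longrightarrow> restr A \<omega> \<in> S) \<and>
    (\<forall>\<omega>\<in>S. \<omega> e \<noteq> 0 \<longrightarrow> (\<exists>a\<in>A. \<omega> a \<noteq> 0) \<and> (\<exists>b. b \<notin> A \<and> b \<noteq> e \<and> \<omega> b \<noteq> 0))"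

text \<open>What is kept of minimal connectivity, expressed by dependencies alone; in this form it
  passes to subgraphs, see \<open>split_graph_subgraph\<close>.\<close>

definition splittable :: bool where
  "splittable \<longleftrightarrow> (\<forall>\<omega>\<in>S. \<forall>e. \<omega> e \<noteq> 0 \<longrightarrow> (\<exists>A. valid_split e A))"

text \<open>The complement of a basis. Its elements serve as coordinates on \<open>S\<close> by
  \<open>cobasis_dual\<close>, so its cardinality is the dimension of \<open>S\<close>.\<close>

definition cobasis :: "'b set \<Rightarrow> bool" where
  "cobasis J \<longleftrightarrow> J \<subseteq> E \<and> ind (E - J) \<and> (\<forall>j\<in>J. \<not> ind (insert j (E - J)))"

lemma finite_support: "\<omega> \<in> S \<Longrightarrow> finite (support \<omega>)"
  using support_E finite_E finite_subset by blast

lemma scale: "\<omega> \<in> S \<Longrightarrow> (\<lambda>g. a * \<omega> g) \<in> S"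
  using lin[of \<omega> \<omega> a 0] by simp

lemma diff: "\<omega> \<in> S \<Longrightarrow> \<tau> \<in> S \<Longrightarrow> (\<lambda>g. \<omega> g - b * \<tau> g) \<in> S"
  using lin[of \<omega> \<tau> 1 "- b"] by simp

lemma sum_in:
  assumes "\<And>j. j \<in> J \<Longrightarrow> W j \<in> S"
  shows "(\<lambda>g. \<Sum>j\<in>J. c j * W j g) \<in> S"
  using assms
proof (induction J rule: infinite_finite_induct)
  case (insert j J)
  then have "W j \<in> S" "(\<lambda>g. \<Sum>j\<in>J. c j * W j g) \<in> S" by auto
  from lin[OF this, of "c j" 1] insert.hyps show ?case by simp
qed (simp_all add: zero)

section \<open>Circuits and separators\<close>

text \<open>Minimality of the support is demanded only among dependencies nonzero at
  \<open>e\<close>, yet it yields a circuit: a dependency with smaller support that vanishes at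
  \<open>e\<close> can be subtracted to shrink \<open>\<tau>\<close> without changing its value at
  \<open>e\<close>.\<close>

lemma circuit_through:
  assumes "\<omega> \<in> S" "\<omega> e \<noteq> 0"
  obtains \<tau> where "\<tau> \<in> S" "\<tau> e \<noteq> 0" "support \<tau> \<subseteq> support \<omega>" "matroid_circuit ind E (support \<tau>)"
proof -
  let ?P = "\<lambda>\<tau>. \<tau> \<in> S \<and> \<tau> e \<noteq> 0 \<and> support \<tau> \<subseteq> support \<omega>"
  obtain \<tau> where \<tau>: "?P \<tau>" and min: "\<And>\<sigma>. ?P \<sigma> \<Longrightarrow> card (support \<tau>) \<le> card (support \<sigma>)"
    using ex_has_least_nat[of ?P \<omega> "\<lambda>\<tau>. card (support \<tau>)"] assms by auto
  have fin: "finite (support \<tau>)" using \<tau> finite_support by blast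
  have *: False if \<sigma>: "\<sigma> \<in> S" "support \<sigma> \<subset> support \<tau>" "\<sigma> y \<noteq> 0" for \<sigma> y
  proof (cases "\<sigma> e = 0")
    case True
    let ?r = "\<lambda>g. \<tau> g - (\<tau> y / \<sigma> y) * \<sigma> g"
    have "support ?r \<subseteq> support \<tau> - {y}" using \<sigma> by (auto simp: support_def)
    moreover have "y \<in> support \<tau>" using \<sigma> by (auto simp: support_def)
    ultimately have sub: "support ?r \<subset> support \<tau>" by blast
    have "?r \<in> S" using \<tau> \<sigma>(1) by (intro diff) auto
    then have "?P ?r" using \<tau> True sub by auto
    from min[OF this] psubset_card_mono[OF fin sub] show False by simp
  next
    case False
    then have "?P \<sigma>" using \<sigma> \<tau> by auto
    from min[OF this] psubset_card_mono[OF fin \<sigma>(2)] show False by simp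
  qed
  have "ind D" if "D \<subset> support \<tau>" for D
    unfolding ind_def
  proof (intro ballI impI equals0I)
    fix \<sigma> y assume \<sigma>: "\<sigma> \<in> S" "support \<sigma> \<subseteq> D" "y \<in> support \<sigma>"
    show False by (rule *[OF \<sigma>(1) _ \<sigma>(3)[unfolded in_support]]) (use \<sigma>(2) that in blast)
  qed
  moreover have "\<not> ind (support \<tau>)" using \<tau> by (auto simp: ind_def support_def)
  ultimately have "matroid_circuit ind E (support \<tau>)"
    using support_E \<tau> by (auto simp: matroid_circuit_def)
  then show thesis using that \<tau> by blast
qed

lemma circuit_stress:
  assumes "matroid_circuit ind X C"
  obtains \<tau> where "\<tau> \<in> S" "support \<tau> = C"
proof -
  obtain \<tau> where \<tau>: "\<tau> \<in> S" "support \<tau> \<subseteq> C" "support \<tau> \<noteq> {}"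
    using assms by (auto simp: matroid_circuit_def ind_def)
  have "support \<tau> = C"
  proof (rule ccontr)
    assume "support \<tau> \<noteq> C"
    then have "ind (support \<tau>)" using assms \<tau> by (auto simp: matroid_circuit_def)
    then show False using \<tau> by (auto simp: ind_def)
  qed
  with \<tau> that show thesis by blast
qed

lemma circuit_subset:
  assumes "X \<subseteq> E"
  shows "matroid_circuit ind X C \<longleftrightarrow> matroid_circuit ind E C \<and> C \<subseteq> X"
  using assms by (auto simp: matroid_circuit_def)

lemma circuit_subset_eq:
  assumes "matroid_circuit ind E C" "matroid_circuit ind E D" "C \<subseteq> D"
  shows "C = D"
  using assms by (auto simp: matroid_circuit_def)

text \<open>Eliminating a common element gives a circuit through \<open>x\<close>. If it misses
  \<open>z\<close>, it contains some \<open>u\<close> in \<open>C2 - C1\<close>, and eliminating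
  \<open>u\<close> from \<open>C2\<close> gives a circuit through \<open>z\<close> that meets
  \<open>C1\<close> and avoids \<open>u\<close>, so the union has shrunk. The bound by
  \<open>C1 \<union> C2\<close> keeps the result inside a given set.\<close>

lemma circuit_trans:
  assumes "matroid_circuit ind E C1" "matroid_circuit ind E C2" "x \<in> C1" "z \<in> C2" "C1 \<inter> C2 \<noteq> {}"
  shows "\<exists>C. matroid_circuit ind E C \<and> x \<in> C \<and> z \<in> C \<and> C \<subseteq> C1 \<union> C2"
  using assms
proof (induction "card (C1 \<union> C2)" arbitrary: C2 rule: less_induct)
  case less
  note C = less.prems
  have fin: "finite (C1 \<union> C2)"
    using C(1,2) finite_subset[OF _ finite_E] by (simp add: matroid_circuit_def)
  show ?case
  proof (cases "z \<in> C1 \<or> x \<in> C2")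
    case True
    then show ?thesis using C by blast
  next
    case False
    obtain y where y: "y \<in> C1" "y \<in> C2" using C(5) by blast
    obtain \<omega>1 where \<omega>1: "\<omega>1 \<in> S" "support \<omega>1 = C1" using circuit_stress[OF C(1)] by blast
    obtain \<omega>2 where \<omega>2: "\<omega>2 \<in> S" "support \<omega>2 = C2" using circuit_stress[OF C(2)] by blast
    let ?w = "\<lambda>g. \<omega>1 g - (\<omega>1 y / \<omega>2 y) * \<omega>2 g"
    have "\<omega>1 x \<noteq> 0" "\<omega>2 x = 0" "\<omega>2 y \<noteq> 0"
      using C(3) y False unfolding \<omega>1(2)[symmetric] \<omega>2(2)[symmetric] by (auto simp: in_support)
    then have "?w x \<noteq> 0" by simp
    from circuit_through[OF diff[OF \<omega>1(1) \<omega>2(1)] this]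
    obtain \<omega>3 where \<omega>3: "\<omega>3 \<in> S" "\<omega>3 x \<noteq> 0" "support \<omega>3 \<subseteq> support ?w"
      "matroid_circuit ind E (support \<omega>3)" by blast
    have s3: "support \<omega>3 \<subseteq> C1 \<union> C2 - {y}"
    proof -
      have "support ?w \<subseteq> C1 \<union> C2 - {y}"
        using \<omega>1(2) \<omega>2(2) \<open>\<omega>2 y \<noteq> 0\<close> by (auto simp: support_def)
      then show ?thesis using \<omega>3(3) by blast
    qed
    show ?thesis
    proof (cases "z \<in> support \<omega>3")
      case True
      then show ?thesis using \<omega>3 s3 in_support[of x \<omega>3] by blast
    next
      case z3: False
      have "\<not> support \<omega>3 \<subseteq> C1" using circuit_subset_eq[OF \<omega>3(4) C(1)] y s3 by blast
      then obtain u where u: "u \<in> support \<omega>3" "u \<notin> C1" by blast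
      then have u2: "u \<in> C2" using s3 by blast
      let ?v = "\<lambda>g. \<omega>2 g - (\<omega>2 u / \<omega>3 u) * \<omega>3 g"
      have "\<omega>2 z \<noteq> 0" "\<omega>3 z = 0" "\<omega>3 u \<noteq> 0"
        using C(4) z3 u unfolding \<omega>2(2)[symmetric] by (auto simp: in_support)
      then have "?v z \<noteq> 0" by simp
      from circuit_through[OF diff[OF \<omega>2(1) \<omega>3(1)] this]
      obtain \<omega>4 where \<omega>4: "\<omega>4 \<in> S" "\<omega>4 z \<noteq> 0" "support \<omega>4 \<subseteq> support ?v"
        "matroid_circuit ind E (support \<omega>4)" by blast
      have s4: "support \<omega>4 \<subseteq> C2 \<union> support \<omega>3 - {u}"
      proof -
        have "support ?v \<subseteq> C2 \<union> support \<omega>3 - {u}"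
          using \<omega>2(2) \<open>\<omega>3 u \<noteq> 0\<close> by (auto simp: support_def)
        then show ?thesis using \<omega>4(3) by blast
      qed
      have "\<not> support \<omega>4 \<subseteq> C2" using circuit_subset_eq[OF \<omega>4(4) C(2)] u2 s4 by blast
      then obtain v where "v \<in> support \<omega>4" "v \<notin> C2" by blast
      then have ne: "C1 \<inter> support \<omega>4 \<noteq> {}" using s3 s4 by blast
      have "C1 \<union> support \<omega>4 \<subset> C1 \<union> C2" using s3 s4 u u2 by blast
      then have lt: "card (C1 \<union> support \<omega>4) < card (C1 \<union> C2)"
        using psubset_card_mono[OF fin] by blast
      have "z \<in> support \<omega>4" using \<omega>4(2) by (simp add: in_support)
      from less.hyps[OF lt C(1) \<omega>4(4) C(3) this ne] \<open>C1 \<union> support \<omega>4 \<subset> C1 \<union> C2\<close>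
      show ?thesis by blast
    qed
  qed
qed

text \<open>Every dependency is a sum of dependencies supported on circuits, and each circuit lies
  inside the class or misses it, by \<open>circuit_trans\<close>.\<close>

lemma restr_circuit_class:
  assumes "X \<subseteq> E" "\<omega> \<in> S" "support \<omega> \<subseteq> X"
  shows "restr (circuit_class ind X e) \<omega> \<in> S"
  using assms(2,3)
proof (induction "card (support \<omega>)" arbitrary: \<omega> rule: less_induct)
  case less
  let ?A = "circuit_class ind X e"
  show ?case
  proof (cases "support \<omega> = {}")
    case True
    then have "restr ?A \<omega> = (\<lambda>g. 0)" by (auto simp: restr_def support_def)
    then show ?thesis using zero by simp
  next
    case False
    then obtain f where f: "\<omega> f \<noteq> 0" by (auto simp: support_def)
    from circuit_through[OF less.prems(1) f]
    obtain \<tau> where \<tau>: "\<tau> \<in> S" "\<tau> f \<noteq> 0" "support \<tau> \<subseteq> support \<omega>"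
      "matroid_circuit ind E (support \<tau>)" by blast
    let ?w = "\<lambda>g. \<omega> g - (\<omega> f / \<tau> f) * \<tau> g"
    have sub: "support ?w \<subset> support \<omega>"
    proof -
      have "support ?w \<subseteq> support \<omega> - {f}" using \<tau> by (auto simp: support_def)
      then show ?thesis using f in_support[of f \<omega>] by blast
    qed
    have "restr ?A ?w \<in> S"
      using less.hyps[OF psubset_card_mono[OF finite_support[OF less.prems(1)] sub]
          diff[OF less.prems(1) \<tau>(1)]] sub less.prems(2) by blast
    moreover have "restr ?A \<tau> \<in> S"
    proof (cases "support \<tau> \<inter> ?A = {}")
      case True
      then have "restr ?A \<tau> = (\<lambda>g. 0)" by (auto simp: restr_def support_def fun_eq_iff)
      then show ?thesis using zero by simp
    next
      case False
      then obtain g where g: "g \<in> support \<tau>" "g \<in> ?A" by blast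
      have cX: "matroid_circuit ind X (support \<tau>)"
        using \<tau> less.prems(2) circuit_subset[OF assms(1)] by blast
      have "support \<tau> \<subseteq> ?A"
      proof
        fix h assume h: "h \<in> support \<tau>"
        show "h \<in> ?A"
        proof (cases "g = e")
          case True
          then show ?thesis using cX g h by (auto simp: circuit_class_def)
        next
          case False
          then obtain C where C: "matroid_circuit ind X C" "e \<in> C" "g \<in> C"
            using g by (auto simp: circuit_class_def)
          then have CE: "matroid_circuit ind E C" "C \<subseteq> X" using circuit_subset[OF assms(1)] by auto
          obtain D where D: "matroid_circuit ind E D" "e \<in> D" "h \<in> D" "D \<subseteq> C \<union> support \<tau>"
            using circuit_trans[OF CE(1) \<tau>(4) C(2) h] C(3) g(1) by blast
          moreover have "D \<subseteq> X" using D(4) CE(2) \<tau>(3) less.prems(2) by blast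
          ultimately show ?thesis using circuit_subset[OF assms(1)] by (auto simp: circuit_class_def)
        qed
      qed
      then have "restr ?A \<tau> = \<tau>" by (auto simp: restr_def support_def fun_eq_iff)
      then show ?thesis using \<tau> by simp
    qed
    ultimately have "(\<lambda>g. 1 * restr ?A ?w g + (\<omega> f / \<tau> f) * restr ?A \<tau> g) \<in> S" by (rule lin)
    moreover have "(\<lambda>g. 1 * restr ?A ?w g + (\<omega> f / \<tau> f) * restr ?A \<tau> g) = restr ?A \<omega>"
      by (auto simp: restr_def fun_eq_iff)
    ultimately show ?thesis by simp
  qed
qed

text \<open>A circuit through \<open>a\<close> and \<open>b\<close> would be cut by \<open>A\<close>
  into a nonempty proper part that is still dependent.\<close>

lemma connected_no_separator:
  assumes "matroid_connected ind X" "\<And>\<tau>. \<tau> \<in> S \<Longrightarrow> support \<tau> \<subseteq> X \<Longrightarrow> restr A \<tau> \<in> S"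
    "a \<in> X" "a \<in> A" "b \<in> X" "b \<notin> A"
  shows False
proof -
  obtain C where C: "matroid_circuit ind X C" "a \<in> C" "b \<in> C"
    using assms by (metis matroid_connected_def)
  obtain \<tau> where \<tau>: "\<tau> \<in> S" "support \<tau> = C" using circuit_stress[OF C(1)] by blast
  have "C \<subseteq> X" using C(1) by (simp add: matroid_circuit_def)
  then have r: "restr A \<tau> \<in> S" using assms(2) \<tau> by blast
  have s: "support (restr A \<tau>) = C \<inter> A" using \<tau>(2) by (auto simp: support_def restr_def)
  have "ind (C \<inter> A)" using C assms(6) by (auto simp: matroid_circuit_def)
  then show False using r s C(2) assms(4) by (auto simp: ind_def)
qed

section \<open>From minimal connectivity to series pairs\<close>

text \<open>The split is a class of \<open>X - {e}\<close>, where \<open>X\<close> is the class of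
  \<open>e\<close>. A dependency nonzero at \<open>e\<close> that missed one of the two sides could
  be used to clear the value at \<open>e\<close> of any other without affecting that side, which
  would then separate \<open>X\<close>.\<close>

lemma splittable_if_minimally_connected:
  assumes loopfree: "\<And>\<omega> e. \<omega> \<in> S \<Longrightarrow> \<omega> e \<noteq> 0 \<Longrightarrow> \<exists>f. f \<noteq> e \<and> \<omega> f \<noteq> 0"
    and conn: "\<And>e. e \<in> E \<Longrightarrow> card (circuit_class ind E e) \<ge> 2 \<Longrightarrow>
      matroid_connected ind (circuit_class ind E e) \<and>
      \<not> matroid_connected ind (circuit_class ind E e - {e})"
  shows splittable
  unfolding splittable_def
proof (intro ballI allI impI)
  fix \<omega>0 e assume \<omega>0: "\<omega>0 \<in> S" "\<omega>0 e \<noteq> 0"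
  define X where "X = circuit_class ind E e"
  have eE: "e \<in> E" using \<omega>0 support_E[OF \<omega>0(1)] in_support[of e \<omega>0] by blast
  have XE: "X \<subseteq> E" using eE by (auto simp: X_def circuit_class_def matroid_circuit_def)
  have eX: "e \<in> X" by (simp add: X_def circuit_class_def)
  obtain \<tau>0 where \<tau>0: "\<tau>0 \<in> S" "\<tau>0 e \<noteq> 0" "matroid_circuit ind E (support \<tau>0)"
    using circuit_through[OF \<omega>0] by blast
  obtain f where f: "f \<noteq> e" "\<tau>0 f \<noteq> 0" using loopfree[OF \<tau>0(1,2)] by blast
  have "f \<in> X" using \<tau>0 f by (auto simp: X_def circuit_class_def in_support)
  then have "card {e, f} \<le> card X"
    using eX XE finite_E finite_subset by (intro card_mono) auto
  then have "card X \<ge> 2" using f by simp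
  then have Xc: "matroid_connected ind X" "\<not> matroid_connected ind (X - {e})"
    using conn[OF eE] by (auto simp: X_def)
  obtain a b where ab: "a \<in> X - {e}" "b \<in> X - {e}" "a \<noteq> b"
    "\<And>C. \<not> (matroid_circuit ind (X - {e}) C \<and> a \<in> C \<and> b \<in> C)"
    using Xc(2) by (auto simp: matroid_connected_def)
  define A where "A = circuit_class ind (X - {e}) a"
  have AX: "A \<subseteq> X - {e}" using ab(1) by (auto simp: A_def circuit_class_def matroid_circuit_def)
  have aA: "a \<in> A" and bA: "b \<notin> A" using ab by (auto simp: A_def circuit_class_def)
  have rX: "restr X \<omega> \<in> S" if "\<omega> \<in> S" for \<omega>
    unfolding X_def using that support_E by (intro restr_circuit_class) auto
  have rA: "restr A \<omega> \<in> S" if "\<omega> \<in> S" "support \<omega> \<subseteq> X - {e}" for \<omega>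
    unfolding A_def using that XE by (intro restr_circuit_class) auto
  have rrA: "restr A \<omega> \<in> S" if "\<omega> \<in> S" "\<omega> e = 0" for \<omega>
  proof -
    have "support (restr X \<omega>) \<subseteq> X - {e}" using that by (auto simp: support_def restr_def)
    from rA[OF rX[OF that(1)] this] have "restr A (restr X \<omega>) \<in> S" .
    moreover have "restr A (restr X \<omega>) = restr A \<omega>" using AX by (auto simp: restr_def fun_eq_iff)
    ultimately show ?thesis by simp
  qed
  have "\<exists>a\<in>A. \<omega> a \<noteq> 0" if \<omega>: "\<omega> \<in> S" "\<omega> e \<noteq> 0" for \<omega>
  proof (rule ccontr)
    assume "\<not> (\<exists>a\<in>A. \<omega> a \<noteq> 0)"
    then have z: "\<And>a. a \<in> A \<Longrightarrow> \<omega> a = 0" by blast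
    have "restr A \<tau> \<in> S" if "\<tau> \<in> S" for \<tau>
    proof -
      have "restr A (\<lambda>g. \<tau> g - (\<tau> e / \<omega> e) * \<omega> g) \<in> S"
        using \<omega> that by (intro rrA diff) auto
      moreover have "restr A (\<lambda>g. \<tau> g - (\<tau> e / \<omega> e) * \<omega> g) = restr A \<tau>"
        using z by (auto simp: restr_def fun_eq_iff)
      ultimately show ?thesis by simp
    qed
    then show False using connected_no_separator[OF Xc(1), of A a e] ab aA AX eX by auto
  qed
  moreover have "\<exists>b. b \<notin> A \<and> b \<noteq> e \<and> \<omega> b \<noteq> 0" if \<omega>: "\<omega> \<in> S" "\<omega> e \<noteq> 0" for \<omega>
  proof (rule ccontr)
    assume "\<not> ?thesis"
    then have z: "\<And>b. b \<notin> A \<Longrightarrow> b \<noteq> e \<Longrightarrow> \<omega> b = 0" by blast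
    have "restr (X - insert e A) \<tau> \<in> S" if \<tau>: "\<tau> \<in> S" "support \<tau> \<subseteq> X" for \<tau>
    proof -
      let ?\<rho> = "\<lambda>g. \<tau> g - (\<tau> e / \<omega> e) * \<omega> g"
      have \<rho>: "?\<rho> \<in> S" using \<tau> \<omega> by (intro diff)
      have "restr A ?\<rho> \<in> S" using \<omega> by (intro rrA \<rho>) auto
      from diff[OF \<rho> this, of 1]
      have "(\<lambda>g. ?\<rho> g - 1 * restr A ?\<rho> g) \<in> S" .
      moreover have "(\<lambda>g. ?\<rho> g - 1 * restr A ?\<rho> g) = restr (X - insert e A) \<tau>"
      proof
        fix g
        have "g = e \<or> g \<in> A \<or> \<omega> g = 0" "g \<notin> X \<longrightarrow> \<tau> g = 0" using z \<tau>(2) by (auto simp: support_def)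
        then show "?\<rho> g - 1 * restr A ?\<rho> g = restr (X - insert e A) \<tau> g"
          using \<omega>(2) eX AX by (auto simp: restr_def)
      qed
      ultimately show ?thesis by simp
    qed
    then show False
      using connected_no_separator[OF Xc(1), of "X - insert e A" b e] ab bA eX by auto
  qed
  ultimately show "\<exists>A. valid_split e A"
    unfolding valid_split_def using rrA AX XE by (intro exI[of _ A]) auto
qed

lemma valid_split_meets:
  assumes "valid_split f B" "\<omega> \<in> S" "\<omega> f \<noteq> 0"
  shows "\<exists>b\<in>B. \<omega> b \<noteq> 0"
  using assms by (simp add: valid_split_def)

text \<open>The two sides of a split are interchangeable, so a side avoiding a given element can be
  chosen.\<close>

lemma valid_split_complement:
  assumes "valid_split f B"
  shows "valid_split f (E - insert f B)"
  unfolding valid_split_def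
proof (intro conjI ballI impI)
  fix \<omega> assume \<omega>: "\<omega> \<in> S" "\<omega> f = 0"
  then have "(\<lambda>g. \<omega> g - 1 * restr B \<omega> g) \<in> S" using assms by (intro diff) (auto simp: valid_split_def)
  moreover have "(\<lambda>g. \<omega> g - 1 * restr B \<omega> g) = restr (E - insert f B) \<omega>"
    using \<omega> support_E[OF \<omega>(1)] by (auto simp: restr_def fun_eq_iff support_def)
  ultimately show "restr (E - insert f B) \<omega> \<in> S" by simp
next
  fix \<omega> assume \<omega>: "\<omega> \<in> S" "\<omega> f \<noteq> 0"
  then show "\<exists>a\<in>E - insert f B. \<omega> a \<noteq> 0" "\<exists>b. b \<notin> E - insert f B \<and> b \<noteq> f \<and> \<omega> b \<noteq> 0"
    using assms support_E[OF \<omega>(1)] by (fastforce simp: valid_split_def support_def)+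
qed auto

text \<open>Take the split \<open>(e, A)\<close> with \<open>e\<close> in the support of \<open>\<omega>0\<close> and \<open>A\<close> smallest. If some \<open>f \<in> A\<close>
  in the support were not in series with \<open>e\<close>, a split \<open>(f, B)\<close> with \<open>e \<notin> B\<close> would yield the smaller
  split \<open>(f, A \<inter> B)\<close>.\<close>

lemma splittable_series_pair:
  assumes splittable "\<omega>0 \<in> S" "\<omega>0 e0 \<noteq> 0"
  obtains e f where "e \<noteq> f" "\<omega>0 e \<noteq> 0" "\<omega>0 f \<noteq> 0" "\<And>\<omega>. \<omega> \<in> S \<Longrightarrow> \<omega> e = 0 \<Longrightarrow> \<omega> f = 0"
proof -
  let ?P = "\<lambda>(e, A). \<omega>0 e \<noteq> 0 \<and> valid_split e A"
  obtain A0 where "valid_split e0 A0" using assms by (auto simp: splittable_def)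
  then have P0: "?P (e0, A0)" using assms by auto
  have "\<exists>p. ?P p \<and> (\<forall>q. ?P q \<longrightarrow> card (snd p) \<le> card (snd q))"
    using P0 by (rule ex_has_least_nat)
  then obtain p where p: "?P p" and pmin: "\<And>q. ?P q \<Longrightarrow> card (snd p) \<le> card (snd q)" by blast
  obtain e A where eA: "p = (e, A)" by (cases p)
  then have e: "\<omega>0 e \<noteq> 0" and A: "valid_split e A" using p by auto
  have min: "card A \<le> card B" if "\<omega>0 f \<noteq> 0" "valid_split f B" for f B
    using pmin[of "(f, B)"] that eA by auto
  obtain f where f: "f \<in> A" "\<omega>0 f \<noteq> 0" using A e assms(2) by (auto simp: valid_split_def)
  have "\<omega> f = 0" if \<omega>: "\<omega> \<in> S" "\<omega> e = 0" for \<omega>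
  proof (rule ccontr)
    assume nz: "\<omega> f \<noteq> 0"
    define \<sigma> where "\<sigma> = restr A \<omega>"
    have \<sigma>: "\<sigma> \<in> S" "\<sigma> f \<noteq> 0" "\<And>g. g \<notin> A \<Longrightarrow> \<sigma> g = 0"
      using A \<omega> nz f by (auto simp: \<sigma>_def valid_split_def restr_def)
    obtain B0 where "valid_split f B0" using assms(1) \<omega>(1) nz by (auto simp: splittable_def)
    then have "\<exists>B. valid_split f B \<and> e \<notin> B"
      using valid_split_complement[of f B0] by (cases "e \<in> B0") auto
    then obtain B where B: "valid_split f B" "e \<notin> B" by blast
    have r: "restr (A \<inter> B) \<tau> \<in> S" if \<tau>: "\<tau> \<in> S" "\<tau> f = 0" for \<tau>
    proof -
      have "restr B \<tau> \<in> S" using B \<tau> by (auto simp: valid_split_def)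
      moreover have "restr B \<tau> e = 0" using B by (simp add: restr_def)
      ultimately have "restr A (restr B \<tau>) \<in> S" using A by (auto simp: valid_split_def)
      moreover have "restr A (restr B \<tau>) = restr (A \<inter> B) \<tau>" by (auto simp: restr_def fun_eq_iff)
      ultimately show ?thesis by simp
    qed
    have ex: "\<exists>a\<in>A \<inter> B. \<tau> a \<noteq> 0" if \<tau>: "\<tau> \<in> S" "\<tau> f \<noteq> 0" for \<tau>
    proof (rule ccontr)
      assume "\<not> ?thesis"
      then have z: "\<And>a. a \<in> A \<Longrightarrow> a \<in> B \<Longrightarrow> \<tau> a = 0" by blast
      \<comment> \<open>\<open>?\<rho>\<close> vanishes at \<open>f\<close> and agrees with
        \<open>\<sigma>\<close> on \<open>A \<inter> B\<close>, where \<open>\<tau>\<close> is zero.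
        Since \<open>\<sigma>\<close> lives on \<open>A\<close>, subtracting the restriction clears
        it on all of \<open>B\<close> but keeps its value at \<open>f\<close>, contrary to the split
        at \<open>f\<close>.\<close>
      let ?\<rho> = "\<lambda>g. \<sigma> g - (\<sigma> f / \<tau> f) * \<tau> g"
      have "restr (A \<inter> B) ?\<rho> \<in> S" using \<tau> \<sigma> by (intro r diff) auto
      from diff[OF \<sigma>(1) this, of 1] have \<kappa>: "(\<lambda>g. \<sigma> g - 1 * restr (A \<inter> B) ?\<rho> g) \<in> S" .
      have "f \<notin> B" using B by (auto simp: valid_split_def)
      then have "(\<lambda>g. \<sigma> g - 1 * restr (A \<inter> B) ?\<rho> g) f \<noteq> 0" using \<sigma>(2) by (simp add: restr_def)
      then have "\<exists>b\<in>B. \<sigma> b - 1 * restr (A \<inter> B) ?\<rho> b \<noteq> 0"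
        by (rule valid_split_meets[OF B(1) \<kappa>])
      then obtain b where "b \<in> B" "\<sigma> b - 1 * restr (A \<inter> B) ?\<rho> b \<noteq> 0" by blast
      then show False using z \<sigma>(3) by (cases "b \<in> A") (auto simp: restr_def)
    qed
    have "valid_split f (A \<inter> B)"
      unfolding valid_split_def using A B r ex by (auto simp: valid_split_def)
    from min[OF f(2) this] have "card A \<le> card (A \<inter> B)" .
    moreover have "A \<inter> B \<subset> A" using f(1) B by (auto simp: valid_split_def)
    moreover have "finite A" using A finite_E finite_subset by (auto simp: valid_split_def)
    ultimately show False using psubset_card_mono[of A "A \<inter> B"] by simp
  qed
  moreover have "e \<noteq> f" using f A by (auto simp: valid_split_def)
  ultimately show thesis using that e f by blast
qed

text \<open>Being in series depends only on the circuits. Hence it is shared by frameworks with the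
  same independent sets, such as the two projections of \<open>q\<close>.\<close>

lemma series_iff_circuits:
  "(\<forall>\<omega>\<in>S. \<omega> e = 0 \<longrightarrow> \<omega> f = 0) \<longleftrightarrow> (\<forall>C. matroid_circuit ind E C \<longrightarrow> f \<in> C \<longrightarrow> e \<in> C)"
proof (intro iffI allI impI ballI)
  fix C assume s: "\<forall>\<omega>\<in>S. \<omega> e = 0 \<longrightarrow> \<omega> f = 0" and C: "matroid_circuit ind E C" "f \<in> C"
  obtain \<tau> where "\<tau> \<in> S" "support \<tau> = C" using circuit_stress[OF C(1)] by blast
  then show "e \<in> C" using s C(2) in_support[of _ \<tau>] by blast
next
  fix \<omega> assume c: "\<forall>C. matroid_circuit ind E C \<longrightarrow> f \<in> C \<longrightarrow> e \<in> C" and \<omega>: "\<omega> \<in> S" "\<omega> e = 0"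
  show "\<omega> f = 0"
  proof (rule ccontr)
    assume "\<omega> f \<noteq> 0"
    from circuit_through[OF \<omega>(1) this] obtain \<tau> where "\<tau> f \<noteq> 0" "support \<tau> \<subseteq> support \<omega>"
      "matroid_circuit ind E (support \<tau>)" by blast
    then show False using c \<omega>(2) in_support[of f \<tau>] in_support[of e \<omega>] by blast
  qed
qed

section \<open>Cobases as coordinates on the dependency space\<close>

text \<open>A smallest \<open>J\<close> inside \<open>N\<close> with \<open>E - J\<close>
  independent works. In the main application \<open>N\<close> consists of edges with a series
  partner.\<close>

lemma cobasis_exists:
  assumes "N \<subseteq> E" "\<And>\<omega>. \<omega> \<in> S \<Longrightarrow> (\<And>e. e \<in> N \<Longrightarrow> \<omega> e = 0) \<Longrightarrow> support \<omega> = {}"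
  obtains J where "J \<subseteq> N" "cobasis J"
proof -
  let ?P = "\<lambda>J. J \<subseteq> N \<and> ind (E - J)"
  have "\<omega> e = 0" if "support \<omega> \<subseteq> E - N" "e \<in> N" for \<omega> :: "'b \<Rightarrow> real" and e
    using that in_support[of e \<omega>] by blast
  then have "?P N" using assms(2) by (auto simp: ind_def)
  then have "\<exists>J. ?P J \<and> (\<forall>K. ?P K \<longrightarrow> card J \<le> card K)" by (rule ex_has_least_nat)
  then obtain J where J: "?P J" and min: "\<And>K. ?P K \<Longrightarrow> card J \<le> card K" by blast
  have "J \<subseteq> E" using J assms(1) by auto
  then have fin: "finite J" using finite_E by (rule finite_subset)
  have "\<not> ind (insert j (E - J))" if "j \<in> J" for j
  proof
    assume "ind (insert j (E - J))"
    moreover have "insert j (E - J) = E - (J - {j})" using that J assms(1) by blast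
    ultimately have "?P (J - {j})" using J by auto
    from min[OF this] card_Diff1_less[OF fin that] show False by simp
  qed
  then show thesis using that J assms(1) by (auto simp: cobasis_def)
qed

text \<open>\<open>W j\<close> is the dependency on the fundamental circuit of \<open>j\<close> with
  respect to the basis \<open>E - J\<close>, scaled to 1 at \<open>j\<close>.\<close>

lemma cobasis_dual:
  assumes "cobasis J"
  obtains W where "\<And>j. j \<in> J \<Longrightarrow> W j \<in> S" "\<And>i j. i \<in> J \<Longrightarrow> j \<in> J \<Longrightarrow> W j i = (if i = j then 1 else 0)"
    "\<And>\<omega> g. \<omega> \<in> S \<Longrightarrow> \<omega> g = (\<Sum>j\<in>J. \<omega> j * W j g)"
proof -
  have ex: "\<exists>w. w \<in> S \<and> (\<forall>i\<in>J. w i = (if i = j then 1 else 0))" if j: "j \<in> J" for j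
  proof -
    have "\<not> ind (insert j (E - J))" using assms j by (simp add: cobasis_def)
    then obtain w where w: "w \<in> S" "support w \<subseteq> insert j (E - J)" "support w \<noteq> {}"
      by (auto simp: ind_def)
    have "w j \<noteq> 0"
    proof
      assume "w j = 0"
      then have "support w \<subseteq> E - J" using w(2) by (auto simp: support_def)
      then show False using w(1,3) assms by (auto simp: cobasis_def ind_def)
    qed
    moreover have "w i = 0" if "i \<in> J" "i \<noteq> j" for i using that w(2) by (auto simp: support_def)
    ultimately show ?thesis using scale[OF w(1), of "1 / w j"]
      by (intro exI[of _ "\<lambda>g. 1 / w j * w g"]) auto
  qed
  define W where "W j = (SOME w. w \<in> S \<and> (\<forall>i\<in>J. w i = (if i = j then 1 else 0)))" for j
  have W: "W j \<in> S" "i \<in> J \<Longrightarrow> W j i = (if i = j then 1 else 0)" if "j \<in> J" for i j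
    using someI_ex[OF ex[OF that]] by (auto simp: W_def)
  have fin: "finite J" using assms finite_E finite_subset by (auto simp: cobasis_def)
  have "\<omega> g = (\<Sum>j\<in>J. \<omega> j * W j g)" if \<omega>: "\<omega> \<in> S" for \<omega> g
  proof -
    let ?\<rho> = "\<lambda>g. \<omega> g - 1 * (\<Sum>j\<in>J. \<omega> j * W j g)"
    have \<rho>: "?\<rho> \<in> S" using \<omega> W(1) by (intro diff sum_in)
    have "?\<rho> i = 0" if "i \<in> J" for i
      using W(2)[OF _ that] that fin by (simp add: if_distrib[of "(*) _"] cong: if_cong)
    then have "support ?\<rho> \<subseteq> E - J" using support_E[OF \<rho>] by (auto simp: in_support)
    then have "support ?\<rho> = {}" using assms \<rho> by (auto simp: cobasis_def ind_def)
    then show ?thesis using in_support[of g ?\<rho>] by auto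
  qed
  then show thesis using that[of W] W by simp
qed

text \<open>No nonzero combination of fundamental dependencies is supported in an independent set
  \<open>I\<close>, so they stay independent on \<open>E - I\<close>, which therefore has at least
  \<open>card J\<close> elements.\<close>

lemma cobasis_rank:
  assumes "cobasis J"
  shows "matroid_rank ind E = card E - card J"
proof -
  have J: "J \<subseteq> E" "finite J" using assms finite_E finite_subset by (auto simp: cobasis_def)
  have le: "card I \<le> card E - card J" if I: "I \<subseteq> E" "ind I" for I
  proof -
    obtain W where W: "\<And>j. j \<in> J \<Longrightarrow> W j \<in> S"
      "\<And>i j. i \<in> J \<Longrightarrow> j \<in> J \<Longrightarrow> W j i = (if i = j then 1 else 0)"
      using cobasis_dual[OF assms] by metis
    have "lin_indep W J (E - I)"
      unfolding lin_indep_def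
    proof (intro allI impI ballI)
      fix c j assume c: "\<forall>g\<in>E - I. (\<Sum>j\<in>J. c j * W j g) = 0" and j: "j \<in> J"
      let ?w = "\<lambda>g. \<Sum>j\<in>J. c j * W j g"
      have w: "?w \<in> S" using W(1) by (rule sum_in)
      have "support ?w \<subseteq> I" using c support_E[OF w] by (auto simp: in_support)
      then have "support ?w = {}" using I(2) w by (auto simp: ind_def)
      then have "?w j = 0" using in_support[of j ?w] by auto
      then show "c j = 0" using W(2)[OF j] j J(2) by (simp add: if_distrib[of "(*) _"] cong: if_cong)
    qed
    then have "card J \<le> card (E - I)" using lin_indep_card_le[OF J(2)] finite_E by blast
    then show ?thesis using I(1) card_mono[OF finite_E I(1)] card_Diff_subset[OF finite_subset[OF I(1) finite_E] I(1)]
      by simp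
  qed
  have in_: "E - J \<in> {I. I \<subseteq> E \<and> ind I}" using assms by (auto simp: cobasis_def)
  have card: "card (E - J) = card E - card J" using J by (simp add: card_Diff_subset)
  show ?thesis
    unfolding matroid_rank_def
  proof (rule Max_eqI)
    show "finite (card ` {I. I \<subseteq> E \<and> ind I})" using finite_E by simp
    show "card E - card J \<in> card ` {I. I \<subseteq> E \<and> ind I}" using in_ card by (metis image_eqI)
  qed (use le in auto)
qed

lemma almost_ind_nonzero:
  assumes "ind (D - {e})" "\<omega> \<in> S" "support \<omega> \<subseteq> D" "support \<omega> \<noteq> {}"
  shows "\<omega> e \<noteq> 0"
proof
  assume "\<omega> e = 0"
  then have "support \<omega> \<subseteq> D - {e}" using assms(3) in_support[of e \<omega>] by auto
  then show False using assms by (auto simp: ind_def)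
qed

text \<open>Since \<open>D - {e}\<close> carries no dependency, the value at \<open>e\<close>
  determines a dependency inside \<open>D\<close>: they form a line.\<close>

lemma almost_ind_proportional:
  assumes "ind (D - {e})" "\<omega> \<in> S" "support \<omega> \<subseteq> D" "\<omega> e \<noteq> 0" "\<tau> \<in> S" "support \<tau> \<subseteq> D"
  shows "\<tau> g * \<omega> e = \<tau> e * \<omega> g"
proof -
  let ?\<rho> = "\<lambda>g. \<tau> g - (\<tau> e / \<omega> e) * \<omega> g"
  have "?\<rho> \<in> S" using assms by (intro diff)
  moreover have "support ?\<rho> \<subseteq> D"
    using assms(3,6) support_diff[of \<tau> "\<tau> e / \<omega> e" \<omega>] by blast
  moreover have "?\<rho> e = 0" using assms(4) by simp
  ultimately have "support ?\<rho> = {}" using almost_ind_nonzero[OF assms(1)] by blast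
  then have "?\<rho> g = 0" using in_support[of g ?\<rho>] by simp
  then show ?thesis using assms(4) by (simp add: field_simps)
qed

lemma zero_on_E: "\<omega> \<in> S \<Longrightarrow> (\<And>e. e \<in> E \<Longrightarrow> \<omega> e = 0) \<Longrightarrow> support \<omega> = {}"
  using support_E[of \<omega>] by (auto simp: support_def)

lemma series_proportional:
  assumes "\<And>\<omega>. \<omega> \<in> S \<Longrightarrow> \<omega> e = 0 \<Longrightarrow> \<omega> f = 0" "\<omega> \<in> S" "\<tau> \<in> S"
  shows "\<omega> f * \<tau> e = \<omega> e * \<tau> f"
proof (cases "\<tau> e = 0")
  case False
  have "(\<lambda>g. \<omega> g - (\<omega> e / \<tau> e) * \<tau> g) f = 0"
    by (rule assms(1)[OF diff[OF assms(2,3)]]) (simp add: False)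
  then show ?thesis using False by (simp add: field_simps)
qed (simp add: assms(1)[OF assms(3)])

end

section \<open>Equilibrium stresses\<close>

definition coord :: "('a \<Rightarrow> nat \<Rightarrow> real) \<Rightarrow> nat \<Rightarrow> 'a \<Rightarrow> real" where
  "coord p i v = p v i"

definition delta :: "'a \<Rightarrow> 'a \<Rightarrow> real" where
  "delta v w = (if w = v then 1 else 0)"

text \<open>The contribution \<open>(y u - y v) * (h u - h v)\<close> of an edge
  \<open>{u, v}\<close>; the sum over its vertices avoids a choice of endpoints.\<close>

definition edge_form :: "'a set \<Rightarrow> ('a \<Rightarrow> real) \<Rightarrow> ('a \<Rightarrow> real) \<Rightarrow> real" where
  "edge_form g y h = (\<Sum>v\<in>g. y v * (\<Sum>w\<in>g - {v}. h v - h w))"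

lemma edge_form_pair: "u \<noteq> v \<Longrightarrow> edge_form {u, v} y h = (y u - y v) * (h u - h v)"
proof -
  assume a: "u \<noteq> v"
  then have "{u, v} - {u} = {v}" "{u, v} - {v} = {u}" by auto
  then show ?thesis using a by (simp add: edge_form_def algebra_simps)
qed

lemma edge_form_delta:
  assumes "finite g"
  shows "edge_form g (delta v) (coord p i) = rigidity_matrix p g (v, i)"
  using assms by (simp add: edge_form_def delta_def rigidity_matrix_def coord_def
      if_distrib[of "\<lambda>x. x * _"] cong: if_cong)

lemma edge_form_cong_on: "(\<And>v. v \<in> g \<Longrightarrow> h v = h' v) \<Longrightarrow> edge_form g y h = edge_form g y h'"
  unfolding edge_form_def by (intro sum.cong refl arg_cong[of _ _ "(*) _"]) auto

locale graph =
  fixes V :: "'a set" and E :: "'a set set"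
  assumes simple: "simple_graph V E"
begin

text \<open>In terms of the stress matrix \<open>\<Omega>\<^sub>\<omega>\<close> this is \<open>y\<^sup>T \<Omega>\<^sub>\<omega> h\<close>.\<close>

definition bform :: "('a set \<Rightarrow> real) \<Rightarrow> ('a \<Rightarrow> real) \<Rightarrow> ('a \<Rightarrow> real) \<Rightarrow> real" where
  "bform \<omega> y h = (\<Sum>g\<in>E. \<omega> g * edge_form g y h)"

text \<open>\<open>C\<close> selects coordinates, so that the stresses of different projections of
  one framework can be compared.\<close>

definition stresses :: "nat set \<Rightarrow> ('a \<Rightarrow> nat \<Rightarrow> real) \<Rightarrow> ('a set \<Rightarrow> real) set" where
  "stresses C p = {\<omega>. support \<omega> \<subseteq> E \<and> (\<forall>i\<in>C. \<forall>y. bform \<omega> y (coord p i) = 0)}"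

lemma finite_V: "finite V" and finite_E: "finite E"
proof -
  show "finite V" using simple by (simp add: simple_graph_def)
  moreover have "E \<subseteq> Pow V" using simple by (auto simp: simple_graph_def)
  ultimately show "finite E" using finite_subset by auto
qed

lemma edge_pair:
  assumes "g \<in> E"
  obtains u v where "u \<noteq> v" "u \<in> V" "v \<in> V" "g = {u, v}"
proof -
  have "card g = 2" "g \<subseteq> V" using assms simple by (auto simp: simple_graph_def)
  then show thesis using that by (auto simp: card_2_iff)
qed

lemma edge_subset: "g \<in> E \<Longrightarrow> g \<subseteq> V" and finite_edge: "g \<in> E \<Longrightarrow> finite g"
  by (auto elim!: edge_pair)

lemma edge_form_add: "g \<in> E \<Longrightarrow> edge_form g (\<lambda>v. a * y v + b * z v) h = a * edge_form g y h + b * edge_form g z h"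
  by (erule edge_pair) (simp add: edge_form_pair algebra_simps)

lemma edge_form_sym: "g \<in> E \<Longrightarrow> edge_form g y h = edge_form g h y"
  by (erule edge_pair) (simp add: edge_form_pair algebra_simps)

lemma edge_form_const: "g \<in> E \<Longrightarrow> edge_form g (\<lambda>v. y v + c) h = edge_form g y h"
  by (erule edge_pair) (simp add: edge_form_pair)

lemma edge_form_sum: "g \<in> E \<Longrightarrow> edge_form g (\<lambda>v. \<Sum>i\<in>I. a i * y i v) h = (\<Sum>i\<in>I. a i * edge_form g (y i) h)"
  by (erule edge_pair)
    (simp add: edge_form_pair sum_subtractf[symmetric] sum_distrib_right,
      simp add: algebra_simps sum_subtractf sum.distrib)

lemma edge_form_cong:
  "g \<in> E \<Longrightarrow> (\<And>v. v \<in> V \<Longrightarrow> y v = y' v) \<Longrightarrow> (\<And>v. v \<in> V \<Longrightarrow> h v = h' v) \<Longrightarrow> edge_form g y h = edge_form g y' h'"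
  by (erule edge_pair) (simp add: edge_form_pair)

lemma bform_sym: "bform \<omega> y h = bform \<omega> h y"
  unfolding bform_def by (intro sum.cong refl) (simp add: edge_form_sym)

lemma bform_add: "bform \<omega> (\<lambda>v. a * y v + b * z v) h = a * bform \<omega> y h + b * bform \<omega> z h"
  unfolding bform_def sum_distrib_left sum.distrib[symmetric]
  by (intro sum.cong refl) (simp add: edge_form_add algebra_simps)

lemma bform_const: "bform \<omega> (\<lambda>v. y v + c) h = bform \<omega> y h"
  unfolding bform_def by (intro sum.cong refl) (simp add: edge_form_const)

lemma bform_sum: "bform \<omega> (\<lambda>v. \<Sum>i\<in>I. a i * y i v) h = (\<Sum>i\<in>I. a i * bform \<omega> (y i) h)"
proof -
  have "bform \<omega> (\<lambda>v. \<Sum>i\<in>I. a i * y i v) h = (\<Sum>g\<in>E. \<Sum>i\<in>I. a i * (\<omega> g * edge_form g (y i) h))"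
    unfolding bform_def by (intro sum.cong refl) (simp add: edge_form_sum sum_distrib_left algebra_simps)
  also have "\<dots> = (\<Sum>i\<in>I. \<Sum>g\<in>E. a i * (\<omega> g * edge_form g (y i) h))" by (rule sum.swap)
  finally show ?thesis by (simp add: bform_def sum_distrib_left)
qed

lemma bform_cong:
  "(\<And>v. v \<in> V \<Longrightarrow> y v = y' v) \<Longrightarrow> (\<And>v. v \<in> V \<Longrightarrow> h v = h' v) \<Longrightarrow> bform \<omega> y h = bform \<omega> y' h'"
  unfolding bform_def by (intro sum.cong refl arg_cong[of _ _ "(*) _"] edge_form_cong) auto

lemma bform_lin: "bform (\<lambda>g. a * \<omega> g + b * \<tau> g) y h = a * bform \<omega> y h + b * bform \<tau> y h"
  by (simp add: bform_def sum_distrib_left sum.distrib algebra_simps)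

lemma bform_stress_sum:
  "bform (\<lambda>g. \<Sum>j\<in>J. c j * W j g) y h = (\<Sum>j\<in>J. c j * bform (W j) y h)"
proof -
  have "bform (\<lambda>g. \<Sum>j\<in>J. c j * W j g) y h = (\<Sum>g\<in>E. \<Sum>j\<in>J. c j * (W j g * edge_form g y h))"
    unfolding bform_def by (intro sum.cong refl) (simp add: sum_distrib_right mult.assoc)
  also have "\<dots> = (\<Sum>j\<in>J. \<Sum>g\<in>E. c j * (W j g * edge_form g y h))" by (rule sum.swap)
  finally show ?thesis by (simp add: bform_def sum_distrib_left)
qed

lemma bform_delta: "bform \<omega> y h = (\<Sum>v\<in>V. y v * bform \<omega> (delta v) h)"
proof -
  have "bform \<omega> y h = bform \<omega> (\<lambda>w. \<Sum>v\<in>V. y v * delta v w) h"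
  proof (rule bform_cong)
    fix w assume "w \<in> V"
    then show "y w = (\<Sum>v\<in>V. y v * delta v w)"
      using finite_V by (simp add: delta_def if_distrib[of "(*) _"] cong: if_cong)
  qed simp
  then show ?thesis by (simp add: bform_sum)
qed

lemma bform_delta_delta:
  assumes "u \<in> V" "v \<in> V" "u \<noteq> v" "support \<omega> \<subseteq> E"
  shows "bform \<omega> (delta u) (delta v) = - \<omega> {u, v}"
proof -
  have "bform \<omega> (delta u) (delta v) = (\<Sum>g\<in>E. if g = {u, v} then - \<omega> g else 0)"
    unfolding bform_def
  proof (intro sum.cong refl)
    fix g assume "g \<in> E"
    then show "\<omega> g * edge_form g (delta u) (delta v) = (if g = {u, v} then - \<omega> g else 0)"
      using assms(3) by (elim edge_pair) (auto simp: edge_form_pair delta_def doubleton_eq_iff)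
  qed
  also have "\<dots> = - \<omega> {u, v}"
    using finite_E assms(4) by (auto simp: support_def)
  finally show ?thesis .
qed

lemma stressesD: "\<omega> \<in> stresses C p \<Longrightarrow> i \<in> C \<Longrightarrow> bform \<omega> y (coord p i) = 0"
  by (simp add: stresses_def)

lemma stressesI:
  assumes "support \<omega> \<subseteq> E" "\<And>i v. i \<in> C \<Longrightarrow> v \<in> V \<Longrightarrow> bform \<omega> (delta v) (coord p i) = 0"
  shows "\<omega> \<in> stresses C p"
proof -
  have "bform \<omega> y (coord p i) = 0" if "i \<in> C" for y i
    by (subst bform_delta) (simp add: assms(2) that)
  then show ?thesis using assms(1) by (simp add: stresses_def)
qed

lemma stresses_mono: "C \<subseteq> D \<Longrightarrow> stresses D p \<subseteq> stresses C p"
  by (auto simp: stresses_def)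

lemma stresses_cong:
  assumes "\<And>v i. v \<in> V \<Longrightarrow> i \<in> C \<Longrightarrow> p v i = p' v i"
  shows "stresses C p = stresses C p'"
proof -
  have "bform \<omega> y (coord p i) = bform \<omega> y (coord p' i)" if "i \<in> C" for \<omega> y i
    using assms that by (intro bform_cong) (auto simp: coord_def)
  then show ?thesis by (auto simp: stresses_def)
qed

lemma stresses_reindex:
  assumes "\<sigma> ` C = C'"
  shows "stresses C (\<lambda>v i. p v (\<sigma> i)) = stresses C' p"
proof -
  have "coord (\<lambda>v i. p v (\<sigma> i)) i = coord p (\<sigma> i)" for i by (simp add: coord_def fun_eq_iff)
  then show ?thesis using assms by (auto simp: stresses_def)
qed

sublocale stress: dependency_space "stresses C p" E for C p
proof
  show "finite E" by (rule finite_E)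
  show "support \<omega> \<subseteq> E" if "\<omega> \<in> stresses C p" for \<omega> using that by (simp add: stresses_def)
  show "(\<lambda>g. 0) \<in> stresses C p" by (simp add: stresses_def support_def bform_def)
  show "(\<lambda>g. a * \<omega> g + b * \<tau> g) \<in> stresses C p"
    if "\<omega> \<in> stresses C p" "\<tau> \<in> stresses C p" for \<omega> \<tau> a b
  proof -
    have "support (\<lambda>g. a * \<omega> g + b * \<tau> g) \<subseteq> support \<omega> \<union> support \<tau>" by (auto simp: support_def)
    then show ?thesis using that by (auto simp: stresses_def bform_lin)
  qed
qed

abbreviation "indep C p \<equiv> stress.ind C p"

lemma lin_indep_iff:
  assumes "F \<subseteq> E"
  shows "lin_indep (rigidity_matrix p) F (V \<times> C) \<longleftrightarrow> indep C p F"
proof -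
  have sum: "(\<Sum>g\<in>F. c g * rigidity_matrix p g (v, i)) = bform (restr F c) (delta v) (coord p i)" for c v i
  proof -
    have "bform (restr F c) (delta v) (coord p i) = (\<Sum>g\<in>E. restr F c g * rigidity_matrix p g (v, i))"
      unfolding bform_def by (intro sum.cong refl) (simp add: edge_form_delta finite_edge)
    also have "\<dots> = (\<Sum>g\<in>F. c g * rigidity_matrix p g (v, i))"
      using assms finite_E by (intro sum.mono_neutral_cong_right) (auto simp: restr_def)
    finally show ?thesis by simp
  qed
  show ?thesis
  proof
    assume L: "lin_indep (rigidity_matrix p) F (V \<times> C)"
    show "indep C p F"
      unfolding stress.ind_def
    proof (intro ballI impI)
      fix \<omega> assume \<omega>: "\<omega> \<in> stresses C p" "support \<omega> \<subseteq> F"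
      then have r: "restr F \<omega> = \<omega>" by (auto simp: restr_def support_def fun_eq_iff)
      have "\<omega> g = 0" if "g \<in> F" for g
        by (rule lin_indepD[OF L _ that]) (use \<omega> r in \<open>auto simp: sum stressesD\<close>)
      then show "support \<omega> = {}" using \<omega>(2) by (auto simp: support_def)
    qed
  next
    assume I: "indep C p F"
    show "lin_indep (rigidity_matrix p) F (V \<times> C)"
      unfolding lin_indep_def
    proof (intro allI impI ballI)
      fix c g assume c: "\<forall>j\<in>V \<times> C. (\<Sum>g\<in>F. c g * rigidity_matrix p g j) = 0" and g: "g \<in> F"
      have "restr F c \<in> stresses C p"
        using c assms by (intro stressesI) (auto simp: sum[symmetric] restr_def support_def split: if_splits)
      moreover have "support (restr F c) \<subseteq> F" by (auto simp: restr_def support_def)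
      ultimately have "support (restr F c) = {}" using I by (auto simp: stress.ind_def)
      then show "c g = 0" using g in_support[of g "restr F c"] by (auto simp: restr_def)
    qed
  qed
qed

lemma rigidity_indep_iff:
  assumes "F \<subseteq> E"
  shows "rigidity_indep k p V F \<longleftrightarrow> indep {..<k} p F"
  using lin_indep_iff[OF assms, of p "{..<k}"] by (simp add: rigidity_indep_def lin_indep_def)

lemma row_dot:
  assumes "g \<in> E" "finite C"
  shows "(\<Sum>(v, i)\<in>V \<times> C. rigidity_matrix p g (v, i) * Y v i) = (\<Sum>i\<in>C. edge_form g (coord Y i) (coord p i))"
proof -
  have "(\<Sum>v\<in>V. rigidity_matrix p g (v, i) * Y v i) = edge_form g (coord Y i) (coord p i)" for i
  proof -
    have "edge_form g (coord Y i) (coord p i) = edge_form g (\<lambda>w. \<Sum>v\<in>V. Y v i * delta v w) (coord p i)"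
      using assms(1) finite_V
      by (intro edge_form_cong) (simp_all add: coord_def delta_def if_distrib[of "(*) _"] cong: if_cong)
    also have "\<dots> = (\<Sum>v\<in>V. Y v i * edge_form g (delta v) (coord p i))"
      by (rule edge_form_sum[OF assms(1)])
    finally show ?thesis
      using assms(1) by (simp add: edge_form_delta finite_edge mult.commute)
  qed
  then show ?thesis by (simp add: sum.cartesian_product[symmetric] sum.swap[of _ C V])
qed

text \<open>The framework \<open>p\<close> may be arbitrary: placing its coordinates
  \<open>C'\<close> at the positions \<open>C\<close> gives a special point, and independence there
  carries over to the generic \<open>q\<close>.\<close>

lemma generic_indep:
  assumes "generic_framework n V q" "F \<subseteq> E" "C \<subseteq> {..<n}" "bij_betw \<sigma> C C'" "indep C' p F"
  shows "indep C q F"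
proof -
  let ?r = "\<lambda>x g. rigidity_matrix (\<lambda>v i. x (v, i)) g"
  let ?x0 = "\<lambda>(v, l). p v (\<sigma> l)"
  have L: "lin_indep (rigidity_matrix p) F (V \<times> C')" using lin_indep_iff assms(2,5) by blast
  have eq: "?r ?x0 g (v, l) = rigidity_matrix p g (v, \<sigma> l)" for g v l
    by (simp add: rigidity_matrix_def)
  have "lin_indep (?r ?x0) F (V \<times> C)"
    unfolding lin_indep_def
  proof (intro allI impI ballI)
    fix c g assume c: "\<forall>j\<in>V \<times> C. (\<Sum>g\<in>F. c g * ?r ?x0 g j) = 0" and g: "g \<in> F"
    have "(\<Sum>g\<in>F. c g * rigidity_matrix p g j) = 0" if j: "j \<in> V \<times> C'" for j
    proof -
      obtain v l where "j = (v, \<sigma> l)" "v \<in> V" "l \<in> C"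
        using j assms(4) by (auto simp: bij_betw_def)
      then show ?thesis using bspec[OF c, of "(v, l)"] unfolding eq by auto
    qed
    then show "c g = 0" using lin_indepD[OF L _ g, of c] by blast
  qed
  then have "lin_indep (?r (\<lambda>(v, i). q v i)) F (V \<times> C)"
  proof (rule alg_indep_lin_indep[rotated -1])
    show "algebraically_independent_over_rat (V \<times> {..<n}) (\<lambda>(v, i). q v i)"
      using assms(1) by (simp add: generic_framework_def)
    show "finite F" using assms(2) finite_E finite_subset by blast
    show "rat_poly_fun (V \<times> {..<n}) (\<lambda>x. ?r x g j)" if "g \<in> F" "j \<in> V \<times> C" for g j
    proof -
      obtain v i where j: "j = (v, i)" "v \<in> V" "i < n" using \<open>j \<in> V \<times> C\<close> assms(3) by auto
      have "g \<subseteq> V" using \<open>g \<in> F\<close> assms(2) edge_subset by blast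
      then show ?thesis
        unfolding rigidity_matrix_def j(1) using j
        by (cases "v \<in> g") (auto intro!: rat_poly_fun_sum rat_poly_fun_diff rat_poly_fun.var rat_poly_fun_0)
    qed
  qed
  then show ?thesis using lin_indep_iff[OF assms(2), of q C] by simp
qed

section \<open>Projective images and stresses of complete graphs\<close>

text \<open>Multiplied by both factors, the difference of the projected coordinates along an edge
  becomes a combination of edge terms in the coordinates \<open>i\<close> and 0 of \<open>p\<close>
  with altered test functions. The stress is in equilibrium in both, hence
  \<open>0 \<in> C\<close>.\<close>

lemma stresses_projective:
  assumes "\<omega> \<in> stresses C p" "0 \<in> C" "\<And>v. v \<in> V \<Longrightarrow> 1 + t * p v 0 \<noteq> 0"
  shows "(\<lambda>g. \<omega> g * (\<Prod>v\<in>g. 1 + t * p v 0)) \<in> stresses C (\<lambda>v i. p v i / (1 + t * p v 0))"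
    (is "?\<omega> \<in> stresses C ?p")
proof (rule stressesI)
  show "support ?\<omega> \<subseteq> E" using stress.support_E[OF assms(1)] by (auto simp: support_def)
  fix i and v :: 'a assume i: "i \<in> C"
  let ?y = "delta v"
  have edge: "(\<Prod>v\<in>g. 1 + t * p v 0) * edge_form g ?y (coord ?p i)
      = 1 * edge_form g (\<lambda>v. (1 + t * p v 0) * ?y v) (coord p i)
        + (- t) * edge_form g (\<lambda>v. p v i * ?y v) (coord p 0)" if g: "g \<in> E" for g
  proof -
    obtain u w where uw: "u \<noteq> w" "u \<in> V" "w \<in> V" "g = {u, w}" using edge_pair[OF g] by blast
    have n: "1 + t * p u 0 \<noteq> 0" "1 + t * p w 0 \<noteq> 0" using assms(3) uw by auto
    define a b y z where "a = 1 + t * p u 0" and "b = 1 + t * p w 0" and "y = ?y u" and "z = ?y w"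
    have "(a * b) * ((y - z) * (p u i / a - p w i / b)) = (y - z) * (p u i * b - p w i * a)"
      using n by (simp add: a_def[symmetric] b_def[symmetric] field_simps)
    also have "\<dots> = (a * y - b * z) * (p u i - p w i) - t * ((p u i * y - p w i * z) * (p u 0 - p w 0))"
      by (simp add: a_def b_def algebra_simps)
    finally show ?thesis
      using uw(1) by (simp add: uw(4) edge_form_pair coord_def a_def b_def y_def z_def)
  qed
  have "bform ?\<omega> ?y (coord ?p i) = 1 * bform \<omega> (\<lambda>v. (1 + t * p v 0) * ?y v) (coord p i)
      + (- t) * bform \<omega> (\<lambda>v. p v i * ?y v) (coord p 0)"
    unfolding bform_def sum_distrib_left sum.distrib[symmetric]
    by (intro sum.cong refl) (simp only: mult.assoc edge, simp add: algebra_simps)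
  then show "bform ?\<omega> ?y (coord ?p i) = 0" using stressesD[OF assms(1)] i assms(2) by simp
qed

lemma bform_one: "bform \<omega> (\<lambda>v. c) h = 0"
  using bform_const[of \<omega> "\<lambda>v. 0" c h] bform_add[of \<omega> 0 "\<lambda>v. 0" 0 "\<lambda>v. 0" h] by simp

lemma edge_form_delta_outside: "g \<in> E \<Longrightarrow> v \<notin> g \<Longrightarrow> edge_form g (delta v) h = 0"
  by (simp add: edge_form_def delta_def finite_edge if_distrib[of "\<lambda>x. x * _"] cong: if_cong)

text \<open>The values \<open>u v * u w\<close> have the stress matrix \<open>- u u^T\<close>, and
  an affine dependency \<open>u\<close> is orthogonal to the coordinates and to the
  constants.\<close>

lemma complete_stress:
  assumes "X \<subseteq> V" "\<And>v w. v \<in> X \<Longrightarrow> w \<in> X \<Longrightarrow> v \<noteq> w \<Longrightarrow> {v, w} \<in> E"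
    "(\<Sum>v\<in>X. u v) = 0" "\<And>i. i \<in> C \<Longrightarrow> (\<Sum>v\<in>X. u v * p v i) = 0"
  shows "(\<lambda>g. if g \<in> E \<and> g \<subseteq> X then \<Prod>v\<in>g. u v else 0) \<in> stresses C p" (is "?\<omega> \<in> _")
proof (rule stressesI)
  show "support ?\<omega> \<subseteq> E" by (auto simp: support_def)
  fix i v assume i: "i \<in> C"
  have fin: "finite X" using assms(1) finite_V finite_subset by blast
  show "bform ?\<omega> (delta v) (coord p i) = 0"
  proof (cases "v \<in> X")
    case False
    have "?\<omega> g * edge_form g (delta v) (coord p i) = 0" if "g \<in> E" for g
    proof (cases "g \<subseteq> X")
      case True
      then have "v \<notin> g" using False by blast
      then show ?thesis using that by (simp add: edge_form_delta_outside)
    qed simp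
    then show ?thesis unfolding bform_def by (intro sum.neutral) blast
  next
    case True
    let ?t = "\<lambda>g. ?\<omega> g * edge_form g (delta v) (coord p i)"
    have "bform ?\<omega> (delta v) (coord p i) = (\<Sum>g\<in>(\<lambda>w. {v, w}) ` (X - {v}). ?t g)"
      unfolding bform_def
    proof (rule sum.mono_neutral_right[OF finite_E])
      show "(\<lambda>w. {v, w}) ` (X - {v}) \<subseteq> E" using assms(2) True by auto
      show "\<forall>g\<in>E - (\<lambda>w. {v, w}) ` (X - {v}). ?t g = 0"
      proof
        fix g assume g: "g \<in> E - (\<lambda>w. {v, w}) ` (X - {v})"
        then obtain a b where ab: "g = {a, b}" "a \<noteq> b" using edge_pair by blast
        then have "v \<notin> g \<or> \<not> g \<subseteq> X" using g by (auto simp: insert_commute)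
        then show "?t g = 0" using g by (auto simp: edge_form_delta_outside)
      qed
    qed
    also have "\<dots> = (\<Sum>w\<in>X - {v}. ?t {v, w})"
      by (subst sum.reindex) (auto simp: inj_on_def doubleton_eq_iff)
    also have "\<dots> = (\<Sum>w\<in>X - {v}. u v * (u w * p v i - u w * p w i))"
      using assms(2) True by (intro sum.cong refl) (auto simp: edge_form_pair delta_def coord_def algebra_simps)
    also have "\<dots> = u v * ((\<Sum>w\<in>X - {v}. u w) * p v i - (\<Sum>w\<in>X - {v}. u w * p w i))"
      by (simp add: sum_distrib_left[symmetric] sum_distrib_right sum_subtractf)
    also have "(\<Sum>w\<in>X - {v}. u w) = - u v" using assms(3) sum.remove[OF fin True, of u] by simp
    also have "(\<Sum>w\<in>X - {v}. u w * p w i) = - u v * p v i"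
      using assms(4)[OF i] sum.remove[OF fin True, of "\<lambda>w. u w * p w i"] by simp
    finally show ?thesis by simp
  qed
qed

lemma bform_delta_nbrs:
  assumes "support \<omega> \<subseteq> E" "v \<in> V"
  shows "bform \<omega> (delta v) h = (\<Sum>w\<in>V - {v}. \<omega> {v, w} * (h v - h w))"
proof -
  have *: "bform \<omega> y (delta v) = y v * bform \<omega> (delta v) (delta v) - (\<Sum>w\<in>V - {v}. y w * \<omega> {v, w})" for y
  proof -
    have "bform \<omega> y (delta v) = (\<Sum>w\<in>V. y w * bform \<omega> (delta w) (delta v))" by (rule bform_delta)
    also have "\<dots> = y v * bform \<omega> (delta v) (delta v) + (\<Sum>w\<in>V - {v}. y w * bform \<omega> (delta w) (delta v))"
      using finite_V assms(2) by (rule sum.remove)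
    also have "(\<Sum>w\<in>V - {v}. y w * bform \<omega> (delta w) (delta v)) = (\<Sum>w\<in>V - {v}. - (y w * \<omega> {v, w}))"
      using assms by (intro sum.cong refl) (simp add: bform_delta_delta insert_commute)
    finally show ?thesis by (simp add: sum_negf)
  qed
  have "bform \<omega> (delta v) (delta v) = (\<Sum>w\<in>V - {v}. \<omega> {v, w})"
    using *[of "\<lambda>w. 1"] by (simp add: bform_one)
  then have "bform \<omega> h (delta v) = h v * (\<Sum>w\<in>V - {v}. \<omega> {v, w}) - (\<Sum>w\<in>V - {v}. h w * \<omega> {v, w})"
    using *[of h] by simp
  also have "\<dots> = (\<Sum>w\<in>V - {v}. \<omega> {v, w} * (h v - h w))"
    by (simp add: sum_distrib_left sum_subtractf[symmetric] algebra_simps)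
  finally show ?thesis by (subst bform_sym)
qed

lemma subgraph_bform:
  assumes "graph V H" "H \<subseteq> E" "support \<omega> \<subseteq> H"
  shows "graph.bform H \<omega> y h = bform \<omega> y h"
proof -
  interpret H: graph V H by (rule assms(1))
  show ?thesis
    unfolding H.bform_def bform_def using assms(2,3) finite_E
    by (intro sum.mono_neutral_left) (auto simp: support_def)
qed

end

lemma subgraph_stresses:
  assumes "graph V E" "graph V' H" "V' \<subseteq> V" "H \<subseteq> E"
  shows "\<omega> \<in> graph.stresses H C p \<longleftrightarrow> \<omega> \<in> graph.stresses E C p \<and> support \<omega> \<subseteq> H"
proof -
  interpret graph V E by (rule assms(1))
  interpret H: graph V' H by (rule assms(2))
  have "H.bform \<omega> y h = bform \<omega> y h" if "support \<omega> \<subseteq> H" for y h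
    unfolding H.bform_def bform_def using assms(4) finite_E that
    by (intro sum.mono_neutral_left) (auto simp: support_def)
  then show ?thesis using assms(4) unfolding H.stresses_def stresses_def by auto
qed

section \<open>Generic frameworks\<close>

locale generic_graph = graph +
  fixes d :: nat and q :: "'a \<Rightarrow> nat \<Rightarrow> real"
  assumes d_pos: "d \<ge> 1" and generic: "generic_framework (Suc d) V q"
begin

lemma indep_generic:
  assumes "F \<subseteq> E" "C \<subseteq> {..d}" "bij_betw \<sigma> C C'" "indep C' p F"
  shows "indep C q F"
  using generic_indep[OF generic assms(1) _ assms(3,4)] assms(2) by (auto simp: lessThan_Suc_atMost)

lemma indep_generic_card:
  assumes "F \<subseteq> E" "C \<subseteq> {..d}" "finite C'" "card C = card C'" "indep C' p F"
  shows "indep C q F"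
proof -
  have "finite C" using assms(2) finite_subset by blast
  then obtain \<sigma> where "bij_betw \<sigma> C C'" using assms(3,4) finite_same_card_bij by blast
  then show ?thesis using indep_generic assms by blast
qed

lemma indep_front:
  assumes "F \<subseteq> E" "indep {..<d} p F"
  shows "indep {..<d} q F"
proof -
  have "{..<d} \<subseteq> {..d}" by auto
  from indep_generic_card[OF assms(1) this _ refl assms(2)] show ?thesis by simp
qed

text \<open>Both projections of \<open>q\<close> are generic in dimension \<open>d\<close>, so they
  have the same rigidity matroid.\<close>

lemma indep_shift:
  assumes "F \<subseteq> E"
  shows "indep {1..d} q F \<longleftrightarrow> indep {..<d} q F"
proof -
  have "{1..d} \<subseteq> {..d}" "{..<d} \<subseteq> {..d}" by auto
  then show ?thesis
    using indep_generic_card[OF assms, of "{1..d}" "{..<d}" q]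
      indep_generic_card[OF assms, of "{..<d}" "{1..d}" q] by auto
qed

lemma shift_circuit:
  "matroid_circuit (indep {1..d} q) E C \<longleftrightarrow> matroid_circuit (indep {..<d} q) E C"
  by (intro matroid_circuit_cong) (rule indep_shift)

lemma edge_sum_differs:
  assumes "e \<in> E" "f \<in> E" "e \<noteq> f"
  shows "(\<Sum>v\<in>e. q v 0) \<noteq> (\<Sum>v\<in>f. q v 0)"
proof -
  obtain a b where e: "e = {a, b}" "a \<noteq> b" using edge_pair[OF assms(1)] by metis
  obtain a' b' where f: "f = {a', b'}" "a' \<noteq> b'" using edge_pair[OF assms(2)] by metis
  obtain v where v: "v \<in> e" "v \<notin> f" using e f assms(3) by blast
  let ?\<phi> = "\<lambda>x :: 'a \<times> nat \<Rightarrow> real. (\<Sum>v\<in>e. x (v, 0)) - (\<Sum>v\<in>f. x (v, 0))"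
  let ?x0 = "\<lambda>j. if j = (v, 0) then 1 else (0 :: real)"
  have "?\<phi> (\<lambda>(v, i). q v i) \<noteq> 0"
  proof (rule alg_indep_nonzero[where \<phi> = "?\<phi>" and ?x0.0 = "?x0"])
    show "algebraically_independent_over_rat (V \<times> {..<Suc d}) (\<lambda>(v, i). q v i)"
      using generic by (simp add: generic_framework_def)
    show "rat_poly_fun (V \<times> {..<Suc d}) ?\<phi>"
      using edge_subset[OF assms(1)] edge_subset[OF assms(2)]
      by (intro rat_poly_fun_diff rat_poly_fun_sum rat_poly_fun.var) auto
    show "?\<phi> ?x0 \<noteq> 0" using v e f by (auto simp: finite_edge)
  qed
  then show ?thesis by simp
qed

text \<open>These products are the factors by which a projective transformation rescales stresses.
  They agree at \<open>t = 0\<close>, and their first-order terms differ by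
  \<open>edge_sum_differs\<close>.\<close>

lemma edge_prod_differs:
  assumes "e \<in> E" "f \<in> E" "e \<noteq> f"
  shows "eventually (\<lambda>t. (\<Prod>v\<in>e. 1 + t * q v 0) \<noteq> (\<Prod>v\<in>f. 1 + t * q v 0)) (at 0)"
proof -
  have ex: "\<exists>c. \<forall>t. (\<Prod>v\<in>g. 1 + t * q v 0) = 1 + t * (\<Sum>v\<in>g. q v 0) + t * t * c" if g: "g \<in> E" for g
  proof -
    obtain a b where "g = {a, b}" "a \<noteq> b" using edge_pair[OF g] by metis
    then show ?thesis by (intro exI[of _ "q a 0 * q b 0"]) (simp add: algebra_simps)
  qed
  obtain ce where ce: "\<And>t. (\<Prod>v\<in>e. 1 + t * q v 0) = 1 + t * (\<Sum>v\<in>e. q v 0) + t * t * ce"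
    using ex[OF assms(1)] by blast
  obtain cf where cf: "\<And>t. (\<Prod>v\<in>f. 1 + t * q v 0) = 1 + t * (\<Sum>v\<in>f. q v 0) + t * t * cf"
    using ex[OF assms(2)] by blast
  define A B where "A = (\<Sum>v\<in>e. q v 0) - (\<Sum>v\<in>f. q v 0)" and "B = ce - cf"
  have "((\<lambda>t. A + t * B) \<longlongrightarrow> A + 0 * B) (at 0)" by (intro tendsto_intros)
  moreover have "A \<noteq> 0" using edge_sum_differs[OF assms] by (simp add: A_def)
  ultimately have "eventually (\<lambda>t. A + t * B \<noteq> 0) (at 0)"
    by (intro tendsto_imp_eventually_ne[of _ A]) simp_all
  moreover have "eventually (\<lambda>t :: real. t \<noteq> 0) (at 0)" by (rule eventually_neq_at_within)
  ultimately show ?thesis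
  proof eventually_elim
    case (elim t)
    have "(\<Prod>v\<in>e. 1 + t * q v 0) - (\<Prod>v\<in>f. 1 + t * q v 0) = t * (A + t * B)"
      unfolding ce cf A_def B_def by (simp add: algebra_simps)
    then show ?case using elim by auto
  qed
qed

lemma eventually_indep:
  fixes a :: "real \<Rightarrow> 'a \<Rightarrow> nat \<Rightarrow> real"
  assumes "F \<subseteq> E" "\<And>v i. v \<in> V \<Longrightarrow> i \<in> C \<Longrightarrow> isCont (\<lambda>t. a t v i) 0" "indep C (a 0) F"
  shows "eventually (\<lambda>t. indep C (a t) F) (at 0)"
proof -
  have "eventually (\<lambda>t. lin_indep (rigidity_matrix (a t)) F (V \<times> C)) (at 0)"
  proof (rule eventually_lin_indep)
    show "finite F" using assms(1) finite_E finite_subset by blast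
    show "lin_indep (rigidity_matrix (a 0)) F (V \<times> C)" using lin_indep_iff[OF assms(1)] assms(3) by blast
    fix g j assume g: "g \<in> F" and j: "j \<in> V \<times> C"
    have "g \<subseteq> V" using g assms(1) edge_subset by blast
    then show "isCont (\<lambda>t. rigidity_matrix (a t) g j) 0"
      using j assms(2) by (cases j, cases "fst j \<in> g")
        (auto simp: rigidity_matrix_def intro!: continuous_sum continuous_diff)
  qed
  then show ?thesis using lin_indep_iff[OF assms(1)] by simp
qed

text \<open>Moving coordinate \<open>i0\<close> of \<open>q\<close> in direction \<open>z\<close>
  disturbs the equilibrium of \<open>\<omega>\<close> by a load \<open>s\<close>. The rank is
  maximal at \<open>q\<close>, so to first order the edges resolve this load, and a motion
  \<open>Y\<close> is orthogonal to all that they resolve. Derivatives are avoided: were the pairing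
  nonzero, \<open>s\<close> would be independent of the rows in \<open>F\<close> even for small
  \<open>t\<close>, whereas an exact correction at \<open>t\<close> resolves it.\<close>

lemma motion_stress:
  assumes "C \<subseteq> {..d}" "\<And>g. g \<in> E \<Longrightarrow> (\<Sum>i\<in>C. edge_form g (coord Y i) (coord q i)) = 0"
    "\<omega> \<in> stresses C q" "i0 \<in> C"
  shows "bform \<omega> (coord Y i0) z = 0"
proof (rule ccontr)
  assume nz: "bform \<omega> (coord Y i0) z \<noteq> 0"
  have finC: "finite C" using assms(1) finite_subset by blast
  obtain J where J: "J \<subseteq> E" "stress.cobasis C q J"
    by (rule stress.cobasis_exists[OF subset_refl stress.zero_on_E])
  define F where "F = E - J"
  have F: "F \<subseteq> E" "finite F" "indep C q F" using J(2) finite_E by (auto simp: F_def stress.cobasis_def)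
  define a where "a t v i = q v i + (if i = i0 then t * z v else 0)" for t v i
  define s where "s = (\<lambda>(v, i). if i = i0 then bform \<omega> (delta v) z else 0)"
  define r where "r t = case_option s (rigidity_matrix (a t))" for t
  let ?G = "insert None (Some ` F)"
  have sumG: "(\<Sum>x\<in>?G. c x * r t x j) = c None * s j + (\<Sum>g\<in>F. c (Some g) * rigidity_matrix (a t) g j)"
    for c t j using F(2) by (simp add: r_def sum.reindex)
  have a0: "a 0 = q" by (simp add: a_def fun_eq_iff)
  have cont: "isCont (\<lambda>t. a t v i) 0" for v i
    unfolding a_def by (cases "i = i0") (auto intro!: continuous_intros)
  have "lin_indep (r 0) ?G (V \<times> C)"
    unfolding lin_indep_def
  proof (intro allI impI)
    fix c assume c: "\<forall>j\<in>V \<times> C. (\<Sum>x\<in>?G. c x * r 0 x j) = 0"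
    have c': "c None * s j + (\<Sum>g\<in>F. c (Some g) * rigidity_matrix q g j) = 0" if "j \<in> V \<times> C" for j
      using bspec[OF c that] unfolding sumG a0 .
    have "0 = (\<Sum>j\<in>V \<times> C. (c None * s j + (\<Sum>g\<in>F. c (Some g) * rigidity_matrix q g j)) * Y (fst j) (snd j))"
      using c' by simp
    also have "\<dots> = c None * (\<Sum>j\<in>V \<times> C. s j * Y (fst j) (snd j))
        + (\<Sum>j\<in>V \<times> C. \<Sum>g\<in>F. c (Some g) * (rigidity_matrix q g j * Y (fst j) (snd j)))"
      by (simp add: sum.distrib sum_distrib_left sum_distrib_right algebra_simps)
    also have "(\<Sum>j\<in>V \<times> C. \<Sum>g\<in>F. c (Some g) * (rigidity_matrix q g j * Y (fst j) (snd j)))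
        = (\<Sum>g\<in>F. c (Some g) * (\<Sum>j\<in>V \<times> C. rigidity_matrix q g j * Y (fst j) (snd j)))"
      by (subst sum.swap) (simp add: sum_distrib_left)
    also have "\<dots> = 0"
    proof (intro sum.neutral ballI)
      fix g assume "g \<in> F"
      then have "g \<in> E" using F(1) by blast
      from row_dot[OF this finC, of q Y] assms(2)[OF this]
      show "c (Some g) * (\<Sum>j\<in>V \<times> C. rigidity_matrix q g j * Y (fst j) (snd j)) = 0"
        by (simp add: case_prod_unfold)
    qed
    also have "(\<Sum>j\<in>V \<times> C. s j * Y (fst j) (snd j)) = bform \<omega> (coord Y i0) z"
    proof -
      have "(\<Sum>j\<in>V \<times> C. s j * Y (fst j) (snd j)) = (\<Sum>v\<in>V. \<Sum>i\<in>C. if i = i0 then bform \<omega> (delta v) z * Y v i else 0)"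
        by (simp add: sum.cartesian_product s_def case_prod_unfold if_distrib[of "\<lambda>x. x * _"] cong: if_cong)
      also have "\<dots> = (\<Sum>v\<in>V. Y v i0 * bform \<omega> (delta v) z)"
        using finC assms(4) by (simp add: mult.commute)
      finally show ?thesis by (subst bform_delta) (simp add: coord_def)
    qed
    finally have "c None = 0" using nz by simp
    moreover have "lin_indep (rigidity_matrix q) F (V \<times> C)" using lin_indep_iff F by blast
    ultimately have "\<forall>g\<in>F. c (Some g) = 0"
      using c' lin_indepD[of "rigidity_matrix q" F "V \<times> C" "\<lambda>g. c (Some g)"] by simp
    then show "\<forall>x\<in>?G. c x = 0" using \<open>c None = 0\<close> by simp
  qed
  then have "eventually (\<lambda>t. lin_indep (r t) ?G (V \<times> C)) (at 0)"
  proof (rule eventually_lin_indep[rotated -1])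
    show "finite ?G" using F(2) by simp
    fix x j assume x: "x \<in> ?G" and j: "j \<in> V \<times> C"
    show "isCont (\<lambda>t. r t x j) 0"
    proof (cases x)
      case (Some g)
      show ?thesis using cont
        by (cases j, cases "fst j \<in> g")
          (auto simp: r_def Some rigidity_matrix_def intro!: continuous_sum continuous_diff)
    qed (simp add: r_def)
  qed
  moreover have "eventually (\<lambda>t. indep C (a t) F) (at 0)"
    using F(1,3) a0 by (intro eventually_indep cont) auto
  moreover have "eventually (\<lambda>t :: real. t \<noteq> 0) (at 0)" by (rule eventually_neq_at_within)
  ultimately have "eventually (\<lambda>t. lin_indep (r t) ?G (V \<times> C) \<and> indep C (a t) F \<and> t \<noteq> 0) (at 0)"
    by eventually_elim simp
  then obtain t where t: "lin_indep (r t) ?G (V \<times> C)" "indep C (a t) F" "t \<noteq> 0"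
    using eventually_happens[of _ "at (0 :: real)"] by auto
  \<comment> \<open>Independence at any framework carries over to \<open>q\<close>, so the basis
    \<open>F\<close> of \<open>q\<close> is still a basis at \<open>a t\<close>.\<close>
  have "\<not> indep C (a t) (insert j F)" if "j \<in> J" for j
  proof
    assume "indep C (a t) (insert j F)"
    then have "indep C q (insert j F)"
      using that J(1) assms(1) by (intro indep_generic[of _ C id C]) (auto simp: F_def)
    then show False using that J(2) by (auto simp: stress.cobasis_def F_def)
  qed
  then have "stress.cobasis C (a t) J" using t(2) J(1) by (auto simp: stress.cobasis_def F_def)
  then obtain W where W: "\<And>j. j \<in> J \<Longrightarrow> W j \<in> stresses C (a t)"
    "\<And>i j. i \<in> J \<Longrightarrow> j \<in> J \<Longrightarrow> W j i = (if i = j then 1 else 0)"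
    by (rule stress.cobasis_dual) (rule that)
  have finJ: "finite J" using J(1) finite_E finite_subset by blast
  \<comment> \<open>Subtracting stresses of \<open>a t\<close> removes the entries on
    \<open>J\<close> and leaves the load \<open>t * s\<close> unchanged, so the rows of
    \<open>F\<close> resolve it.\<close>
  define \<omega>' where "\<omega>' g = 1 * \<omega> g + (- 1) * (\<Sum>j\<in>J. \<omega> j * W j g)" for g
  have supp: "\<omega>' g = 0" if "g \<notin> F" for g
  proof (cases "g \<in> J")
    case True
    then show ?thesis using W(2)[OF True] finJ
      by (simp add: \<omega>'_def if_distrib[of "(*) _"] cong: if_cong)
  next
    case False
    then have "g \<notin> E" using that by (simp add: F_def)
    then have "\<omega> g = 0" "\<And>j. j \<in> J \<Longrightarrow> W j g = 0"
      using stress.support_E[OF assms(3)] stress.support_E[OF W(1)] by (auto simp: support_def)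
    then show ?thesis by (simp add: \<omega>'_def)
  qed
  have bf: "bform \<omega>' (delta v) (coord (a t) i) = t * s (v, i)" if i: "i \<in> C" for v i
  proof -
    have "bform \<omega>' (delta v) (coord (a t) i) = bform \<omega> (delta v) (coord (a t) i)"
      unfolding \<omega>'_def bform_lin bform_stress_sum by (simp add: stressesD[OF W(1) i])
    also have "\<dots> = bform \<omega> (coord (a t) i) (delta v)" by (rule bform_sym)
    also have "\<dots> = bform \<omega> (\<lambda>w. 1 * coord q i w + (if i = i0 then t else 0) * z w) (delta v)"
      by (rule arg_cong[of _ _ "\<lambda>h. bform \<omega> h _"]) (simp add: coord_def a_def fun_eq_iff)
    also have "\<dots> = t * s (v, i)"
      by (subst bform_add)
        (use stressesD[OF assms(3) i] in \<open>simp add: bform_sym[of \<omega> "coord q i"] bform_sym[of \<omega> z] s_def\<close>)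
    finally show ?thesis .
  qed
  define c where "c = case_option (- t) \<omega>'"
  have "(\<Sum>x\<in>?G. c x * r t x j) = 0" if j: "j \<in> V \<times> C" for j
  proof -
    obtain v i where j: "j = (v, i)" "i \<in> C" using j by auto
    have "(\<Sum>g\<in>F. \<omega>' g * rigidity_matrix (a t) g (v, i)) = (\<Sum>g\<in>E. \<omega>' g * edge_form g (delta v) (coord (a t) i))"
      using F(1) finite_E supp
      by (intro sum.mono_neutral_cong_left) (auto simp: edge_form_delta finite_edge)
    also have "\<dots> = t * s (v, i)" using bf[OF j(2)] by (simp add: bform_def)
    finally show ?thesis unfolding sumG by (simp add: c_def j(1))
  qed
  from lin_indepD[OF t(1) this, of None] show False using t(3) by (simp add: c_def)
qed

subsection \<open>Series pairs and projections\<close>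

text \<open>The family \<open>ratio_rows x\<close>, indexed by \<open>ratio_index D e f\<close>, is independent iff the quotients of the entries at \<open>f\<close> and
  \<open>e\<close> of the stresses of the circuit \<open>D\<close> differ for the coordinates \<open>0, \<dots>, d - 1\<close> and
  \<open>1, \<dots>, d\<close>. So the quotients differ for a generic framework unless they agree everywhere.\<close>

definition ratio_rows :: "('a \<times> nat \<Rightarrow> real) \<Rightarrow> nat \<times> 'a set \<Rightarrow> nat \<times> 'a \<times> nat \<Rightarrow> real" where
  "ratio_rows x = (\<lambda>(k, g) (b, v, i).
     if k = 2 \<or> k = b then rigidity_matrix (\<lambda>v i. x (v, i)) g (v, i + b) else 0)"

definition ratio_index :: "'a set set \<Rightarrow> 'a set \<Rightarrow> 'a set \<Rightarrow> (nat \<times> 'a set) set" where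
  "ratio_index D e f = {0, 1} \<times> (D - {e, f}) \<union> {2} \<times> {e, f}"

abbreviation "ratio_columns \<equiv> {0, 1 :: nat} \<times> V \<times> {..<d}"

text \<open>A coefficient vector encodes two functions on \<open>D\<close>, one for each window
  \<open>b\<close>; the rows with first index 2 make them share their values at \<open>e\<close> and
  \<open>f\<close>.\<close>

lemma ratio_rows_sum:
  assumes D: "D \<subseteq> E" "e \<in> D" "f \<in> D" "e \<noteq> f" and b: "b < 2"
  shows "(\<Sum>k\<in>ratio_index D e f. c k * ratio_rows x k (b, v, i)) =
    bform (\<lambda>g. if g \<in> {e, f} then c (2, g) else if g \<in> D then c (b, g) else 0) (delta v)
      (coord (\<lambda>v i. x (v, i)) (i + b))" (is "?L = bform ?\<tau> _ _")
proof -
  let ?R = "\<lambda>g. rigidity_matrix (\<lambda>v i. x (v, i)) g (v, i + b)"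
  have fin: "finite D" using D(1) finite_E finite_subset by blast
  have "?L = (\<Sum>k\<in>{0, 1} \<times> (D - {e, f}). c k * ratio_rows x k (b, v, i))
      + (\<Sum>k\<in>{2} \<times> {e, f}. c k * ratio_rows x k (b, v, i))"
    unfolding ratio_index_def using fin by (intro sum.union_disjoint) auto
  also have "(\<Sum>k\<in>{0, 1} \<times> (D - {e, f}). c k * ratio_rows x k (b, v, i))
      = (\<Sum>k\<in>{0, 1}. \<Sum>g\<in>D - {e, f}. c (k, g) * (if k = b then ?R g else 0))"
    by (simp add: sum.cartesian_product' ratio_rows_def)
  also have "\<dots> = (\<Sum>g\<in>D - {e, f}. c (b, g) * ?R g)"
  proof -
    have "b = 0 \<or> b = 1" using b by auto
    then show ?thesis by auto
  qed
  also have "(\<Sum>k\<in>{2} \<times> {e, f}. c k * ratio_rows x k (b, v, i)) = (\<Sum>g\<in>{e, f}. c (2, g) * ?R g)"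
    using D(4) by (simp add: sum.cartesian_product' ratio_rows_def)
  also have "(\<Sum>g\<in>D - {e, f}. c (b, g) * ?R g) + \<dots> = (\<Sum>g\<in>D. ?\<tau> g * ?R g)"
  proof -
    have "(\<Sum>g\<in>D. ?\<tau> g * ?R g) = (\<Sum>g\<in>D - {e, f}. ?\<tau> g * ?R g) + (\<Sum>g\<in>{e, f}. ?\<tau> g * ?R g)"
      using fin D by (intro sum.subset_diff) auto
    moreover have "(\<Sum>g\<in>D - {e, f}. ?\<tau> g * ?R g) = (\<Sum>g\<in>D - {e, f}. c (b, g) * ?R g)"
      by (intro sum.cong) auto
    ultimately show ?thesis using D(4) by simp
  qed
  also have "\<dots> = (\<Sum>g\<in>E. ?\<tau> g * edge_form g (delta v) (coord (\<lambda>v i. x (v, i)) (i + b)))"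
    using D finite_E by (intro sum.mono_neutral_cong_left) (auto simp: edge_form_delta finite_edge)
  finally show ?thesis by (simp add: bform_def)
qed

lemma ratio_rows_indep:
  fixes p :: "'a \<Rightarrow> nat \<Rightarrow> real"
  assumes D: "D \<subseteq> E" "e \<in> D" "f \<in> D" "e \<noteq> f"
    and ind: "indep {..<d} p (D - {e})" "indep {1..d} p (D - {e})"
    and \<omega>: "\<omega> \<in> stresses {..<d} p" "support \<omega> \<subseteq> D" "\<omega> e \<noteq> 0"
    and \<omega>': "\<omega>' \<in> stresses {1..d} p" "support \<omega>' \<subseteq> D" "\<omega>' e \<noteq> 0"
    and ne: "\<omega> f * \<omega>' e \<noteq> \<omega> e * \<omega>' f"
  shows "lin_indep (ratio_rows (\<lambda>(v, i). p v i)) (ratio_index D e f) ratio_columns"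
  unfolding lin_indep_def
proof (intro allI impI)
  fix c assume c: "\<forall>j\<in>ratio_columns. (\<Sum>k\<in>ratio_index D e f. c k * ratio_rows (\<lambda>(v, i). p v i) k j) = 0"
  define \<tau> where "\<tau> b g = (if g \<in> {e, f} then c (2, g) else if g \<in> D then c (b, g) else 0)" for b g
  have z: "bform (\<tau> b) (delta v) (coord p (i + b)) = 0" if "b < 2" "v \<in> V" "i < d" for b v i
  proof -
    have "(b, v, i) \<in> ratio_columns" using that by auto
    then have "(\<Sum>k\<in>ratio_index D e f. c k * ratio_rows (\<lambda>(v, i). p v i) k (b, v, i)) = 0"
      using c by blast
    then show ?thesis unfolding ratio_rows_sum[OF D that(1)] \<tau>_def by simp
  qed
  have supp: "support (\<tau> b) \<subseteq> D" for b using D by (auto simp: \<tau>_def support_def)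
  have "\<tau> 0 \<in> stresses {..<d} p"
    using z[of 0] supp[of 0] D(1) by (intro stressesI) auto
  then have t0: "\<tau> 0 g * \<omega> e = \<tau> 0 e * \<omega> g" for g
    using stress.almost_ind_proportional[OF ind(1) \<omega> _ supp] by blast
  have "\<tau> 1 \<in> stresses {1..d} p"
  proof (rule stressesI)
    show "support (\<tau> 1) \<subseteq> E" using supp D(1) by blast
    fix i v assume "i \<in> {1..d}" "v \<in> V"
    then show "bform (\<tau> 1) (delta v) (coord p i) = 0" using z[of 1 v "i - 1"] by auto
  qed
  then have t1: "\<tau> 1 g * \<omega>' e = \<tau> 1 e * \<omega>' g" for g
    using stress.almost_ind_proportional[OF ind(2) \<omega>' _ supp] by blast
  have eq: "\<tau> 0 e = \<tau> 1 e" "\<tau> 0 f = \<tau> 1 f" by (simp_all add: \<tau>_def)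
  have "\<tau> 0 e * (\<omega> f * \<omega>' e) = \<tau> 0 f * \<omega> e * \<omega>' e" using t0[of f] by simp
  also have "\<dots> = \<tau> 0 e * (\<omega> e * \<omega>' f)" using t1[of f] eq by simp
  finally have "\<tau> 0 e = 0" using ne by simp
  then have "\<tau> 0 g = 0" "\<tau> 1 g = 0" for g using t0[of g] t1[of g] \<omega>(3) \<omega>'(3) eq by auto
  then have z: "\<tau> 0 e = 0" "\<tau> 0 f = 0" "\<tau> 0 g = 0" "\<tau> 1 g = 0" for g by blast+
  show "\<forall>k\<in>ratio_index D e f. c k = 0"
  proof
    fix k assume "k \<in> ratio_index D e f"
    then consider g where "k = (0, g)" "g \<in> D" "g \<noteq> e" "g \<noteq> f"
      | g where "k = (1, g)" "g \<in> D" "g \<noteq> e" "g \<noteq> f" | "k = (2, e)" | "k = (2, f)"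
      by (auto simp: ratio_index_def)
    then show "c k = 0"
    proof cases
      case (1 g)
      then show ?thesis using z(3)[of g] by (simp add: \<tau>_def)
    next
      case (2 g)
      then show ?thesis using z(4)[of g] by (simp add: \<tau>_def)
    qed (use z(1,2) in \<open>simp_all add: \<tau>_def\<close>)
  qed
qed

lemma ratio_rows_dep:
  fixes p :: "'a \<Rightarrow> nat \<Rightarrow> real"
  assumes D: "D \<subseteq> E" "e \<in> D" "f \<in> D" "e \<noteq> f"
    and \<omega>: "\<omega> \<in> stresses {..<d} p" "support \<omega> \<subseteq> D" "\<omega> e \<noteq> 0"
    and \<omega>': "\<omega>' \<in> stresses {1..d} p" "support \<omega>' \<subseteq> D" "\<omega>' e \<noteq> 0"
    and eq: "\<omega> f * \<omega>' e = \<omega> e * \<omega>' f"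
  shows "\<not> lin_indep (ratio_rows (\<lambda>(v, i). p v i)) (ratio_index D e f) ratio_columns"
proof
  assume L: "lin_indep (ratio_rows (\<lambda>(v, i). p v i)) (ratio_index D e f) ratio_columns"
  \<comment> \<open>\<open>\<omega>\<close> and \<open>\<omega>'\<close> are scaled to agree at
    \<open>e\<close>; equal quotients then make them agree at \<open>f\<close> too, so they fit the
    shared rows.\<close>
  define c where "c = (\<lambda>(k :: nat, g). if k = 1 then \<omega>' g * \<omega> e else \<omega> g * \<omega>' e)"
  have "(\<Sum>k\<in>ratio_index D e f. c k * ratio_rows (\<lambda>(v, i). p v i) k j) = 0"
    if j: "j \<in> ratio_columns" for j
  proof -
    obtain b v i where j: "j = (b, v, i)" "b = 0 \<or> b = 1" "i < d" using j by auto
    then have b: "b < 2" by auto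
    let ?\<tau> = "\<lambda>g. if g \<in> {e, f} then c (2, g) else if g \<in> D then c (b, g) else 0"
    have "bform ?\<tau> (delta v) (coord p (i + b)) = 0"
    proof (cases "b = 0")
      case True
      have "?\<tau> = (\<lambda>g. \<omega>' e * \<omega> g)"
        using \<omega>(2) True by (auto simp: c_def support_def fun_eq_iff)
      then show ?thesis using stressesD[OF stress.scale[OF \<omega>(1)]] j(3) True by simp
    next
      case False
      then have "b = 1" using j by simp
      have "?\<tau> = (\<lambda>g. \<omega> e * \<omega>' g)"
        using \<omega>'(2) \<open>b = 1\<close> eq by (auto simp: c_def support_def fun_eq_iff)
      then show ?thesis using stressesD[OF stress.scale[OF \<omega>'(1)]] j(3) \<open>b = 1\<close> by simp
    qed
    then show ?thesis unfolding j(1) ratio_rows_sum[OF D b] by simp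
  qed
  from lin_indepD[OF L this, of "(2, e)"] show False
    using \<omega>(3) \<omega>'(3) by (simp add: c_def ratio_index_def)
qed

text \<open>If the quotients agreed everywhere, they would agree along the chain of windows
  \<open>(a\<^sub>j, \<dots>, a\<^sub>j\<^sub>+\<^sub>d\<^sub>-\<^sub>1)\<close> leading from \<open>q\<close> to its projective image
  \<open>q / (1 + t q\<^sub>0)\<close>, where they differ by the factor \<open>\<lambda>\<^sub>f / \<lambda>\<^sub>e\<close>. For \<open>t = 0\<close> every window
  consists of \<open>d\<close> distinct coordinates of \<open>q\<close>, so it stays generic enough for small \<open>t\<close>.\<close>

lemma circuit_ratio_differs:
  assumes D: "D \<subseteq> E" "e \<in> D" "f \<in> D" "e \<noteq> f"
    and ind: "indep {..<d} q (D - {e})" "indep {..<d} q (D - {f})" and dep: "\<not> indep {..<d} q D"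
    and \<omega>: "\<omega> \<in> stresses {..<d} q" "support \<omega> \<subseteq> D" "\<omega> e \<noteq> 0"
    and \<omega>': "\<omega>' \<in> stresses {1..d} q" "support \<omega>' \<subseteq> D" "\<omega>' e \<noteq> 0"
  shows "\<omega> f * \<omega>' e \<noteq> \<omega> e * \<omega>' f"
proof
  assume "\<omega> f * \<omega>' e = \<omega> e * \<omega>' f"
  from ratio_rows_dep[OF D \<omega> \<omega>' this]
  have notq: "\<not> lin_indep (ratio_rows (\<lambda>(v, i). q v i)) (ratio_index D e f) ratio_columns" .
  have never: "\<not> lin_indep (ratio_rows x) (ratio_index D e f) ratio_columns" for x
  proof
    assume "lin_indep (ratio_rows x) (ratio_index D e f) ratio_columns"
    then have "lin_indep (ratio_rows (\<lambda>(v, i). q v i)) (ratio_index D e f) ratio_columns"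
    proof (rule alg_indep_lin_indep[rotated -1])
      show "algebraically_independent_over_rat (V \<times> {..<Suc d}) (\<lambda>(v, i). q v i)"
        using generic by (simp add: generic_framework_def)
      show "finite (ratio_index D e f)"
        using finite_subset[OF D(1) finite_E] by (simp add: ratio_index_def)
      fix k j assume k: "k \<in> ratio_index D e f" and j: "j \<in> ratio_columns"
      obtain m g where kg: "k = (m, g)" by (cases k)
      obtain b v i where j': "j = (b, v, i)" "v \<in> V" "i + b < Suc d" using j by auto
      have "g \<subseteq> V" using k kg D edge_subset by (auto simp: ratio_index_def)
      then show "rat_poly_fun (V \<times> {..<Suc d}) (\<lambda>x. ratio_rows x k j)"
        unfolding kg j'(1) ratio_rows_def case_prod_conv rigidity_matrix_def using j'(2,3)
        by (cases "v \<in> g"; cases "m = 2 \<or> m = b")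
          (auto intro!: rat_poly_fun_sum rat_poly_fun_diff rat_poly_fun.var rat_poly_fun_0)
    qed
    then show False using notq by blast
  qed
  \<comment> \<open>Coordinates \<open>0, ..., d\<close> are those of \<open>q\<close>, the later
    ones those of its projective image. Window 0 is the front projection of \<open>q\<close>, window
    \<open>d + 1\<close> its image, and windows \<open>j\<close> and \<open>j + 1\<close> are the
    two projections of one framework in dimension \<open>d + 1\<close>.\<close>
  define a where "a t v i = (if i \<le> d then q v i else q v (i - Suc d) / (1 + t * q v 0))" for t v i
  have cont: "isCont (\<lambda>t. a t v i) 0" for v i
    unfolding a_def by (cases "i \<le> d") (auto intro!: continuous_intros)
  have a0: "indep {j..<j + d} (a 0) F" if F: "F \<subseteq> E" "indep {..<d} q F" and j: "j \<le> Suc d" for F j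
  proof -
    let ?m = "\<lambda>i. i mod Suc d"
    \<comment> \<open>At \<open>t = 0\<close> the coordinates repeat with period
      \<open>d + 1\<close>, and \<open>d\<close> consecutive indices have distinct residues.\<close>
    have "inj_on ?m {j..<j + d}"
    proof (rule inj_onI)
      fix x y assume "x \<in> {j..<j + d}" "y \<in> {j..<j + d}" "?m x = ?m y"
      moreover have False if "x < y" "y < x + Suc d" "x mod Suc d = y mod Suc d" for x y :: nat
      proof -
        have "Suc d dvd y - x" using that mod_eq_dvd_iff_nat[of x y "Suc d"] by simp
        then show False using that nat_dvd_not_less[of "y - x" "Suc d"] by simp
      qed
      ultimately show "x = y" by (cases x y rule: linorder_cases) force+
    qed
    then have c: "card (?m ` {j..<j + d}) = card {..<d}" by (simp add: card_image)
    have "?m ` {j..<j + d} \<subseteq> {..d}" by (simp add: image_subset_iff)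
    from indep_generic_card[OF F(1) this finite_lessThan c F(2)]
    have "indep (?m ` {j..<j + d}) q F" .
    moreover have "stresses {j..<j + d} (a 0) = stresses (?m ` {j..<j + d}) q"
    proof -
      have "a 0 v i = q v (i mod Suc d)" if "i \<in> {j..<j + d}" for v i
      proof (cases "i \<le> d")
        case False
        then have "i mod Suc d = i - Suc d" using that j by (simp add: mod_if)
        then show ?thesis using False by (simp add: a_def)
      qed (simp add: a_def)
      then have "stresses {j..<j + d} (a 0) = stresses {j..<j + d} (\<lambda>v i. q v (i mod Suc d))"
        by (intro stresses_cong) blast
      then show ?thesis using stresses_reindex[of ?m "{j..<j + d}" _ q] by simp
    qed
    ultimately show ?thesis by (simp add: stress.ind_def)
  qed
  have De: "D - {e} \<subseteq> E" "D - {f} \<subseteq> E" using D by auto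
  have "eventually (\<lambda>t. \<forall>j\<in>{..Suc d}. indep {j..<j + d} (a t) (D - {e})) (at 0)"
    using De(1) ind(1) a0 cont by (intro eventually_ball_finite ballI eventually_indep) auto
  moreover have "eventually (\<lambda>t. \<forall>v\<in>V. 1 + t * q v 0 \<noteq> 0) (at 0)"
  proof (intro eventually_ball_finite ballI finite_V)
    fix v
    have "((\<lambda>t. 1 + t * q v 0) \<longlongrightarrow> 1 + 0 * q v 0) (at 0)" by (intro tendsto_intros)
    then show "eventually (\<lambda>t. 1 + t * q v 0 \<noteq> 0) (at 0)"
      by (intro tendsto_imp_eventually_ne[of _ 1]) simp_all
  qed
  moreover have "eventually (\<lambda>t. (\<Prod>v\<in>e. 1 + t * q v 0) \<noteq> (\<Prod>v\<in>f. 1 + t * q v 0)) (at 0)"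
    using D by (intro edge_prod_differs) auto
  ultimately have "eventually (\<lambda>t. (\<forall>j\<in>{..Suc d}. indep {j..<j + d} (a t) (D - {e})) \<and>
      (\<forall>v\<in>V. 1 + t * q v 0 \<noteq> 0) \<and> (\<Prod>v\<in>e. 1 + t * q v 0) \<noteq> (\<Prod>v\<in>f. 1 + t * q v 0)) (at 0)"
    by eventually_elim simp
  from eventually_at_0_ex[OF this]
  obtain t where "(\<forall>j\<in>{..Suc d}. indep {j..<j + d} (a t) (D - {e})) \<and>
      (\<forall>v\<in>V. 1 + t * q v 0 \<noteq> 0) \<and> (\<Prod>v\<in>e. 1 + t * q v 0) \<noteq> (\<Prod>v\<in>f. 1 + t * q v 0)"
    by blast
  then have t: "\<And>j. j \<le> Suc d \<Longrightarrow> indep {j..<j + d} (a t) (D - {e})"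
    "\<And>v. v \<in> V \<Longrightarrow> 1 + t * q v 0 \<noteq> 0" "(\<Prod>v\<in>e. 1 + t * q v 0) \<noteq> (\<Prod>v\<in>f. 1 + t * q v 0)"
    by auto
  \<comment> \<open>Independence of \<open>D\<close> in any window, generic or not, would carry over
    to \<open>q\<close>.\<close>
  have "\<exists>w. w \<in> stresses {j..<j + d} (a t) \<and> support w \<subseteq> D \<and> support w \<noteq> {}" for j
  proof (rule ccontr)
    assume "\<not> ?thesis"
    then have "indep {j..<j + d} (a t) D" by (auto simp: stress.ind_def)
    then have "indep {..<d} q D" by (rule indep_generic_card[OF D(1), rotated -1]) auto
    then show False using dep by blast
  qed
  then obtain w where w: "\<And>j. w j \<in> stresses {j..<j + d} (a t)" "\<And>j. support (w j) \<subseteq> D"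
    "\<And>j. support (w j) \<noteq> {}" by metis
  have we: "w j e \<noteq> 0" if "j \<le> Suc d" for j
    using stress.almost_ind_nonzero[OF t(1)[OF that] w] .
  have step: "w j f * w (Suc j) e = w j e * w (Suc j) f" if j: "j \<le> d" for j
  proof (rule ccontr)
    assume ne: "\<not> ?thesis"
    let ?p = "\<lambda>v i. a t v (i + j)"
    have "(\<lambda>i. i + j) ` {..<d} = {j..<j + d}"
      by (simp add: lessThan_atLeast0 image_add_atLeastLessThan' add.commute)
    then have s0: "stresses {..<d} ?p = stresses {j..<j + d} (a t)" by (rule stresses_reindex)
    have "(\<lambda>i. i + j) ` {1..d} = {Suc j..<Suc j + d}"
      using image_add_atLeastAtMost'[of j 1 d] by (simp add: atLeastLessThanSuc_atLeastAtMost add.commute)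
    then have s1: "stresses {1..d} ?p = stresses {Suc j..<Suc j + d} (a t)" by (rule stresses_reindex)
    have "lin_indep (ratio_rows (\<lambda>(v, i). ?p v i)) (ratio_index D e f) ratio_columns"
    proof (rule ratio_rows_indep[OF D])
      show "indep {..<d} ?p (D - {e})" using t(1)[of j] j by (simp add: stress.ind_def s0)
      show "indep {1..d} ?p (D - {e})" using t(1)[of "Suc j"] j unfolding stress.ind_def s1 by simp
      show "w j \<in> stresses {..<d} ?p" using w(1) s0 by simp
      show "w (Suc j) \<in> stresses {1..d} ?p" unfolding s1 by (rule w(1))
      show "w j e \<noteq> 0" "w (Suc j) e \<noteq> 0" using we j by auto
    qed (use w(2) ne in auto)
    then show False using never by blast
  qed
  have chain: "w 0 f * w j e = w 0 e * w j f" if "j \<le> Suc d" for j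
    using that
  proof (induction j)
    case (Suc j)
    have "w 0 f * w (Suc j) e * w j e = (w 0 f * w j e) * w (Suc j) e" by simp
    also have "\<dots> = w 0 e * (w j f * w (Suc j) e)" using Suc by simp
    also have "\<dots> = w 0 e * w (Suc j) f * w j e" using step[of j] Suc.prems by simp
    finally show ?case using we[of j] Suc.prems by simp
  qed simp
  have "stresses {0..<0 + d} (a t) = stresses {..<d} q"
    by (simp add: lessThan_atLeast0, intro stresses_cong) (simp add: a_def)
  then have w0: "w 0 \<in> stresses {..<d} q" using w(1)[of 0] by simp
  \<comment> \<open>The image of \<open>w 0\<close> and \<open>w (Suc d)\<close> are stresses of the
    same window, hence proportional, while the chain gives \<open>w 0\<close> itself the ratio of
    \<open>w (Suc d)\<close>. The two factors would have to be equal.\<close>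
  let ?w = "\<lambda>g. w 0 g * (\<Prod>v\<in>g. 1 + t * q v 0)"
  have "?w \<in> stresses {..<d} (\<lambda>v i. q v i / (1 + t * q v 0))"
    using d_pos t(2) by (intro stresses_projective[OF w0]) auto
  also have "stresses {..<d} (\<lambda>v i. q v i / (1 + t * q v 0)) = stresses {..<d} (\<lambda>v i. a t v (i + Suc d))"
    by (intro stresses_cong) (simp add: a_def)
  also have "\<dots> = stresses {Suc d..<Suc d + d} (a t)"
    by (rule stresses_reindex) (simp add: lessThan_atLeast0 image_add_atLeastLessThan' add.commute del: add_Suc_right)
  finally have w1: "?w \<in> stresses {Suc d..<Suc d + d} (a t)" .
  have "support ?w \<subseteq> D" using w(2)[of 0] by (auto simp: support_def)
  from stress.almost_ind_proportional[OF t(1) w(1,2) we w1 this, of f]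
  have ratio: "?w f * w (Suc d) e = ?w e * w (Suc d) f" by simp
  have "(w 0 f * w (Suc d) e) * (\<Prod>v\<in>f. 1 + t * q v 0) = ?w f * w (Suc d) e" by simp
  also have "\<dots> = (w 0 e * w (Suc d) f) * (\<Prod>v\<in>e. 1 + t * q v 0)" unfolding ratio by simp
  also have "w 0 e * w (Suc d) f = w 0 f * w (Suc d) e" using chain by simp
  finally have "(w 0 f * w (Suc d) e) * (\<Prod>v\<in>f. 1 + t * q v 0) = (w 0 f * w (Suc d) e) * (\<Prod>v\<in>e. 1 + t * q v 0)" .
  moreover have "w 0 f \<noteq> 0"
  proof (rule stress.almost_ind_nonzero)
    show "indep {..<d} q (D - {f})" by (rule ind(2))
  qed (use w0 w in auto)
  ultimately show False using we[of "Suc d"] t(3) by simp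
qed

lemma series_shift:
  assumes "\<And>\<omega>. \<omega> \<in> stresses {..<d} q \<Longrightarrow> \<omega> e = 0 \<Longrightarrow> \<omega> f = 0"
    and "\<omega> \<in> stresses {1..d} q" "\<omega> e = 0"
  shows "\<omega> f = 0"
proof -
  have "\<forall>C. matroid_circuit (indep {..<d} q) E C \<longrightarrow> f \<in> C \<longrightarrow> e \<in> C"
    using assms(1) unfolding stress.series_iff_circuits[symmetric] by blast
  then have "\<forall>\<omega>\<in>stresses {1..d} q. \<omega> e = 0 \<longrightarrow> \<omega> f = 0"
    unfolding stress.series_iff_circuits shift_circuit .
  then show ?thesis using assms(2,3) by blast
qed

text \<open>All stresses of one projection that are nonzero at \<open>e\<close> have the same ratio
  on a series pair, so the claim reduces to one circuit through \<open>e\<close> and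
  \<open>f\<close>.\<close>

lemma series_ratio_differs:
  assumes ser: "\<And>\<omega>. \<omega> \<in> stresses {..<d} q \<Longrightarrow> \<omega> e = 0 \<Longrightarrow> \<omega> f = 0" and "e \<noteq> f"
    and \<omega>1: "\<omega>1 \<in> stresses {..<d} q" "\<omega>1 e \<noteq> 0" "\<omega>1 f \<noteq> 0"
    and \<omega>2: "\<omega>2 \<in> stresses {1..d} q" "\<omega>2 e \<noteq> 0"
  shows "\<omega>1 f * \<omega>2 e \<noteq> \<omega>1 e * \<omega>2 f"
proof
  assume eq: "\<omega>1 f * \<omega>2 e = \<omega>1 e * \<omega>2 f"
  obtain \<tau> where \<tau>: "\<tau> \<in> stresses {..<d} q" "\<tau> e \<noteq> 0"
    "matroid_circuit (indep {..<d} q) E (support \<tau>)"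
    using stress.circuit_through[OF \<omega>1(1,2)] by blast
  let ?D = "support \<tau>"
  have p1: "\<omega>1 f * \<tau> e = \<omega>1 e * \<tau> f" using stress.series_proportional[OF ser \<omega>1(1) \<tau>(1)] .
  then have \<tau>f: "\<tau> f \<noteq> 0" using \<omega>1(3) \<tau>(2) by auto
  have circ: "matroid_circuit (indep {1..d} q) E ?D" using \<tau>(3) shift_circuit by blast
  then obtain \<tau>' where \<tau>': "\<tau>' \<in> stresses {1..d} q" "support \<tau>' = ?D"
    by (rule stress.circuit_stress)
  have De: "e \<in> ?D" "f \<in> ?D" using \<tau>(2) \<tau>f by (auto simp: in_support)
  have \<tau>'e: "\<tau>' e \<noteq> 0" using De(1) unfolding \<tau>'(2)[symmetric] by (simp add: in_support)
  have p2: "\<omega>2 f * \<tau>' e = \<omega>2 e * \<tau>' f"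
    by (rule stress.series_proportional[OF series_shift[OF ser] \<omega>2(1) \<tau>'(1)])
  have "\<tau> f * \<tau>' e \<noteq> \<tau> e * \<tau>' f"
  proof (rule circuit_ratio_differs[of ?D])
    show "indep {..<d} q (?D - {e})" "indep {..<d} q (?D - {f})" "\<not> indep {..<d} q ?D"
      using \<tau>(3) De by (auto simp: matroid_circuit_def)
    show "?D \<subseteq> E" using \<tau>(1) by (rule stress.support_E)
  qed (use De assms(2) \<tau> \<tau>' \<tau>'e in auto)
  moreover have "(\<omega>1 e * \<omega>2 e) * (\<tau> f * \<tau>' e) = (\<omega>1 e * \<omega>2 e) * (\<tau> e * \<tau>' f)"
  proof -
    have "(\<omega>1 e * \<omega>2 e) * (\<tau> f * \<tau>' e) = (\<omega>1 f * \<tau> e) * (\<omega>2 e * \<tau>' e)" unfolding p1 by simp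
    also have "\<dots> = (\<omega>1 f * \<omega>2 e) * (\<tau> e * \<tau>' e)" by simp
    also have "\<dots> = \<omega>1 e * \<tau> e * (\<omega>2 f * \<tau>' e)" unfolding eq by simp
    also have "\<dots> = (\<omega>1 e * \<omega>2 e) * (\<tau> e * \<tau>' f)" unfolding p2 by simp
    finally show ?thesis .
  qed
  ultimately show False using \<omega>1(2) \<omega>2(2) by simp
qed

section \<open>Affine functions and affine dependencies in generic position\<close>

text \<open>Index \<open>d\<close> stands for the constant 1; the shift \<open>s\<close> chooses the
  projection, 0 for the first and 1 for the last \<open>d\<close> coordinates.\<close>

definition affine_fun :: "nat \<Rightarrow> nat \<Rightarrow> 'a \<Rightarrow> real" where
  "affine_fun s j v = (if j < d then q v (j + s) else 1)"

lemma affine_fun_generic: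
  assumes "finite G" "s \<le> 1" "lin_indep (r (\<lambda>v i. x0 v i)) G J"
    "\<And>p g j. r p g j = (if k g j < d then p (w g j) (k g j + s) else 1)"
    "\<And>g j. g \<in> G \<Longrightarrow> j \<in> J \<Longrightarrow> w g j \<in> V"
  shows "lin_indep (r q) G J"
proof -
  have "lin_indep (\<lambda>g j. r (\<lambda>v i. (\<lambda>(v, i). q v i) (v, i)) g j) G J"
  proof (rule alg_indep_lin_indep[where r = "\<lambda>x g j. r (\<lambda>v i. x (v, i)) g j"])
    show "algebraically_independent_over_rat (V \<times> {..<Suc d}) (\<lambda>(v, i). q v i)"
      using generic by (simp add: generic_framework_def)
    show "lin_indep (\<lambda>g j. r (\<lambda>v i. (\<lambda>(v, i). x0 v i) (v, i)) g j) G J" using assms(3) by simp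
    show "rat_poly_fun (V \<times> {..<Suc d}) (\<lambda>x. r (\<lambda>v i. x (v, i)) g j)" if "g \<in> G" "j \<in> J" for g j
      unfolding assms(4) using assms(2) assms(5)[OF that]
      by (cases "k g j < d") (auto intro!: rat_poly_fun.var rat_poly_fun_1)
  qed (rule assms(1))
  then show ?thesis by simp
qed

lemma affine_fun_indep:
  assumes "Suc d \<le> card V" "s \<le> 1"
  shows "lin_indep (affine_fun s) {..d} V"
proof -
  obtain f where f: "inj_on f {..d}" "f ` {..d} \<subseteq> V"
    using card_le_inj[OF _ finite_V, of "{..d}"] assms(1) by auto
  let ?r = "\<lambda>p j v. if j < d then p v (j + s) else (1 :: real)"
  \<comment> \<open>Special position: \<open>f 0, ..., f (d - 1)\<close> at the unit vectors and all
    other vertices, \<open>f d\<close> among them, at the origin; \<open>i - s\<close> undoes the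
    shift.\<close>
  have "lin_indep (?r (\<lambda>v i. if v = f (i - s) then 1 else 0)) {..d} V"
    unfolding lin_indep_def
  proof (intro allI impI ballI)
    fix c j assume c: "\<forall>v\<in>V. (\<Sum>j\<in>{..d}. c j * ?r (\<lambda>v i. if v = f (i - s) then 1 else 0) j v) = 0"
      and j: "j \<in> {..d}"
    have sum: "(\<Sum>j\<in>{..d}. c j * ?r (\<lambda>v i. if v = f (i - s) then 1 else 0) j v)
        = (\<Sum>j<d. c j * (if v = f j then 1 else 0)) + c d" for v
      by (simp add: lessThan_Suc_atMost[symmetric])
    have "(\<Sum>j<d. c j * (if f d = f j then 1 else 0)) = 0"
      using inj_on_eq_iff[OF f(1)] by (intro sum.neutral) auto
    then have cd: "c d = 0" using bspec[OF c, of "f d"] f(2) unfolding sum by auto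
    have "c j = 0" if "j < d" for j
    proof -
      have "(\<Sum>i<d. c i * (if f j = f i then 1 else 0)) = (\<Sum>i<d. if i = j then c i else 0)"
        using inj_on_eq_iff[OF f(1)] that by (intro sum.cong refl) auto
      also have "\<dots> = c j" using that by simp
      finally have s: "(\<Sum>i<d. c i * (if f j = f i then 1 else 0)) = c j" .
      have "f j \<in> V" using f(2) that by auto
      from bspec[OF c this] show ?thesis unfolding sum using s cd by simp
    qed
    then show "c j = 0" using j cd by (cases "j < d") auto
  qed
  then have "lin_indep (?r q) {..d} V"
    by (rule affine_fun_generic[OF _ assms(2), where k = "\<lambda>j v. j" and w = "\<lambda>j v. v", rotated]) auto
  moreover have "?r q = affine_fun s" by (simp add: affine_fun_def fun_eq_iff)
  ultimately show ?thesis by simp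
qed

lemma affine_points_indep:
  assumes "X \<subseteq> V" "card X \<le> Suc d" "s \<le> 1"
  shows "lin_indep (\<lambda>v j. affine_fun s j v) X {..d}"
proof -
  have fin: "finite X" using assms(1) finite_V finite_subset by blast
  obtain f where f: "inj_on f X" "f ` X \<subseteq> {..d}"
    using card_le_inj[OF fin, of "{..d}"] assms(2) by auto
  let ?r = "\<lambda>p v j. if j < d then p v (j + s) else (1 :: real)"
  \<comment> \<open>The vertices of \<open>X\<close> go to distinct points among the unit vectors
    and the origin, the latter for \<open>f v = d\<close>.\<close>
  have "lin_indep (?r (\<lambda>v i. if f v = i - s then 1 else 0)) X {..d}"
    unfolding lin_indep_def
  proof (intro allI impI)
    fix c assume c: "\<forall>j\<in>{..d}. (\<Sum>v\<in>X. c v * ?r (\<lambda>v i. if f v = i - s then 1 else 0) v j) = 0"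
    have small: "c w = 0" if "w \<in> X" "f w < d" for w
    proof -
      have "(\<Sum>v\<in>X. c v * ?r (\<lambda>v i. if f v = i - s then 1 else 0) v (f w)) = (\<Sum>v\<in>X. if v = w then c v else 0)"
        using that inj_on_eq_iff[OF f(1)] by (intro sum.cong refl) auto
      also have "\<dots> = c w" using that fin by simp
      finally show ?thesis using bspec[OF c, of "f w"] that by auto
    qed
    have "c w = 0" if "w \<in> X" "f w = d" for w
    proof -
      have "(\<Sum>v\<in>X. c v * ?r (\<lambda>v i. if f v = i - s then 1 else 0) v d) = (\<Sum>v\<in>X. if v = w then c v else 0)"
      proof (intro sum.cong refl)
        fix v assume v: "v \<in> X"
        have "f v < d" if "v \<noteq> w" using that v \<open>w \<in> X\<close> \<open>f w = d\<close> f by (metis atMost_iff image_subset_iff inj_onD le_neq_implies_less)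
        then show "c v * ?r (\<lambda>v i. if f v = i - s then 1 else 0) v d = (if v = w then c v else 0)"
          using small v by auto
      qed
      also have "\<dots> = c w" using that fin by simp
      finally show ?thesis using bspec[OF c, of d] by auto
    qed
    moreover have "f w < d \<or> f w = d" if "w \<in> X" for w using f(2) that by (auto simp: le_less)
    ultimately show "\<forall>w\<in>X. c w = 0" using small by blast
  qed
  then have "lin_indep (?r q) X {..d}"
    by (rule affine_fun_generic[OF fin assms(3), where k = "\<lambda>v j. j" and w = "\<lambda>v j. v"]) (use assms(1) in auto)
  then show ?thesis unfolding affine_fun_def .
qed

text \<open>The trivial motions are orthogonal to all rows. For \<open>j < d\<close> the field
  \<open>T (i, j)\<close> is an infinitesimal rotation, for \<open>j = d\<close> the translation in
  direction \<open>i\<close>.\<close>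

lemma rank_bound:
  assumes "Suc d \<le> card V" "F \<subseteq> E" "indep {..<d} q F"
  shows "card F + (Suc d choose 2) \<le> d * card V"
proof -
  let ?I = "{(i, j). i < j \<and> j \<le> d}"
  define T where "T = (\<lambda>(i, j) (v, l). if l = i then affine_fun 0 j v else if l = j then - q v i else 0)"
  have finI: "finite ?I" by (rule finite_subset[of _ "{..d} \<times> {..d}"]) auto
  have cardI: "card ?I = Suc d choose 2"
  proof -
    have "bij_betw (\<lambda>(i, j). {i, j}) ?I {K. K \<subseteq> {..d} \<and> card K = 2}"
      unfolding bij_betw_def
    proof
      show "inj_on (\<lambda>(i, j). {i, j}) ?I" by (auto simp: inj_on_def doubleton_eq_iff)
      show "(\<lambda>(i, j). {i, j}) ` ?I = {K. K \<subseteq> {..d} \<and> card K = 2}"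
      proof (intro equalityI subsetI)
        fix K assume "K \<in> {K. K \<subseteq> {..d} \<and> card K = 2}"
        then obtain a b where "K = {a, b}" "a \<noteq> b" "a \<le> d" "b \<le> d" by (auto simp: card_2_iff)
        then show "K \<in> (\<lambda>(i, j). {i, j}) ` ?I"
          by (cases "a < b") (force simp: insert_commute)+
      qed auto
    qed
    then show ?thesis using n_subsets[of "{..d}" 2] by (simp add: bij_betw_same_card)
  qed
  have finF: "finite F" using assms(2) finite_E finite_subset by blast
  have "card F + card ?I \<le> card (V \<times> {..<d})"
  proof (rule lin_indep_orthogonal_card[of F ?I _ "rigidity_matrix q" T])
    show "lin_indep (rigidity_matrix q) F (V \<times> {..<d})" using lin_indep_iff assms by blast
    show "lin_indep T ?I (V \<times> {..<d})"
      unfolding lin_indep_def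
    proof (intro allI impI ballI)
      fix c x assume c: "\<forall>y\<in>V \<times> {..<d}. (\<Sum>x\<in>?I. c x * T x y) = 0" and "x \<in> ?I"
      then obtain l m where x: "x = (l, m)" "l < m" "m \<le> d" by auto
      \<comment> \<open>In column \<open>l\<close> a combination of trivial motions is an affine
        function with coefficients \<open>b\<close>, so these vanish.\<close>
      define b where "b n = (if l < n then c (l, n) else if n < l then - c (n, l) else 0)" for n
      have "(\<Sum>n\<in>{..d}. b n * affine_fun 0 n v) = 0" if v: "v \<in> V" for v
      proof -
        have "(\<Sum>x\<in>?I. c x * T x (v, l)) = (\<Sum>x\<in>{l} \<times> {l<..d} \<union> {..<l} \<times> {l}. c x * T x (v, l))"
          using x finI by (intro sum.mono_neutral_right) (auto simp: T_def split: if_splits)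
        also have "\<dots> = (\<Sum>x\<in>{l} \<times> {l<..d}. c x * T x (v, l)) + (\<Sum>x\<in>{..<l} \<times> {l}. c x * T x (v, l))"
          by (intro sum.union_disjoint) auto
        also have "(\<Sum>x\<in>{l} \<times> {l<..d}. c x * T x (v, l)) = (\<Sum>n\<in>{l<..d}. b n * affine_fun 0 n v)"
          by (simp add: sum.cartesian_product' T_def b_def)
        also have "(\<Sum>x\<in>{..<l} \<times> {l}. c x * T x (v, l)) = (\<Sum>n\<in>{..<l}. b n * affine_fun 0 n v)"
          using x by (simp add: sum.cartesian_product' T_def b_def affine_fun_def)
        also have "(\<Sum>n\<in>{l<..d}. b n * affine_fun 0 n v) + (\<Sum>n\<in>{..<l}. b n * affine_fun 0 n v)
            = (\<Sum>n\<in>{l<..d} \<union> {..<l}. b n * affine_fun 0 n v)"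
          by (intro sum.union_disjoint[symmetric]) auto
        also have "\<dots> = (\<Sum>n\<in>{..d}. b n * affine_fun 0 n v)"
          using x by (intro sum.mono_neutral_left) (auto simp: b_def)
        finally show ?thesis using bspec[OF c, of "(v, l)"] v x by auto
      qed
      then have "b m = 0"
        using lin_indepD[OF affine_fun_indep[OF assms(1), of 0], of b m] x by auto
      then show "c x = 0" using x by (simp add: b_def)
    qed
    fix g x assume g: "g \<in> F" and "x \<in> ?I"
    then obtain i j where x: "x = (i, j)" "i < j" "j \<le> d" by auto
    have gE: "g \<in> E" using g assms(2) by blast
    let ?Y = "\<lambda>v l. T x (v, l)"
    have "(\<Sum>y\<in>V \<times> {..<d}. rigidity_matrix q g y * T x y)
        = (\<Sum>l<d. edge_form g (coord ?Y l) (coord q l))"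
      using row_dot[OF gE, of "{..<d}" q ?Y] by (simp add: case_prod_unfold)
    also have "\<dots> = (\<Sum>l<d. if l = i then edge_form g (affine_fun 0 j) (coord q i)
        else if l = j then - edge_form g (coord q i) (coord q j) else 0)"
    proof (intro sum.cong refl)
      fix l
      have "coord ?Y l = (if l = i then affine_fun 0 j else if l = j then (\<lambda>v. (- 1) * coord q i v + 0 * 0) else (\<lambda>v. 0))"
        by (auto simp: coord_def T_def x(1) fun_eq_iff)
      moreover have "edge_form g (\<lambda>v. (- 1) * coord q i v + 0 * 0) h = - edge_form g (coord q i) h" for h
        using edge_form_add[OF gE, of "- 1" "coord q i" 0 "\<lambda>v. 0" h] by simp
      ultimately show "edge_form g (coord ?Y l) (coord q l) = (if l = i then edge_form g (affine_fun 0 j) (coord q i)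
          else if l = j then - edge_form g (coord q i) (coord q j) else 0)"
        by (simp add: edge_form_def)
    qed
    also have "\<dots> = 0"
    proof (cases "j < d")
      case True
      then have "affine_fun 0 j = coord q j" by (simp add: affine_fun_def coord_def fun_eq_iff)
      moreover have "(\<Sum>l<d. if l = i then A else if l = j then B else 0) = A + B" for A B :: real
      proof -
        have "(\<Sum>l<d. if l = i then A else if l = j then B else 0) = (\<Sum>l\<in>{i, j}. if l = i then A else if l = j then B else 0)"
          using x True by (intro sum.mono_neutral_right) auto
        then show ?thesis using x by simp
      qed
      ultimately show ?thesis using edge_form_sym[OF gE] by simp
    next
      case False
      then have "affine_fun 0 j = (\<lambda>v. 0 + 1)" by (simp add: affine_fun_def fun_eq_iff)
      then have "edge_form g (affine_fun 0 j) (coord q i) = 0"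
        using edge_form_const[OF gE, of "\<lambda>v. 0" 1] by (simp add: edge_form_def)
      then show ?thesis using False by (intro sum.neutral) auto
    qed
    finally show "(\<Sum>y\<in>V \<times> {..<d}. rigidity_matrix q g y * T x y) = 0" .
  qed (use finF finI finite_V in auto)
  then show ?thesis using cardI by (simp add: card_cartesian_product mult.commute)
qed

text \<open>With at most \<open>d\<close> stressed neighbours, \<open>v\<close> and these would be
  affinely independent generic points, but equilibrium at \<open>v\<close> is an affine dependency
  between them.\<close>

lemma stress_degree:
  assumes "\<omega> \<in> stresses {..<d} q" "v \<in> V" "w0 \<in> V" "w0 \<noteq> v" "\<omega> {v, w0} \<noteq> 0"
  shows "card {w \<in> V - {v}. \<omega> {v, w} \<noteq> 0} \<ge> Suc d"
proof (rule ccontr)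
  let ?N = "{w \<in> V - {v}. \<omega> {v, w} \<noteq> 0}"
  assume "\<not> ?thesis"
  then have card: "card ?N \<le> d" by simp
  have fin: "finite ?N" using finite_V by simp
  define u where "u w = (if w = v then - (\<Sum>w\<in>?N. \<omega> {v, w}) else \<omega> {v, w})" for w
  have L: "lin_indep (\<lambda>v j. affine_fun 0 j v) (insert v ?N) {..d}"
    using assms(2) card fin by (intro affine_points_indep) (auto simp: card_insert_if)
  have uN: "(\<Sum>w\<in>?N. u w * h w) = (\<Sum>w\<in>?N. \<omega> {v, w} * h w)" for h
    by (intro sum.cong) (auto simp: u_def)
  have "(\<Sum>w\<in>insert v ?N. u w * affine_fun 0 j w) = 0" for j
  proof (cases "j < d")
    case True
    have "(\<Sum>w\<in>?N. \<omega> {v, w} * (q v j - q w j)) = (\<Sum>w\<in>V - {v}. \<omega> {v, w} * (q v j - q w j))"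
      using finite_V by (intro sum.mono_neutral_left) auto
    also have "\<dots> = bform \<omega> (delta v) (coord q j)"
      using bform_delta_nbrs[OF stress.support_E[OF assms(1)] assms(2)] by (simp add: coord_def)
    also have "\<dots> = 0" using assms(1) True by (simp add: stressesD)
    finally have "(\<Sum>w\<in>?N. \<omega> {v, w} * q v j) = (\<Sum>w\<in>?N. \<omega> {v, w} * q w j)"
      by (simp add: right_diff_distrib sum_subtractf)
    then show ?thesis
      using True fin by (simp add: affine_fun_def uN, simp add: u_def sum_distrib_right)
  next
    case False
    then show ?thesis using fin uN[of "\<lambda>_. 1"] by (simp add: affine_fun_def) (simp add: u_def)
  qed
  then have "u w0 = 0" using lin_indepD[OF L] assms by blast
  then show False using assms by (simp add: u_def)
qed

text \<open>Ensures that deleting a stressed edge isolates neither of its ends, and that no single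
  edge is dependent.\<close>

lemma stress_touches:
  assumes "\<omega> \<in> stresses {..<d} q" "\<omega> e \<noteq> 0" "v \<in> e"
  shows "\<exists>g. g \<noteq> e \<and> v \<in> g \<and> \<omega> g \<noteq> 0"
proof -
  have "e \<in> E" using stress.support_E[OF assms(1)] assms(2) by (auto simp: support_def)
  then obtain w where w: "e = {v, w}" "v \<noteq> w" "v \<in> V" "w \<in> V"
    using assms(3) by (elim edge_pair) (auto simp: insert_commute)
  let ?N = "{w \<in> V - {v}. \<omega> {v, w} \<noteq> 0}"
  have "card ?N \<ge> 2" using stress_degree[OF assms(1), of v w] w assms(2) d_pos by auto
  then have "\<not> ?N \<subseteq> {w}" using card_mono[of "{w}" ?N] by auto
  then obtain x where "x \<in> ?N" "x \<noteq> w" by blast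
  then show ?thesis using w by (intro exI[of _ "{v, x}"]) (auto simp: doubleton_eq_iff)
qed

text \<open>On \<open>d + 2\<close> vertices the bound of \<open>stress_degree\<close> joins every
  stressed vertex to all others.\<close>

lemma complete_if_stress:
  assumes "card V = d + 2" "\<omega> \<in> stresses {..<d} q" "support \<omega> \<noteq> {}"
  shows "complete_graph (d + 2) V E"
proof -
  have full: "\<omega> {v, x} \<noteq> 0"
    if v: "v \<in> V" "w \<in> V" "w \<noteq> v" "\<omega> {v, w} \<noteq> 0" and x: "x \<in> V" "x \<noteq> v" for v w x
  proof -
    let ?N = "{w \<in> V - {v}. \<omega> {v, w} \<noteq> 0}"
    have "card (V - {v}) \<le> card ?N"
      using stress_degree[OF assms(2) v] v(1) assms(1) finite_V by simp
    then have "?N = V - {v}" using finite_V by (intro card_seteq) auto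
    then show ?thesis using x by blast
  qed
  obtain g where g: "\<omega> g \<noteq> 0" using assms(3) by (auto simp: support_def)
  then have "g \<in> E" using stress.support_E[OF assms(2)] by (auto simp: support_def)
  then obtain a b where ab: "a \<noteq> b" "a \<in> V" "b \<in> V" "g = {a, b}" by (rule edge_pair)
  have all: "\<omega> {v, w} \<noteq> 0" if vw: "v \<in> V" "w \<in> V" "v \<noteq> w" for v w
  proof (cases "v = a")
    case True
    then show ?thesis using full[of a b w] ab g vw by auto
  next
    case False
    then have "\<omega> {v, a} \<noteq> 0" using full[of a b v] ab g vw by (auto simp: insert_commute)
    then show ?thesis using full[of v a w] ab vw False by auto
  qed
  have "E = {e. e \<subseteq> V \<and> card e = 2}"
  proof
    show "E \<subseteq> {e. e \<subseteq> V \<and> card e = 2}" using simple by (auto simp: simple_graph_def)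
    show "{e. e \<subseteq> V \<and> card e = 2} \<subseteq> E"
    proof
      fix e assume "e \<in> {e. e \<subseteq> V \<and> card e = 2}"
      then obtain v w where "e = {v, w}" "v \<noteq> w" "v \<in> V" "w \<in> V" by (auto simp: card_2_iff)
      then have "\<omega> e \<noteq> 0" using all by simp
      then show "e \<in> E" using stress.support_E[OF assms(2)] by (auto simp: support_def)
    qed
  qed
  then show ?thesis using assms(1) finite_V by (simp add: complete_graph_def)
qed

text \<open>More than \<open>card C + 1\<close> points are affinely dependent. The coefficients sum
  to 0, so two of them are nonzero, and the resulting rank-one stress does not vanish.\<close>

lemma complete_stress_exists:
  assumes "X \<subseteq> V" "\<And>v w. v \<in> X \<Longrightarrow> w \<in> X \<Longrightarrow> v \<noteq> w \<Longrightarrow> {v, w} \<in> E"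
    "finite C" "card X > Suc (card C)"
  shows "\<exists>\<omega>\<in>stresses C q. support \<omega> \<noteq> {}"
proof -
  have fin: "finite X" using assms(1) finite_V finite_subset by blast
  let ?r = "\<lambda>v. case_option 1 (q v)"
  have "card (insert None (Some ` C)) = Suc (card C)" using assms(3) by (simp add: card_image)
  then have "\<not> lin_indep ?r X (insert None (Some ` C))"
    using lin_indep_card_le[OF fin, of "insert None (Some ` C)" ?r] assms(3,4) by auto
  then obtain u v where u: "\<forall>j\<in>insert None (Some ` C). (\<Sum>v\<in>X. u v * ?r v j) = 0" and v: "v \<in> X" "u v \<noteq> 0"
    unfolding lin_indep_def by blast
  have sums: "(\<Sum>v\<in>X. u v) = 0" "\<And>i. i \<in> C \<Longrightarrow> (\<Sum>v\<in>X. u v * q v i) = 0" using u by auto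
  let ?\<omega> = "\<lambda>g. if g \<in> E \<and> g \<subseteq> X then \<Prod>v\<in>g. u v else 0"
  have "?\<omega> \<in> stresses C q" by (rule complete_stress[OF assms(1,2) sums])
  moreover have "\<exists>w\<in>X - {v}. u w \<noteq> 0"
  proof (rule ccontr)
    assume "\<not> ?thesis"
    then have "(\<Sum>v\<in>X. u v) = u v" using sum.remove[OF fin v(1), of u] by simp
    then show False using sums(1) v(2) by simp
  qed
  then obtain w where w: "w \<in> X" "w \<noteq> v" "u w \<noteq> 0" by blast
  then have "?\<omega> {v, w} \<noteq> 0" using v assms(2)[of v w] by auto
  then have "support ?\<omega> \<noteq> {}" using in_support[of "{v, w}" ?\<omega>] by blast
  ultimately show ?thesis by blast
qed

text \<open>An additional column detects that \<open>\<Omega>\<^sub>\<omega>\<close> is nonzero at the generic coordinate \<open>0\<close>.\<close>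

lemma self_form_nonzero:
  assumes J: "stress.cobasis {1..d} q J" "j \<in> J"
    and \<omega>: "\<omega> \<in> stresses {1..d} q" "\<And>i. i \<in> J \<Longrightarrow> \<omega> i = (if i = j then 1 else 0)"
  shows "bform \<omega> (coord q 0) (coord q 0) \<noteq> 0"
proof
  assume zero: "bform \<omega> (coord q 0) (coord q 0) = 0"
  have jE: "j \<in> E" using J by (auto simp: stress.cobasis_def)
  then obtain a b where ab: "a \<noteq> b" "a \<in> V" "b \<in> V" "j = {a, b}" by (rule edge_pair)
  have supp: "support \<omega> \<subseteq> insert j (E - J)"
    using stress.support_E[OF \<omega>(1)] \<omega>(2) by (auto simp: support_def split: if_splits)
  have "\<exists>h. bform \<omega> h h \<noteq> 0"
  proof (rule ccontr)
    assume "\<not> ?thesis"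
    then have z: "bform \<omega> h h = 0" for h by blast
    have "bform \<omega> (\<lambda>v. 1 * delta a v + 1 * delta b v) (\<lambda>v. 1 * delta a v + 1 * delta b v)
        = bform \<omega> (delta a) (delta a) + 2 * bform \<omega> (delta a) (delta b) + bform \<omega> (delta b) (delta b)"
      unfolding bform_add
      by (subst (1 2) bform_sym, unfold bform_add) (simp add: bform_sym[of \<omega> "delta b" "delta a"])
    then have "bform \<omega> (delta a) (delta b) = 0" using z by simp
    then show False using bform_delta_delta[OF ab(2,3,1) stress.support_E[OF \<omega>(1)]] \<omega>(2)[OF J(2)] ab(4) by simp
  qed
  then obtain h where h: "bform \<omega> h h \<noteq> 0" by blast
  let ?F = "insert j (E - J)"
  let ?J = "insert None (Some ` (V \<times> {1..d}))"
  have F: "?F \<subseteq> E" using jE by blast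
  define r where "r x g = case_option (edge_form g (\<lambda>v. x (v, 0)) (\<lambda>v. x (v, 0)))
      (rigidity_matrix (\<lambda>v i. x (v, i)) g)" for x :: "'a \<times> nat \<Rightarrow> real" and g
  \<comment> \<open>Only coordinate 0 changes, so the stresses in the coordinates
    \<open>{1..d}\<close> are those of \<open>q\<close>. On \<open>?F\<close> they are multiples of
    \<open>\<omega>\<close>, which the additional column excludes because
    \<open>bform \<omega> h h\<close> is nonzero.\<close>
  define p where "p v i = (if i = 0 then h v else q v i)" for v and i :: nat
  have sums: "(\<Sum>g\<in>?F. c g * r (\<lambda>(v, i). p v i) g None) = bform (restr ?F c) (coord p 0) (coord p 0)"
    "(\<Sum>g\<in>?F. c g * r (\<lambda>(v, i). p v i) g (Some (v, i))) = bform (restr ?F c) (delta v) (coord p i)" for c v i p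
  proof -
    have "(\<Sum>g\<in>?F. c g * r (\<lambda>(v, i). p v i) g None) = (\<Sum>g\<in>E. restr ?F c g * edge_form g (coord p 0) (coord p 0))"
      using F finite_E by (intro sum.mono_neutral_cong_left) (auto simp: r_def restr_def coord_def[abs_def])
    then show "(\<Sum>g\<in>?F. c g * r (\<lambda>(v, i). p v i) g None) = bform (restr ?F c) (coord p 0) (coord p 0)"
      by (simp add: bform_def)
    have "(\<Sum>g\<in>?F. c g * r (\<lambda>(v, i). p v i) g (Some (v, i))) = (\<Sum>g\<in>E. restr ?F c g * edge_form g (delta v) (coord p i))"
      using F finite_E
      by (intro sum.mono_neutral_cong_left) (auto simp: r_def restr_def edge_form_delta finite_edge)
    then show "(\<Sum>g\<in>?F. c g * r (\<lambda>(v, i). p v i) g (Some (v, i))) = bform (restr ?F c) (delta v) (coord p i)"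
      by (simp add: bform_def)
  qed
  have "lin_indep (r (\<lambda>(v, i). p v i)) ?F ?J"
    unfolding lin_indep_def
  proof (intro allI impI)
    fix c assume c: "\<forall>y\<in>?J. (\<Sum>g\<in>?F. c g * r (\<lambda>(v, i). p v i) g y) = 0"
    have "bform (restr ?F c) (delta v) (coord p i) = 0" if "v \<in> V" "i \<in> {1..d}" for v i
      unfolding sums(2)[symmetric] using c that by blast
    then have "restr ?F c \<in> stresses {1..d} p" using F
      by (intro stressesI) (auto simp: restr_def support_def split: if_splits)
    also have "stresses {1..d} p = stresses {1..d} q" by (rule stresses_cong) (auto simp: p_def)
    finally have "(\<lambda>g. restr ?F c g - c j * \<omega> g) \<in> stresses {1..d} q" using \<omega>(1) by (intro stress.diff)
    moreover have "support (\<lambda>g. restr ?F c g - c j * \<omega> g) \<subseteq> E - J"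
    proof
      fix g assume "g \<in> support (\<lambda>g. restr ?F c g - c j * \<omega> g)"
      then have "restr ?F c g - c j * \<omega> g \<noteq> 0" by (simp add: support_def)
      moreover from this have "g \<in> ?F" using supp by (auto simp: restr_def support_def split: if_splits)
      ultimately show "g \<in> E - J" using \<omega>(2)[OF J(2)] by (auto simp: restr_def)
    qed
    ultimately have "support (\<lambda>g. restr ?F c g - c j * \<omega> g) = {}"
      using J(1) by (auto simp: stress.cobasis_def stress.ind_def)
    then have eq: "restr ?F c = (\<lambda>g. c j * \<omega> g)" by (auto simp: support_def fun_eq_iff)
    have "bform (restr ?F c) (coord p 0) (coord p 0) = 0" using c unfolding sums(1)[symmetric] by blast
    moreover have "coord p 0 = h" by (simp add: coord_def p_def fun_eq_iff)
    ultimately have "bform (\<lambda>g. c j * \<omega> g + 0 * \<omega> g) h h = 0" by (simp add: eq)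
    then have "c j = 0" unfolding bform_lin using h by simp
    then have z: "restr ?F c g = 0" for g using eq by simp
    show "\<forall>g\<in>?F. c g = 0"
    proof
      fix g assume "g \<in> ?F"
      then show "c g = 0" using z[of g] by (simp only: restr_def if_True)
    qed
  qed
  then have L: "lin_indep (r (\<lambda>(v, i). q v i)) ?F ?J"
  proof (rule alg_indep_lin_indep[rotated -1])
    show "algebraically_independent_over_rat (V \<times> {..<Suc d}) (\<lambda>(v, i). q v i)"
      using generic by (simp add: generic_framework_def)
    show "finite ?F" using finite_E by simp
    fix g y assume g: "g \<in> ?F" and y: "y \<in> ?J"
    have gV: "g \<subseteq> V" using g F edge_subset by blast
    show "rat_poly_fun (V \<times> {..<Suc d}) (\<lambda>x. r x g y)"
    proof (cases y)
      case None
      show ?thesis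
        unfolding None r_def option.case edge_form_def using gV
        by (intro rat_poly_fun_sum rat_poly_fun.mult rat_poly_fun_diff rat_poly_fun.var) auto
    next
      case (Some vi)
      then obtain v i where vi: "y = Some (v, i)" "v \<in> V" "i \<in> {1..d}" using y by auto
      show ?thesis
        unfolding vi(1) r_def option.case rigidity_matrix_def using gV vi(2,3)
        by (cases "v \<in> g") (auto intro!: rat_poly_fun_sum rat_poly_fun_diff rat_poly_fun.var rat_poly_fun_0)
    qed
  qed
  have r: "restr ?F \<omega> = \<omega>" using supp by (auto simp: restr_def support_def fun_eq_iff)
  have "(\<Sum>g\<in>?F. \<omega> g * r (\<lambda>(v, i). q v i) g y) = 0" if "y \<in> ?J" for y
    using that zero stressesD[OF \<omega>(1)] by (cases y) (auto simp only: sums r)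
  from lin_indepD[OF L this, of j] show False using \<omega>(2)[OF J(2)] by simp
qed

end

section \<open>Minimally connected components\<close>

lemma double_choose_two: "2 * (n choose 2) = n * (n - 1)"
proof -
  have "even (n * (n - 1))" by (cases n) auto
  then show ?thesis by (simp add: choose_two)
qed

locale split_graph = generic_graph +
  assumes splittable: "stress.splittable {..<d} q"
begin

text \<open>A stress in dimension \<open>d + 1\<close> is a stress of both projections, so it can be
  compared with itself in \<open>series_ratio_differs\<close>.\<close>

lemma no_big_stress:
  assumes "\<omega> \<in> stresses {..d} q"
  shows "support \<omega> = {}"
proof (rule ccontr)
  assume "support \<omega> \<noteq> {}"
  then obtain e0 where e0: "\<omega> e0 \<noteq> 0" by (auto simp: support_def)
  have "{..<d} \<subseteq> {..d}" "{1..d} \<subseteq> {..d}" by auto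
  then have \<omega>: "\<omega> \<in> stresses {..<d} q" "\<omega> \<in> stresses {1..d} q" using assms stresses_mono by blast+
  obtain e f where ef: "e \<noteq> f" "\<omega> e \<noteq> 0" "\<omega> f \<noteq> 0"
    "\<And>\<tau>. \<tau> \<in> stresses {..<d} q \<Longrightarrow> \<tau> e = 0 \<Longrightarrow> \<tau> f = 0"
    using stress.splittable_series_pair[OF splittable \<omega>(1) e0] by blast
  have "\<omega> f * \<omega> e \<noteq> \<omega> e * \<omega> f"
    by (rule series_ratio_differs[of e f \<omega> \<omega>]) (use ef \<omega> in auto)
  then show False by simp
qed

section \<open>Dimension counts and tightness\<close>

text \<open>The orthogonal family \<open>a\<close> is left open: the affine functions give the
  bound, and \<open>tight_affine\<close> adds one more function to them.\<close>

lemma cobasis_count: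
  assumes J: "stress.cobasis C q J" and C: "insert k C = {..d}"
    and I: "finite I" "lin_indep a I V"
    and orth: "\<And>\<omega> i. \<omega> \<in> stresses C q \<Longrightarrow> i \<in> I \<Longrightarrow> bform \<omega> (a i) (coord q k) = 0"
  shows "card J + card I \<le> card V"
proof -
  obtain W where W: "\<And>j. j \<in> J \<Longrightarrow> W j \<in> stresses C q"
    "\<And>i j. i \<in> J \<Longrightarrow> j \<in> J \<Longrightarrow> W j i = (if i = j then 1 else 0)"
    using J by (rule stress.cobasis_dual) (rule that)
  have finJ: "finite J" using J finite_E finite_subset by (auto simp: stress.cobasis_def)
  let ?r = "\<lambda>j v. bform (W j) (delta v) (coord q k)"
  have "lin_indep ?r J V"
    unfolding lin_indep_def
  proof (intro allI impI ballI)
    fix c j assume c: "\<forall>v\<in>V. (\<Sum>j\<in>J. c j * ?r j v) = 0" and j: "j \<in> J"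
    let ?w = "\<lambda>g. \<Sum>j\<in>J. c j * W j g"
    have w: "?w \<in> stresses C q" using W(1) by (rule stress.sum_in)
    have "?w \<in> stresses {..d} q"
    proof (rule stressesI)
      show "support ?w \<subseteq> E" using w by (rule stress.support_E)
      fix i v assume i: "i \<in> {..d}" and v: "v \<in> V"
      show "bform ?w (delta v) (coord q i) = 0"
      proof (cases "i = k")
        case True
        then show ?thesis using c v by (simp add: bform_stress_sum)
      next
        case False
        then have "i \<in> C" using i C by blast
        then show ?thesis by (rule stressesD[OF w])
      qed
    qed
    then have "support ?w = {}" by (rule no_big_stress)
    then have "?w j = 0" using in_support[of j ?w] by auto
    then show "c j = 0" using W(2)[OF j] j finJ by (simp add: if_distrib[of "(*) _"] cong: if_cong)
  qed
  then show ?thesis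
  proof (rule lin_indep_orthogonal_card[OF finJ I(1) finite_V _ I(2)])
    show "(\<Sum>v\<in>V. ?r j v * a i v) = 0" if "j \<in> J" "i \<in> I" for j i
      using orth[OF W(1)[OF that(1)] that(2)] by (subst (asm) bform_delta) (simp add: mult.commute)
  qed
qed

lemma bform_affine_fun:
  assumes "\<omega> \<in> stresses {s..<s + d} q"
  shows "bform \<omega> (affine_fun s i) h = 0"
proof (cases "i < d")
  case True
  then have "affine_fun s i = coord q (i + s)" by (simp add: affine_fun_def coord_def fun_eq_iff)
  then show ?thesis using stressesD[OF assms, of "i + s" h] True by (simp add: bform_sym)
next
  case False
  then have "affine_fun s i = (\<lambda>v. 1)" by (simp add: affine_fun_def fun_eq_iff)
  then show ?thesis by (simp add: bform_one)
qed

lemma cobasis_card: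
  assumes "stress.cobasis {..<d} q J" "Suc d \<le> card V"
  shows "card J + Suc d \<le> card V"
proof -
  have "card J + card {..d} \<le> card V"
  proof (rule cobasis_count[OF assms(1)])
    show "insert d {..<d} = {..d}" by auto
    show "lin_indep (affine_fun 0) {..d} V" using assms(2) by (intro affine_fun_indep) simp_all
    show "bform \<omega> (affine_fun 0 i) (coord q d) = 0" if "\<omega> \<in> stresses {..<d} q" for \<omega> i
      using bform_affine_fun[of \<omega> 0] that by (simp add: lessThan_atLeast0)
  qed simp
  then show ?thesis by simp
qed

text \<open>In the tight case the affine functions fill the orthogonal complement of the vectors
  \<open>\<Omega> q_k\<close>, which leaves no room for another orthogonal function.\<close>

lemma tight_affine:
  assumes J: "stress.cobasis {s..<s + d} q J" and C: "insert k {s..<s + d} = {..d}" and "s \<le> 1"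
    and tight: "card J + Suc d = card V"
    and orth: "\<And>\<omega>. \<omega> \<in> stresses {s..<s + d} q \<Longrightarrow> bform \<omega> z (coord q k) = 0"
  shows "\<exists>b. \<forall>v\<in>V. z v = (\<Sum>i\<in>{..d}. b i * affine_fun s i v)"
proof (rule ccontr)
  assume no: "\<not> ?thesis"
  let ?a = "\<lambda>i. if i \<le> d then affine_fun s i else z"
  have aff: "lin_indep (affine_fun s) {..d} V" using tight assms(3) by (intro affine_fun_indep) auto
  have "lin_indep ?a {..Suc d} V"
    unfolding lin_indep_def
  proof (intro allI impI)
    fix c assume c: "\<forall>v\<in>V. (\<Sum>i\<in>{..Suc d}. c i * ?a i v) = 0"
    have c': "(\<Sum>i\<in>{..d}. c i * affine_fun s i v) + c (Suc d) * z v = 0" if "v \<in> V" for v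
      using c that by simp
    have cd: "c (Suc d) = 0"
    proof (rule ccontr)
      assume nz: "c (Suc d) \<noteq> 0"
      have "z v = (\<Sum>i\<in>{..d}. (- c i / c (Suc d)) * affine_fun s i v)" if "v \<in> V" for v
        using c'[OF that] nz
        by (simp add: sum_divide_distrib[symmetric] sum_negf field_simps add_eq_0_iff)
      then have "\<exists>b. \<forall>v\<in>V. z v = (\<Sum>i\<in>{..d}. b i * affine_fun s i v)"
        by (intro exI[of _ "\<lambda>i. - c i / c (Suc d)"]) simp
      then show False using no by simp
    qed
    then have "c i = 0" if "i \<le> d" for i
      using c' lin_indepD[OF aff, of c i] that by simp
    then show "\<forall>i\<in>{..Suc d}. c i = 0" using cd by (auto simp: le_Suc_eq)
  qed
  from cobasis_count[OF J C _ this] have "card J + card {..Suc d} \<le> card V"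
    using orth bform_affine_fun by simp
  then show False using tight by simp
qed

section \<open>Motions and kernel vectors\<close>

text \<open>By \<open>no_big_stress\<close> the rows are independent in dimension
  \<open>d + 1\<close>, so some velocity field changes the length of \<open>e\<close> alone.\<close>

lemma edge_motion:
  "\<exists>Y. \<forall>g\<in>E. (\<Sum>i\<in>{..d}. edge_form g (coord Y i) (coord q i)) = (if g = e then 1 else 0)"
proof -
  have "indep {..d} q E" using no_big_stress by (auto simp: stress.ind_def)
  then have "lin_indep (rigidity_matrix q) E (V \<times> {..d})" using lin_indep_iff by blast
  from lin_indep_solvable[OF finite_E _ this, of "\<lambda>g. if g = e then 1 else 0"]
  obtain y where y: "\<forall>g\<in>E. (\<Sum>j\<in>V \<times> {..d}. rigidity_matrix q g j * y j) = (if g = e then 1 else 0)"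
    using finite_V by auto
  let ?Y = "\<lambda>v i. y (v, i)"
  have "(\<Sum>i\<in>{..d}. edge_form g (coord ?Y i) (coord q i)) = (if g = e then 1 else 0)" if g: "g \<in> E" for g
    using row_dot[OF g, of "{..d}" q ?Y] bspec[OF y g] by (simp add: case_prod_unfold)
  then show ?thesis by (intro exI[of _ ?Y]) blast
qed

text \<open>Weighting the edge equations of the motion by \<open>\<omega>\<close> gives
  \<open>\<omega> e\<close>; coordinates in \<open>C\<close> contribute 0 by equilibrium.\<close>

lemma edge_motion_stress:
  assumes Y: "\<forall>g\<in>E. (\<Sum>i\<in>{..d}. edge_form g (coord Y i) (coord q i)) = (if g = e then 1 else 0)"
    and C: "insert k C = {..d}" "k \<notin> C" and \<omega>: "\<omega> \<in> stresses C q"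
  shows "bform \<omega> (coord Y k) (coord q k) = \<omega> e"
proof -
  have fin: "finite C" using C(1) by (metis finite_atMost finite_insert)
  have "(\<Sum>i\<in>{..d}. bform \<omega> (coord Y i) (coord q i)) = bform \<omega> (coord Y k) (coord q k)"
    unfolding C(1)[symmetric] using C(2) fin by (simp add: stressesD[OF \<omega>])
  moreover have "(\<Sum>i\<in>{..d}. bform \<omega> (coord Y i) (coord q i))
      = (\<Sum>g\<in>E. \<omega> g * (\<Sum>i\<in>{..d}. edge_form g (coord Y i) (coord q i)))"
    unfolding bform_def sum_distrib_left by (rule sum.swap)
  moreover have "\<dots> = (\<Sum>g\<in>E. if g = e then \<omega> g else 0)"
    using Y by (intro sum.cong refl) simp
  moreover have "\<dots> = \<omega> e"
    using finite_E stress.support_E[OF \<omega>] by (auto simp: support_def)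
  ultimately show ?thesis by simp
qed

lemma front_interval: "{0..<0 + d} = {..<d}" and back_interval: "{1..<1 + d} = {1..d}"
  by auto

text \<open>For a series pair \<open>e, f\<close> the stress matrices vanishing at \<open>e\<close> have a common kernel vector
  which is not affine: combine the motions \<open>Y\<^sub>e\<close>, \<open>Y\<^sub>f\<close> of \<open>E - e\<close>, \<open>E - f\<close> in dimension
  \<open>d + 1\<close> into a motion of \<open>E - e - f\<close> in dimension \<open>d\<close>; its coordinates are in the kernel by
  \<open>motion_stress\<close>, and by \<open>series_ratio_differs\<close> the \<open>0\<close>-th one is not affine.\<close>

lemma kernel_vector:
  assumes J: "stress.cobasis {..<d} q J" and tight: "card J + Suc d = card V"
    and e: "e \<in> J" and j2: "j2 \<in> J" "j2 \<noteq> e"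
    and ser: "f \<noteq> e" "\<omega>f \<in> stresses {..<d} q" "\<omega>f f \<noteq> 0"
      "\<And>\<omega>. \<omega> \<in> stresses {..<d} q \<Longrightarrow> \<omega> e = 0 \<Longrightarrow> \<omega> f = 0"
  shows "\<exists>w. \<not> (\<exists>b. \<forall>v\<in>V. w v = (\<Sum>i\<in>{..d}. b i * affine_fun 0 i v)) \<and>
    (\<forall>\<omega>\<in>stresses {..<d} q. \<omega> e = 0 \<longrightarrow> (\<forall>z. bform \<omega> w z = 0))"
proof -
  have JE: "J \<subseteq> E" using J by (simp add: stress.cobasis_def)
  have eE: "e \<in> E" using JE e by blast
  have fE: "f \<in> E" using stress.support_E[OF ser(2)] ser(3) by (auto simp: support_def)
  have Jback: "stress.cobasis {1..d} q J"
  proof -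
    have "indep {1..d} q F \<longleftrightarrow> indep {..<d} q F" if "F \<subseteq> E" for F using that by (rule indep_shift)
    moreover have "E - J \<subseteq> E" "\<And>j. j \<in> J \<Longrightarrow> insert j (E - J) \<subseteq> E" using JE by auto
    ultimately show ?thesis using J by (simp add: stress.cobasis_def)
  qed
  obtain W where W: "\<And>j. j \<in> J \<Longrightarrow> W j \<in> stresses {..<d} q"
    "\<And>i j. i \<in> J \<Longrightarrow> j \<in> J \<Longrightarrow> W j i = (if i = j then 1 else 0)"
    using J by (rule stress.cobasis_dual) (rule that)
  obtain W' where W': "\<And>j. j \<in> J \<Longrightarrow> W' j \<in> stresses {1..d} q"
    "\<And>i j. i \<in> J \<Longrightarrow> j \<in> J \<Longrightarrow> W' j i = (if i = j then 1 else 0)"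
    using Jback by (rule stress.cobasis_dual) (rule that)
  have We: "W e e = 1" "W' e e = 1" using W(2) W'(2) e by auto
  obtain Ye where Ye: "\<forall>g\<in>E. (\<Sum>i\<in>{..d}. edge_form g (coord Ye i) (coord q i)) = (if g = e then 1 else 0)"
    using edge_motion by blast
  obtain Yf where Yf: "\<forall>g\<in>E. (\<Sum>i\<in>{..d}. edge_form g (coord Yf i) (coord q i)) = (if g = f then 1 else 0)"
    using edge_motion by blast
  \<comment> \<open>The common ratios of the values at \<open>f\<close> and \<open>e\<close>, for
    the front and the back projection.\<close>
  define c c' where "c = W e f" and "c' = W' e f"
  have c: "\<omega> f = c * \<omega> e" if "\<omega> \<in> stresses {..<d} q" for \<omega>
  proof -
    have "\<omega> f * W e e = \<omega> e * W e f"
      by (rule stress.series_proportional[OF _ that W(1)[OF e]]) (rule ser(4))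
    then show ?thesis using We(1) by (simp add: c_def mult.commute)
  qed
  have c': "\<omega> f = c' * \<omega> e" if "\<omega> \<in> stresses {1..d} q" for \<omega>
  proof -
    have "\<omega> f * W' e e = \<omega> e * W' e f"
      by (rule stress.series_proportional[OF _ that W'(1)[OF e]]) (rule series_shift[OF ser(4)])
    then show ?thesis using We(2) by (simp add: c'_def mult.commute)
  qed
  have "W e f \<noteq> 0" using c[OF ser(2)] ser(3) by (auto simp: c_def)
  have "W e f * W' e e \<noteq> W e e * W' e f"
  proof (rule series_ratio_differs[of e f "W e" "W' e"])
    show "\<omega> f = 0" if "\<omega> \<in> stresses {..<d} q" "\<omega> e = 0" for \<omega> using that by (rule ser(4))
    show "e \<noteq> f" using ser(1) by blast
  qed (simp_all add: W(1) W'(1) e We \<open>W e f \<noteq> 0\<close> del: One_nat_def)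
  then have cc': "c \<noteq> c'" by (simp add: c_def c'_def We)
  \<comment> \<open>The weights make the pairing with a stress
    \<open>c * \<omega> e - \<omega> f = 0\<close>, and likewise for \<open>c'\<close>; by tightness
    \<open>z\<close> and \<open>z'\<close> are then affine.\<close>
  define z z' where "z v = c * coord Ye d v + (- 1) * coord Yf d v"
    and "z' v = c' * coord Ye 0 v + (- 1) * coord Yf 0 v" for v
  have cover: "insert d {..<d} = {..d}" "insert 0 {1..d} = {..d}" using d_pos by auto
  have "bform \<omega> z (coord q d) = 0" if \<omega>: "\<omega> \<in> stresses {..<d} q" for \<omega>
    unfolding z_def bform_add
    using edge_motion_stress[OF Ye cover(1) _ \<omega>] edge_motion_stress[OF Yf cover(1) _ \<omega>] c[OF \<omega>] by simp
  then obtain b where b: "\<And>v. v \<in> V \<Longrightarrow> z v = (\<Sum>i\<in>{..d}. b i * affine_fun 0 i v)"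
    using tight_affine[of 0 J d z, unfolded front_interval] J cover(1) tight by auto
  have "bform \<omega> z' (coord q 0) = 0" if \<omega>: "\<omega> \<in> stresses {1..d} q" for \<omega>
    unfolding z'_def bform_add
    using edge_motion_stress[OF Ye cover(2) _ \<omega>] edge_motion_stress[OF Yf cover(2) _ \<omega>] c'[OF \<omega>] by simp
  then obtain b' where b': "\<And>v. v \<in> V \<Longrightarrow> z' v = (\<Sum>i\<in>{..d}. b' i * affine_fun 1 i v)"
    using tight_affine[of 1 J 0 z', unfolded back_interval] Jback cover(2) tight by auto
  \<comment> \<open>Coordinate \<open>d\<close> is traded for the others: \<open>z\<close> is affine
    with coefficients \<open>b\<close>, so by symmetry of the edge form its contribution equals that
    of \<open>b i * q v d\<close> in the coordinates \<open>i < d\<close>.\<close>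
  define Y where "Y v i = c * Ye v i + (- 1) * Yf v i + b i * q v d" for v i
  have coordY: "coord Y i = (\<lambda>v. 1 * (c * coord Ye i v + (- 1) * coord Yf i v) + b i * coord q d v)" for i
    by (simp add: coord_def Y_def fun_eq_iff)
  define H where "H = E - {e, f}"
  interpret H: generic_graph V H d q
  proof unfold_locales
    show "simple_graph V H" using simple by (auto simp: simple_graph_def H_def)
  qed (rule d_pos generic)+
  have HE: "H \<subseteq> E" by (auto simp: H_def)
  have sG: "graph V E" "graph V H" by unfold_locales
  have motion: "(\<Sum>i\<in>{..<d}. edge_form g (coord Y i) (coord q i)) = 0" if g: "g \<in> H" for g
  proof -
    have gE: "g \<in> E" "g \<noteq> e" "g \<noteq> f" using g by (auto simp: H_def)
    let ?t = "\<lambda>X i. edge_form g (coord X i) (coord q i)"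
    have last: "(\<Sum>i\<in>{..<d}. ?t X i) = - ?t X d" if "(\<Sum>i\<in>{..d}. ?t X i) = 0" for X
      using that by (simp add: lessThan_Suc_atMost[symmetric])
    have "(\<Sum>i\<in>{..<d}. ?t Y i) = (\<Sum>i\<in>{..<d}. c * ?t Ye i + (- 1) * ?t Yf i + b i * edge_form g (coord q d) (coord q i))"
      unfolding coordY edge_form_add[OF gE(1)] by simp
    also have "\<dots> = c * (\<Sum>i\<in>{..<d}. ?t Ye i) - (\<Sum>i\<in>{..<d}. ?t Yf i)
        + (\<Sum>i\<in>{..<d}. b i * edge_form g (coord q d) (coord q i))"
      by (simp add: sum.distrib sum_subtractf sum_distrib_left)
    also have "\<dots> = - (c * ?t Ye d + (- 1) * ?t Yf d)
        + (\<Sum>i\<in>{..<d}. b i * edge_form g (coord q d) (coord q i))"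
      using last[of Ye] last[of Yf] Ye Yf gE by simp
    also have "c * ?t Ye d + (- 1) * ?t Yf d = edge_form g z (coord q d)"
      unfolding z_def by (rule edge_form_add[OF gE(1), symmetric])
    also have "edge_form g z (coord q d) = edge_form g (\<lambda>v. \<Sum>i\<in>{..d}. b i * affine_fun 0 i v) (coord q d)"
      using b by (intro edge_form_cong[OF gE(1)]) auto
    also have "\<dots> = (\<Sum>i\<in>{..d}. b i * edge_form g (affine_fun 0 i) (coord q d))"
      by (rule edge_form_sum[OF gE(1)])
    also have "\<dots> = (\<Sum>i\<in>{..<d}. b i * edge_form g (coord q d) (coord q i))"
    proof -
      have "affine_fun 0 d = (\<lambda>v. 0 + 1)" by (simp add: affine_fun_def fun_eq_iff)
      then have "edge_form g (affine_fun 0 d) (coord q d) = 0"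
        using edge_form_const[OF gE(1), of "\<lambda>v. 0" 1] by (simp add: edge_form_def)
      moreover have "edge_form g (affine_fun 0 i) (coord q d) = edge_form g (coord q d) (coord q i)" if "i < d" for i
      proof -
        have "affine_fun 0 i = coord q i" using that by (simp add: affine_fun_def coord_def fun_eq_iff)
        then show ?thesis using edge_form_sym[OF gE(1)] by simp
      qed
      ultimately show ?thesis by (simp add: lessThan_Suc_atMost[symmetric])
    qed
    finally show ?thesis by simp
  qed
  let ?w = "coord Y 0"
  have kernel: "bform \<omega> ?w x = 0" if \<omega>: "\<omega> \<in> stresses {..<d} q" "\<omega> e = 0" for \<omega> x
  proof -
    have supp: "support \<omega> \<subseteq> H"
      using stress.support_E[OF \<omega>(1)] \<omega>(2) ser(4)[OF \<omega>] by (auto simp: H_def support_def)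
    then have "\<omega> \<in> H.stresses {..<d} q" using subgraph_stresses[OF sG _ HE] \<omega>(1) by blast
    then have "H.bform \<omega> ?w x = 0" using d_pos motion by (intro H.motion_stress) auto
    then show ?thesis using subgraph_bform[OF sG(2) HE supp] by simp
  qed
  have "\<not> (\<exists>a. \<forall>v\<in>V. ?w v = (\<Sum>i\<in>{..d}. a i * affine_fun 0 i v))"
  proof
    assume "\<exists>a. \<forall>v\<in>V. ?w v = (\<Sum>i\<in>{..d}. a i * affine_fun 0 i v)"
    then obtain a where a: "\<And>v. v \<in> V \<Longrightarrow> ?w v = (\<Sum>i\<in>{..d}. a i * affine_fun 0 i v)" by blast
    \<comment> \<open>If \<open>?w\<close> is affine, a back stress sees only its part along
      \<open>q_0\<close>, while comparison with \<open>z'\<close> gives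
      \<open>(c - c') * \<omega> e\<close>. Then \<open>W' e\<close> forces
      \<open>a 0 \<noteq> 0\<close>, and \<open>W' j2\<close>, which is zero at \<open>e\<close>,
      forces \<open>a 0 = 0\<close>: here a second stress is needed.\<close>
    have val: "(c - c') * \<omega> e = a 0 * bform \<omega> (coord q 0) (coord q 0)"
      if \<omega>: "\<omega> \<in> stresses {1..d} q" for \<omega>
    proof -
      have aff1: "bform \<omega> (\<lambda>v. \<Sum>i\<in>{..d}. b' i * affine_fun 1 i v) (coord q 0) = 0"
        unfolding bform_sum using bform_affine_fun[of \<omega> 1] \<omega> by (simp add: back_interval del: One_nat_def)
      have aff0: "bform \<omega> (\<lambda>v. \<Sum>i\<in>{..d}. a i * affine_fun 0 i v) (coord q 0) = a 0 * bform \<omega> (coord q 0) (coord q 0)"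
      proof -
        have "bform \<omega> (affine_fun 0 i) (coord q 0) = (if i = 0 then bform \<omega> (coord q 0) (coord q 0) else 0)" for i
        proof (cases "i < d")
          case True
          then have "affine_fun 0 i = coord q i" by (simp add: affine_fun_def coord_def fun_eq_iff)
          then show ?thesis using stressesD[OF \<omega>, of i] True bform_sym[of \<omega> "coord q i"] by auto
        next
          case False
          then have "affine_fun 0 i = (\<lambda>v. 1)" by (simp add: affine_fun_def fun_eq_iff)
          then show ?thesis using False d_pos by (simp add: bform_one)
        qed
        then show ?thesis unfolding bform_sum by (simp add: if_distrib[of "(*) _"] cong: if_cong)
      qed
      have "bform \<omega> ?w (coord q 0) = a 0 * bform \<omega> (coord q 0) (coord q 0)"
        using bform_cong[of ?w _ "coord q 0" "coord q 0" \<omega>, OF a] aff0 by simp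
      moreover have "bform \<omega> z' (coord q 0) = 0"
        using bform_cong[of z' _ "coord q 0" "coord q 0" \<omega>, OF b'] aff1 by simp
      moreover have "bform \<omega> ?w (coord q 0) = bform \<omega> (\<lambda>v. c * coord Ye 0 v + (- 1) * coord Yf 0 v) (coord q 0)"
        unfolding coordY bform_add[of \<omega> 1] using stressesD[OF \<omega>, of d "coord q 0"] d_pos
        by (simp add: bform_sym[of \<omega> "coord q d"])
      ultimately have "c * bform \<omega> (coord Ye 0) (coord q 0) - bform \<omega> (coord Yf 0) (coord q 0) = a 0 * bform \<omega> (coord q 0) (coord q 0)"
        "c' * bform \<omega> (coord Ye 0) (coord q 0) - bform \<omega> (coord Yf 0) (coord q 0) = 0"
        unfolding z'_def bform_add by simp_all
      moreover have "bform \<omega> (coord Ye 0) (coord q 0) = \<omega> e"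
        using edge_motion_stress[OF Ye cover(2) _ \<omega>] by simp
      ultimately show ?thesis by (simp add: algebra_simps)
    qed
    have "a 0 \<noteq> 0" using val[OF W'(1)[OF e]] We(2) cc' by auto
    moreover have "a 0 * bform (W' j2) (coord q 0) (coord q 0) = 0"
      using val[OF W'(1)[OF j2(1)]] W'(2)[OF e j2(1)] j2(2) by simp
    moreover have "bform (W' j2) (coord q 0) (coord q 0) \<noteq> 0"
      using self_form_nonzero[OF Jback j2(1) W'(1)[OF j2(1)] W'(2)[OF _ j2(1)]] by simp
    ultimately show False by simp
  qed
  then show ?thesis using kernel by (intro exI[of _ ?w]) blast
qed

text \<open>The non-affine kernel vectors \<open>w\<^sub>j\<close> diagonalize all stress matrices simultaneously.\<close>

lemma rank_one_stresses:
  assumes J: "stress.cobasis {..<d} q J" and tight: "card J + Suc d = card V"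
    and W: "\<And>j. j \<in> J \<Longrightarrow> W j \<in> stresses {..<d} q"
      "\<And>i j. i \<in> J \<Longrightarrow> j \<in> J \<Longrightarrow> W j i = (if i = j then 1 else 0)"
      "\<And>\<omega> g. \<omega> \<in> stresses {..<d} q \<Longrightarrow> \<omega> g = (\<Sum>j\<in>J. \<omega> j * W j g)"
    and ker: "\<And>e. e \<in> J \<Longrightarrow> \<exists>w. \<not> (\<exists>b. \<forall>v\<in>V. w v = (\<Sum>i\<in>{..d}. b i * affine_fun 0 i v)) \<and>
      (\<forall>\<omega>\<in>stresses {..<d} q. \<omega> e = 0 \<longrightarrow> (\<forall>z. bform \<omega> w z = 0))"
  shows "\<exists>\<alpha> \<kappa>. \<forall>j\<in>J. \<forall>u\<in>V. \<forall>v\<in>V. bform (W j) (delta u) (delta v) = \<kappa> j * \<alpha> j u * (\<alpha> j v :: real)"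
proof -
  define w where "w e = (SOME w. \<not> (\<exists>b. \<forall>v\<in>V. w v = (\<Sum>i\<in>{..d}. b i * affine_fun 0 i v)) \<and>
      (\<forall>\<omega>\<in>stresses {..<d} q. \<omega> e = 0 \<longrightarrow> (\<forall>z. bform \<omega> w z = 0)))" for e
  have w: "\<not> (\<exists>b. \<forall>v\<in>V. w e v = (\<Sum>i\<in>{..d}. b i * affine_fun 0 i v))"
    "\<And>\<omega> z. \<omega> \<in> stresses {..<d} q \<Longrightarrow> \<omega> e = 0 \<Longrightarrow> bform \<omega> (w e) z = 0" if "e \<in> J" for e
    using someI_ex[OF ker[OF that], folded w_def] by blast+
  have finJ: "finite J" using J finite_E finite_subset by (auto simp: stress.cobasis_def)
  have affW: "bform (W j) (affine_fun 0 i) z = 0" if "j \<in> J" for i j z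
    using bform_affine_fun[of "W j" 0] W(1)[OF that] by (simp add: lessThan_atLeast0)
  have wW: "bform (W j) (w i) z = 0" if "i \<in> J" "j \<in> J" "i \<noteq> j" for i j z
    using w(2)[OF that(1) W(1)[OF that(2)]] W(2)[OF that(1,2)] that(3) by simp
  let ?r = "case_sum w (affine_fun 0)"
  let ?I = "J <+> {..d}"
  have expand: "bform (W j) (\<lambda>v. \<Sum>x\<in>?I. a x * ?r x v) z = a (Inl j) * bform (W j) (w j) z" if j: "j \<in> J" for a j z
  proof -
    have "bform (W j) (\<lambda>v. \<Sum>x\<in>?I. a x * ?r x v) z = (\<Sum>x\<in>?I. a x * bform (W j) (?r x) z)"
      by (rule bform_sum)
    also have "\<dots> = (\<Sum>i\<in>J. a (Inl i) * bform (W j) (w i) z)"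
      using finJ affW[OF j] by (simp add: sum.Plus)
    also have "\<dots> = (\<Sum>i\<in>J. if i = j then a (Inl i) * bform (W j) (w i) z else 0)"
      using wW j by (intro sum.cong refl) auto
    finally show ?thesis using finJ j by simp
  qed
  have aff: "lin_indep (affine_fun 0) {..d} V" using tight by (intro affine_fun_indep) auto
  have "lin_indep ?r ?I V"
    unfolding lin_indep_def
  proof (intro allI impI)
    fix a assume a: "\<forall>v\<in>V. (\<Sum>x\<in>?I. a x * ?r x v) = 0"
    \<comment> \<open>Otherwise \<open>W j\<close> would kill \<open>w j\<close>, as all other
      \<open>W i\<close> do anyway, and \<open>w j\<close> would be affine by tightness.\<close>
    have al: "a (Inl j) = 0" if j: "j \<in> J" for j
    proof (rule ccontr)
      assume nz: "a (Inl j) \<noteq> 0"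
      have wj: "bform (W j) (w j) z = 0" for z
      proof -
        have "bform (W j) (\<lambda>v. \<Sum>x\<in>?I. a x * ?r x v) z = bform (W j) (\<lambda>v. 0) z"
          using a by (intro bform_cong) auto
        then show ?thesis unfolding expand[OF j] using nz bform_one[of "W j" 0 z] by simp
      qed
      have "bform \<omega> (w j) (coord q d) = 0" if \<omega>: "\<omega> \<in> stresses {..<d} q" for \<omega>
      proof -
        have "\<omega> = (\<lambda>g. \<Sum>i\<in>J. \<omega> i * W i g)" by (rule ext) (rule W(3)[OF \<omega>])
        then have "bform \<omega> (w j) (coord q d) = bform (\<lambda>g. \<Sum>i\<in>J. \<omega> i * W i g) (w j) (coord q d)"
          by (rule arg_cong)
        also have "\<dots> = (\<Sum>i\<in>J. \<omega> i * bform (W i) (w j) (coord q d))" by (rule bform_stress_sum)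
        also have "\<dots> = 0"
        proof (intro sum.neutral ballI)
          fix i assume "i \<in> J"
          then show "\<omega> i * bform (W i) (w j) (coord q d) = 0"
            using wj wW[OF j] by (cases "i = j") auto
        qed
        finally show ?thesis .
      qed
      moreover have "insert d {..<d} = {..d}" by auto
      ultimately have "\<exists>b. \<forall>v\<in>V. w j v = (\<Sum>i\<in>{..d}. b i * affine_fun 0 i v)"
        using tight_affine[of 0 J d "w j", unfolded front_interval] J tight by auto
      then show False using w(1)[OF j] by blast
    qed
    have "(\<Sum>i\<in>{..d}. a (Inr i) * affine_fun 0 i v) = 0" if "v \<in> V" for v
      using bspec[OF a that] al finJ by (simp add: sum.Plus)
    then have "\<forall>i\<in>{..d}. a (Inr i) = 0" using lin_indepD[OF aff, of "\<lambda>i. a (Inr i)"] by blast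
    then show "\<forall>x\<in>?I. a x = 0" using al by auto
  qed
  then have "\<exists>a. \<forall>v\<in>V. t v = (\<Sum>x\<in>?I. a x * ?r x v)" for t
    using finJ finite_V tight by (intro lin_indep_spans) (auto simp: card_Plus)
  then obtain a where a: "\<And>t v. v \<in> V \<Longrightarrow> t v = (\<Sum>x\<in>?I. a t x * ?r x v)" by metis
  \<comment> \<open>In the basis formed by the \<open>w i\<close> and the affine functions, the only
    possibly nonzero entry of the form \<open>W j\<close> is at \<open>w j\<close>;
    \<open>\<alpha> j u\<close> is the coordinate of \<open>delta u\<close> there.\<close>
  define \<alpha> where "\<alpha> j u = a (delta u) (Inl j)" for j u
  have step: "bform (W j) (delta u) z = \<alpha> j u * bform (W j) (w j) z" if j: "j \<in> J" for j u z
  proof -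
    have "bform (W j) (delta u) z = bform (W j) (\<lambda>v. \<Sum>x\<in>?I. a (delta u) x * ?r x v) z"
      by (rule bform_cong) (rule a, simp_all)
    then show ?thesis unfolding expand[OF j] \<alpha>_def .
  qed
  have "bform (W j) (delta u) (delta v) = bform (W j) (w j) (w j) * \<alpha> j u * \<alpha> j v" if "j \<in> J" for j u v
    using step[OF that, of u "delta v"] step[OF that, of v "w j"] bform_sym[of "W j" "w j" "delta v"] by simp
  then show ?thesis by (intro exI[of _ \<alpha>] exI[of _ "\<lambda>j. bform (W j) (w j) (w j)"]) blast
qed

section \<open>Overlapping complete graphs\<close>

text \<open>Any \<open>d + 3\<close> points are affinely dependent in dimension
  \<open>d + 1\<close>, so a larger complete graph would be stressed there.\<close>

lemma complete_subgraph_card: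
  assumes "X \<subseteq> V" "\<And>v w. v \<in> X \<Longrightarrow> w \<in> X \<Longrightarrow> v \<noteq> w \<Longrightarrow> {v, w} \<in> E"
  shows "card X \<le> d + 2"
proof (rule ccontr)
  assume "\<not> ?thesis"
  then have "\<exists>\<omega>\<in>stresses {..d} q. support \<omega> \<noteq> {}"
    using assms by (intro complete_stress_exists) auto
  then show False using no_big_stress by blast
qed

text \<open>If two of the complete graphs \<open>K\<^sub>d\<^sub>+\<^sub>2\<close> shared two edges on which their stresses are
  proportional, then so would they after moving a vertex \<open>a\<close> of the first that is not in the second,
  whereas this motion can change the affine dependency of the first at any shared vertex \<open>y\<close>.\<close>

lemma rank_one_ratio_differs:
  assumes span: "\<And>\<omega>. \<omega> \<in> stresses {..<d} q \<Longrightarrow> support \<omega> \<subseteq> support W1 \<union> support W2 \<Longrightarrow>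
      \<exists>x y. \<forall>g. \<omega> g = x * W1 g + y * W2 g"
    and W: "W1 \<in> stresses {..<d} q" "W2 \<in> stresses {..<d} q"
    and \<alpha>: "\<And>u v. u \<in> V \<Longrightarrow> v \<in> V \<Longrightarrow> u \<noteq> v \<Longrightarrow> W1 {u, v} = \<kappa> * \<alpha> u * \<alpha> v"
      "(\<Sum>v\<in>U. \<alpha> v) = 0" "\<And>i. i < d \<Longrightarrow> (\<Sum>v\<in>U. \<alpha> v * q v i) = 0"
      "U = {v \<in> V. \<alpha> v \<noteq> 0}" "\<kappa> \<noteq> 0"
    and a: "a \<in> U" "\<And>g. a \<in> g \<Longrightarrow> W2 g = 0"
    and g: "W1 g \<noteq> 0" "W2 g \<noteq> 0" "W1 g' \<noteq> 0" "W2 g' \<noteq> 0" "g \<noteq> g'"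
  shows "W1 g * W2 g' \<noteq> W1 g' * W2 g"
proof
  assume eq: "W1 g * W2 g' = W1 g' * W2 g"
  define H where "H = support W1 \<union> support W2"
  have HE: "H \<subseteq> E" using stress.support_E[OF W(1)] stress.support_E[OF W(2)] by (simp add: H_def)
  interpret H: generic_graph V H d q
  proof unfold_locales
    show "simple_graph V H" using simple HE by (auto simp: simple_graph_def)
  qed (rule d_pos generic)+
  have sG: "graph V E" "graph V H" by unfold_locales
  have gE: "g \<in> E" "g' \<in> E" using g stress.support_E[OF W(1)] by (auto simp: support_def)
  obtain u1 u2 where u: "u1 \<noteq> u2" "u1 \<in> V" "u2 \<in> V" "g = {u1, u2}" using gE(1) by (rule edge_pair)
  obtain z1 z2 where z: "z1 \<noteq> z2" "z1 \<in> V" "z2 \<in> V" "g' = {z1, z2}" using gE(2) by (rule edge_pair)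
  have "\<exists>y y2. g = {y, y2} \<and> y \<noteq> y2 \<and> y \<in> V \<and> y2 \<in> V \<and> y \<notin> g'"
  proof (cases "u1 \<in> g'")
    case False
    then show ?thesis using u by blast
  next
    case True
    then have "u2 \<notin> g'" using u z g(5) by auto
    then show ?thesis using u by (intro exI[of _ u2] exI[of _ u1]) auto
  qed
  then obtain y y2 where y: "g = {y, y2}" "y \<noteq> y2" "y \<in> V" "y2 \<in> V" "y \<notin> g'" by blast
  have W1g: "W1 g = \<kappa> * \<alpha> y * \<alpha> y2" "W1 g' = \<kappa> * \<alpha> z1 * \<alpha> z2"
    using \<alpha>(1)[OF y(3,4,2)] \<alpha>(1)[OF z(2,3,1)] y(1) z(4) by auto
  then have nonzero: "\<alpha> y \<noteq> 0" "\<alpha> y2 \<noteq> 0" "\<alpha> z1 \<noteq> 0" "\<alpha> z2 \<noteq> 0" using g(1,3) by auto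
  have ag: "a \<noteq> y" "a \<noteq> y2" "a \<noteq> z1" "a \<noteq> z2" using a(2)[of g] a(2)[of g'] g(2,4) y(1) z(4) by auto
  have aV: "a \<in> V" "\<alpha> a \<noteq> 0" using a(1) \<alpha>(4) by auto
  have U: "U \<subseteq> V" "finite U" "y \<in> U" using \<alpha>(4) finite_V y nonzero by auto
  \<comment> \<open>The new position of \<open>a\<close> makes the coefficients \<open>u\<close>
    below an affine dependency: weight \<open>s\<close> passes from \<open>a\<close> to
    \<open>y\<close>, a vertex of \<open>g\<close> outside \<open>g'\<close>. The stress
    \<open>W2\<close> does not see the move.\<close>
  define p where "p s v k = (if v = a then (\<alpha> a * q a k - s * q y k) / (\<alpha> a - s) else q v k)" for s v k
  have p0: "p 0 = q" using aV by (simp add: p_def fun_eq_iff)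
  have cont: "isCont (\<lambda>s. p s v k) 0" for v k
    unfolding p_def using aV by (cases "v = a") (auto intro!: continuous_intros)
  have "eventually (\<lambda>s. \<forall>F\<in>{F \<in> Pow H. H.indep {..<d} q F}. H.indep {..<d} (p s) F) (at 0)"
  proof (rule eventually_ball_finite)
    show "finite {F \<in> Pow H. H.indep {..<d} q F}" using H.finite_E by simp
    show "\<forall>F\<in>{F \<in> Pow H. H.indep {..<d} q F}. eventually (\<lambda>s. H.indep {..<d} (p s) F) (at 0)"
      using cont p0 by (auto intro!: H.eventually_indep)
  qed
  moreover have "eventually (\<lambda>s :: real. s \<noteq> 0) (at 0)" by (rule eventually_neq_at_within)
  moreover have "eventually (\<lambda>s. \<alpha> a - s \<noteq> 0) (at 0)"
  proof (rule tendsto_imp_eventually_ne)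
    show "((\<lambda>s. \<alpha> a - s) \<longlongrightarrow> \<alpha> a - 0) (at 0)" by (intro tendsto_intros)
  qed (use aV in simp)
  ultimately have "eventually (\<lambda>s. (\<forall>F\<in>{F \<in> Pow H. H.indep {..<d} q F}. H.indep {..<d} (p s) F) \<and>
      s \<noteq> 0 \<and> \<alpha> a - s \<noteq> 0) (at 0)"
    by eventually_elim simp
  from eventually_at_0_ex[OF this]
  obtain s where s: "\<And>F. F \<subseteq> H \<Longrightarrow> H.indep {..<d} q F \<Longrightarrow> H.indep {..<d} (p s) F" "s \<noteq> 0" "\<alpha> a - s \<noteq> 0"
    by auto
  have same: "H.indep {..<d} (p s) F \<longleftrightarrow> H.indep {..<d} q F" if F: "F \<subseteq> H" for F
  proof
    assume "H.indep {..<d} (p s) F"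
    then show "H.indep {..<d} q F" by (intro H.indep_generic[OF F, where \<sigma> = id]) auto
  qed (rule s(1)[OF F])
  \<comment> \<open>The assumed proportionality puts \<open>g\<close> and \<open>g'\<close> in
    series in \<open>H\<close>, and \<open>H\<close> has the same circuits at
    \<open>p s\<close>.\<close>
  have "\<omega> g' = 0" if \<omega>: "\<omega> \<in> H.stresses {..<d} q" "\<omega> g = 0" for \<omega>
  proof -
    have "\<omega> \<in> stresses {..<d} q" "support \<omega> \<subseteq> H" using \<omega>(1) subgraph_stresses[OF sG _ HE] by auto
    then obtain x x' where x: "\<And>g. \<omega> g = x * W1 g + x' * W2 g" using span unfolding H_def by blast
    have "\<omega> g' * W1 g = W1 g' * (x * W1 g) + x' * (W1 g * W2 g')" by (simp add: x algebra_simps)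
    also have "\<dots> = W1 g' * \<omega> g" unfolding eq by (simp add: x algebra_simps)
    finally show ?thesis using \<omega>(2) g(1) by simp
  qed
  then have "\<forall>\<omega>\<in>H.stresses {..<d} q. \<omega> g = 0 \<longrightarrow> \<omega> g' = 0" by blast
  then have "\<forall>C. matroid_circuit (H.indep {..<d} q) H C \<longrightarrow> g' \<in> C \<longrightarrow> g \<in> C"
    unfolding H.stress.series_iff_circuits .
  then have "\<forall>C. matroid_circuit (H.indep {..<d} (p s)) H C \<longrightarrow> g' \<in> C \<longrightarrow> g \<in> C"
    using matroid_circuit_cong[of H "H.indep {..<d} (p s)" "H.indep {..<d} q", OF same] by blast
  then have "\<forall>\<omega>\<in>H.stresses {..<d} (p s). \<omega> g = 0 \<longrightarrow> \<omega> g' = 0"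
    unfolding H.stress.series_iff_circuits[symmetric] .
  then have ser: "\<And>\<omega>. \<omega> \<in> H.stresses {..<d} (p s) \<Longrightarrow> \<omega> g = 0 \<Longrightarrow> \<omega> g' = 0" by blast
  define u where "u v = (if v = a then \<alpha> a - s else if v = y then \<alpha> y + s else \<alpha> v)" for v
  have two: "(\<Sum>v\<in>U. h v) = h a + h y + (\<Sum>v\<in>U - {a, y}. h v)" for h :: "'a \<Rightarrow> real"
  proof -
    have "(\<Sum>v\<in>U. h v) = (\<Sum>v\<in>U - {a, y}. h v) + (\<Sum>v\<in>{a, y}. h v)"
      using U a(1) by (intro sum.subset_diff) auto
    then show ?thesis using ag(1) by simp
  qed
  have rest: "(\<Sum>v\<in>U - {a, y}. u v * p s v i) = (\<Sum>v\<in>U - {a, y}. \<alpha> v * q v i)"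
    "(\<Sum>v\<in>U - {a, y}. u v) = (\<Sum>v\<in>U - {a, y}. \<alpha> v)" for i
    by (intro sum.cong refl; auto simp: u_def p_def)+
  have usum: "(\<Sum>v\<in>U. u v) = 0"
    using \<alpha>(2) ag(1) unfolding two rest(2) by (simp add: u_def)
  have usum': "(\<Sum>v\<in>U. u v * p s v i) = 0" if "i \<in> {..<d}" for i
  proof -
    have "u a * p s a i = \<alpha> a * q a i - s * q y i" using s(3) by (simp add: u_def p_def)
    moreover have "u y * p s y i = \<alpha> y * q y i + s * q y i" using ag(1) by (simp add: u_def p_def algebra_simps)
    moreover have "\<alpha> a * q a i + \<alpha> y * q y i + (\<Sum>v\<in>U - {a, y}. \<alpha> v * q v i) = 0"
      using \<alpha>(3)[of i] that unfolding two by simp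
    ultimately show ?thesis unfolding two rest(1) by simp
  qed
  have pairs: "{v, w} \<in> H" if "v \<in> U" "w \<in> U" "v \<noteq> w" for v w
    using \<alpha>(1)[of v w] that \<alpha>(4,5) by (auto simp: H_def support_def)
  let ?w = "\<lambda>g. if g \<in> H \<and> g \<subseteq> U then \<Prod>v\<in>g. u v else 0"
  have w: "?w \<in> H.stresses {..<d} (p s)"
    by (rule H.complete_stress[OF U(1) pairs usum usum'])
  have "W2 \<in> H.stresses {..<d} q" using W(2) subgraph_stresses[OF sG _ HE] by (auto simp: H_def)
  moreover have "H.bform W2 x (coord (p s) i) = H.bform W2 x (coord q i)" for x i
    unfolding H.bform_def
  proof (intro sum.cong refl)
    fix g assume "g \<in> H"
    show "W2 g * edge_form g x (coord (p s) i) = W2 g * edge_form g x (coord q i)"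
    proof (cases "a \<in> g")
      case False
      then have "edge_form g x (coord (p s) i) = edge_form g x (coord q i)"
        by (intro edge_form_cong_on) (auto simp: coord_def p_def)
      then show ?thesis by simp
    qed (simp add: a(2))
  qed
  ultimately have W2: "W2 \<in> H.stresses {..<d} (p s)" by (simp add: H.stresses_def)
  have prp: "?w g' * W2 g = ?w g * W2 g'"
    by (rule H.stress.series_proportional[OF _ w W2]) (rule ser)
  have wg: "?w g = (\<alpha> y + s) * \<alpha> y2"
    using pairs[of y y2] y ag nonzero U \<alpha>(4) by (auto simp: u_def)
  have wg': "?w g' = \<alpha> z1 * \<alpha> z2"
    using pairs[of z1 z2] z y ag nonzero \<alpha>(4) by (auto simp: u_def)
  have "\<alpha> z1 * \<alpha> z2 * W2 g = (\<alpha> y + s) * \<alpha> y2 * W2 g'" using prp unfolding wg wg' .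
  moreover have "\<alpha> z1 * \<alpha> z2 * W2 g = \<alpha> y * \<alpha> y2 * W2 g'"
  proof -
    have "\<kappa> * (\<alpha> z1 * \<alpha> z2 * W2 g) = \<kappa> * (\<alpha> y * \<alpha> y2 * W2 g')"
      using eq[symmetric] unfolding W1g by (simp add: mult_ac)
    then show ?thesis using \<alpha>(5) by simp
  qed
  ultimately have "s * \<alpha> y2 * W2 g' = 0" by (simp add: algebra_simps)
  then show False using s(2) nonzero(2) g(4) by simp
qed

text \<open>Leaves only a one-dimensional stress space for the case of equality, where
  \<open>complete_if_stress\<close> applies.\<close>

lemma tight_imp_small:
  assumes J0: "stress.cobasis {..<d} q J0" and tight0: "card J0 + Suc d = card V" and "card J0 \<ge> 2"
  shows False
proof -
  let ?S = "stresses {..<d} q"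
  \<comment> \<open>Every nonzero stress has such an edge in its support, so a cobasis can be chosen
    inside \<open>N\<close>, and \<open>kernel_vector\<close> applies to each of its edges.\<close>
  define N where "N = {e \<in> E. \<exists>f \<omega>. f \<noteq> e \<and> \<omega> \<in> ?S \<and> \<omega> f \<noteq> 0 \<and> (\<forall>\<omega>\<in>?S. \<omega> e = 0 \<longrightarrow> \<omega> f = 0)}"
  have "support \<omega> = {}" if \<omega>: "\<omega> \<in> ?S" "\<And>e. e \<in> N \<Longrightarrow> \<omega> e = 0" for \<omega>
  proof (rule ccontr)
    assume "support \<omega> \<noteq> {}"
    then obtain e0 where "\<omega> e0 \<noteq> 0" by (auto simp: support_def)
    from stress.splittable_series_pair[OF splittable \<omega>(1) this]
    obtain e f where ef: "e \<noteq> f" "\<omega> e \<noteq> 0" "\<omega> f \<noteq> 0"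
      "\<And>\<tau>. \<tau> \<in> ?S \<Longrightarrow> \<tau> e = 0 \<Longrightarrow> \<tau> f = 0" by blast
    have "e \<in> E" using stress.support_E[OF \<omega>(1)] ef(2) by (auto simp: support_def)
    moreover have "\<exists>f \<omega>. f \<noteq> e \<and> \<omega> \<in> ?S \<and> \<omega> f \<noteq> 0 \<and> (\<forall>\<omega>\<in>?S. \<omega> e = 0 \<longrightarrow> \<omega> f = 0)"
      using ef \<omega>(1) by (intro exI[of _ f] exI[of _ \<omega>]) auto
    ultimately have "e \<in> N" unfolding N_def by blast
    then show False using \<omega>(2) ef(2) by blast
  qed
  then obtain J where JN: "J \<subseteq> N" and J: "stress.cobasis {..<d} q J"
    using stress.cobasis_exists[of N "{..<d}" q] unfolding N_def by blast
  have JE: "J \<subseteq> E" "J0 \<subseteq> E" using J J0 by (auto simp: stress.cobasis_def)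
  have finJ: "finite J" using JE finite_E finite_subset by blast
  have "card J = card J0"
    using stress.cobasis_rank[OF J] stress.cobasis_rank[OF J0] card_mono[OF finite_E JE(1)]
      card_mono[OF finite_E JE(2)] by simp
  then have tight: "card J + Suc d = card V" and J2: "card J \<ge> 2" using assms by auto
  have other: "\<exists>j2\<in>J. j2 \<noteq> e" for e
  proof (rule ccontr)
    assume "\<not> ?thesis"
    then have "J \<subseteq> {e}" by blast
    then have "card J \<le> 1" using card_mono[of "{e}" J] by simp
    then show False using J2 by simp
  qed
  have ker: "\<exists>w. \<not> (\<exists>b. \<forall>v\<in>V. w v = (\<Sum>i\<in>{..d}. b i * affine_fun 0 i v)) \<and>
      (\<forall>\<omega>\<in>?S. \<omega> e = 0 \<longrightarrow> (\<forall>z. bform \<omega> w z = 0))" if e: "e \<in> J" for e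
  proof -
    have "e \<in> N" using e JN by blast
    then have "\<exists>f \<omega>. f \<noteq> e \<and> \<omega> \<in> ?S \<and> \<omega> f \<noteq> 0 \<and> (\<forall>\<omega>\<in>?S. \<omega> e = 0 \<longrightarrow> \<omega> f = 0)" by (simp add: N_def)
    then obtain f \<omega> where f: "f \<noteq> e" "\<omega> \<in> ?S" "\<omega> f \<noteq> 0" "\<forall>\<omega>\<in>?S. \<omega> e = 0 \<longrightarrow> \<omega> f = 0"
      by (elim exE conjE) (rule that)
    obtain j2 where j2: "j2 \<in> J" "j2 \<noteq> e" using other by blast
    show ?thesis by (rule kernel_vector[OF J tight e j2 f(1-3)]) (use f(4) in blast)
  qed
  obtain W where W: "\<And>j. j \<in> J \<Longrightarrow> W j \<in> ?S"
    "\<And>i j. i \<in> J \<Longrightarrow> j \<in> J \<Longrightarrow> W j i = (if i = j then 1 else 0)"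
    "\<And>\<omega> g. \<omega> \<in> ?S \<Longrightarrow> \<omega> g = (\<Sum>j\<in>J. \<omega> j * W j g)"
    using J by (rule stress.cobasis_dual) (rule that)
  obtain \<alpha> \<kappa> where ak: "\<And>j u v. j \<in> J \<Longrightarrow> u \<in> V \<Longrightarrow> v \<in> V \<Longrightarrow>
      bform (W j) (delta u) (delta v) = \<kappa> j * \<alpha> j u * (\<alpha> j v :: real)"
    using rank_one_stresses[OF J tight W ker] by blast
  have Wk: "W j {u, v} = - \<kappa> j * \<alpha> j u * \<alpha> j v" if "j \<in> J" "u \<in> V" "v \<in> V" "u \<noteq> v" for j u v
    using ak[OF that(1-3)] bform_delta_delta[OF that(2-4) stress.support_E[OF W(1)[OF that(1)]]] by simp
  define U where "U j = {v \<in> V. \<alpha> j v \<noteq> 0}" for j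
  have fU: "U j \<subseteq> V" "finite (U j)" for j using finite_V by (auto simp: U_def)
  have \<kappa>: "\<kappa> j \<noteq> 0" and Une: "U j \<noteq> {}" if j: "j \<in> J" for j
  proof -
    obtain u v where uv: "u \<noteq> v" "u \<in> V" "v \<in> V" "j = {u, v}" using JE(1) j edge_pair by blast
    have "- \<kappa> j * \<alpha> j u * \<alpha> j v = 1" using Wk[OF j uv(2,3,1)] W(2)[OF j j] uv(4) by simp
    then have "\<kappa> j \<noteq> 0" "\<alpha> j u \<noteq> 0" by auto
    then show "\<kappa> j \<noteq> 0" "U j \<noteq> {}" using uv(2) by (auto simp: U_def)
  qed
  have Wsupp: "W j g \<noteq> 0 \<longleftrightarrow> g \<subseteq> U j" if j: "j \<in> J" and g: "g \<in> E" for j g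
  proof -
    obtain u v where uv: "u \<noteq> v" "u \<in> V" "v \<in> V" "g = {u, v}" using g by (rule edge_pair)
    show ?thesis using Wk[OF j uv(2,3,1)] uv \<kappa>[OF j] by (auto simp: U_def)
  qed
  have pairs: "{u, v} \<in> E" if "j \<in> J" "u \<in> U j" "v \<in> U j" "u \<noteq> v" for j u v
  proof -
    have "W j {u, v} \<noteq> 0" using Wk[of j u v] that \<kappa> by (auto simp: U_def)
    then show ?thesis using stress.support_E[OF W(1)[OF that(1)]] by (auto simp: support_def)
  qed
  \<comment> \<open>The affine functions lie in the kernel of the rank-one matrix of
    \<open>W j\<close>, hence are orthogonal to \<open>\<alpha> j\<close>.\<close>
  have dep: "(\<Sum>v\<in>U j. \<alpha> j v * affine_fun 0 i v) = 0" if j: "j \<in> J" for i j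
  proof -
    obtain z where z: "z \<in> V" "\<alpha> j z \<noteq> 0" using Une[OF j] by (auto simp: U_def)
    have "0 = bform (W j) (affine_fun 0 i) (delta z)"
      using bform_affine_fun[of "W j" 0] W(1)[OF j] by (simp add: lessThan_atLeast0)
    also have "\<dots> = (\<Sum>v\<in>V. affine_fun 0 i v * bform (W j) (delta v) (delta z))" by (rule bform_delta)
    also have "\<dots> = (\<Sum>v\<in>V. (\<kappa> j * \<alpha> j z) * (\<alpha> j v * affine_fun 0 i v))"
      using ak[OF j _ z(1)] by (intro sum.cong refl) simp
    also have "\<dots> = (\<kappa> j * \<alpha> j z) * (\<Sum>v\<in>V. \<alpha> j v * affine_fun 0 i v)"
      by (simp add: sum_distrib_left)
    finally have "(\<Sum>v\<in>V. \<alpha> j v * affine_fun 0 i v) = 0" using \<kappa>[OF j] z(2) by simp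
    moreover have "(\<Sum>v\<in>U j. \<alpha> j v * affine_fun 0 i v) = (\<Sum>v\<in>V. \<alpha> j v * affine_fun 0 i v)"
      using finite_V by (intro sum.mono_neutral_left) (auto simp: U_def)
    ultimately show ?thesis by simp
  qed
  have cardU: "card (U j) = d + 2" if j: "j \<in> J" for j
  proof (rule antisym)
    show "card (U j) \<le> d + 2" by (rule complete_subgraph_card[OF fU(1) pairs[OF j]])
    show "d + 2 \<le> card (U j)"
    proof (rule ccontr)
      assume "\<not> d + 2 \<le> card (U j)"
      then have "lin_indep (\<lambda>v i. affine_fun 0 i v) (U j) {..d}"
        using fU(1) by (intro affine_points_indep) auto
      from lin_indepD[OF this dep[OF j]] have "\<alpha> j v = 0" if "v \<in> U j" for v using that by blast
      then show False using Une[OF j] by (auto simp: U_def)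
    qed
  qed
  define K where "K j = {g. g \<subseteq> U j \<and> card g = 2}" for j
  have KE: "K j \<subseteq> E" if "j \<in> J" for j
    using pairs[OF that] by (auto simp: K_def card_2_iff)
  have cardK: "card (K j) = (d + 2) choose 2" if "j \<in> J" for j
    using n_subsets[OF fU(2)] cardU[OF that] by (simp add: K_def)
  \<comment> \<open>Edge-disjoint complete graphs have too many edges: with
    \<open>card V = card J + d + 1\<close>, doubling the inequality from \<open>rank_bound\<close>
    leaves \<open>card J * (d * (d + 1)) \<le> d * (d + 1)\<close>.\<close>
  have "\<exists>i\<in>J. \<exists>j\<in>J. i \<noteq> j \<and> K i \<inter> K j \<noteq> {}"
  proof (rule ccontr)
    assume "\<not> ?thesis"
    then have "card (\<Union>j\<in>J. K j) = (\<Sum>j\<in>J. card (K j))"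
      using finJ fU(2) by (intro card_UN_disjoint) (auto simp: K_def)
    also have "\<dots> = card J * ((d + 2) choose 2)" using cardK by simp
    finally have "card J * ((d + 2) choose 2) \<le> card E"
      using card_mono[OF finite_E, of "\<Union>j\<in>J. K j"] KE by auto
    moreover have "card (E - J) + (Suc d choose 2) \<le> d * card V"
      using tight J by (intro rank_bound) (auto simp: stress.cobasis_def)
    moreover have "card (E - J) = card E - card J" "card J \<le> card E"
      using JE(1) finJ finite_E by (auto simp: card_Diff_subset card_mono)
    ultimately have "card J * ((d + 2) choose 2) + (Suc d choose 2) \<le> d * (card J + Suc d) + card J"
      using tight by simp
    then have "card J * (2 * ((d + 2) choose 2)) + 2 * (Suc d choose 2) \<le> 2 * d * (card J + Suc d) + 2 * card J"
      by (simp add: algebra_simps)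
    then have "card J * ((d + 2) * (d + 1)) + (d + 1) * d \<le> 2 * d * (card J + Suc d) + 2 * card J"
      unfolding double_choose_two by simp
    then have "card J * (d * (d + 1)) \<le> d * (d + 1)" by (simp add: algebra_simps)
    then show False using J2 d_pos by simp
  qed
  then obtain i j g where ij: "i \<in> J" "j \<in> J" "i \<noteq> j" and gK: "g \<in> K i" "g \<in> K j" by blast
  have gE: "g \<in> E" using KE ij gK by blast
  have Wg: "W i g \<noteq> 0" "W j g \<noteq> 0" using Wsupp[OF _ gE] ij gK by (auto simp: K_def)
  obtain A where A: "stress.valid_split {..<d} q g A"
    using splittable W(1)[OF ij(1)] Wg(1) unfolding stress.splittable_def by blast
  \<comment> \<open>The combination of \<open>W i\<close> and \<open>W j\<close> that vanishes at
    \<open>g\<close>, so that the split at \<open>g\<close> applies to it.\<close>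
  define \<tau> where "\<tau> h = W i h - (W i g / W j g) * W j h" for h
  have \<tau>: "\<tau> \<in> ?S" "\<tau> g = 0"
    using stress.diff[OF W(1)[OF ij(1)] W(1)[OF ij(2)], of "W i g / W j g"] Wg by (auto simp: \<tau>_def[abs_def])
  have \<tau>J: "\<tau> i = 1" "\<tau> j = - (W i g / W j g)" "\<And>l. l \<in> J \<Longrightarrow> l \<noteq> i \<Longrightarrow> l \<noteq> j \<Longrightarrow> \<tau> l = 0"
    using W(2) ij by (auto simp: \<tau>_def)
  have rA: "restr A \<tau> \<in> ?S" "g \<notin> A" using A \<tau> by (auto simp: stress.valid_split_def)
  have expand: "\<omega> h = \<omega> i * W i h + \<omega> j * W j h"
    if "\<omega> \<in> ?S" "\<And>l. l \<in> J \<Longrightarrow> l \<noteq> i \<Longrightarrow> l \<noteq> j \<Longrightarrow> \<omega> l = 0" for \<omega> h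
  proof -
    have "\<omega> h = (\<Sum>l\<in>J. \<omega> l * W l h)" using W(3)[OF that(1)] .
    also have "\<dots> = (\<Sum>l\<in>{i, j}. \<omega> l * W l h)"
      using that(2) ij finJ by (intro sum.mono_neutral_right) auto
    finally show ?thesis using ij(3) by simp
  qed
  have rexp: "restr A \<tau> h = restr A \<tau> i * W i h + restr A \<tau> j * W j h" for h
    by (rule expand[OF rA(1)]) (simp add: restr_def \<tau>J(3))
  have "restr A \<tau> g = 0" using rA(2) by (simp add: restr_def)
  \<comment> \<open>Keeping only one of the two terms would leave a nonzero value at
    \<open>g\<close>. Hence the restriction is \<open>\<tau>\<close> or 0, and \<open>\<tau>\<close>
    vanishes on one side of the split, where \<open>W i\<close> has an edge
    \<open>g'\<close>.\<close>
  then have "i \<in> A \<longleftrightarrow> j \<in> A"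
    using rexp[of g] \<tau>J(1,2) Wg by (cases "i \<in> A"; cases "j \<in> A") (auto simp: restr_def)
  have "\<exists>g'. g' \<noteq> g \<and> W i g' \<noteq> 0 \<and> \<tau> g' = 0"
  proof (cases "i \<in> A")
    case True
    then have "restr A \<tau> h = \<tau> h" for h
      using rexp[of h] expand[OF \<tau>(1) \<tau>J(3), of h] \<open>i \<in> A \<longleftrightarrow> j \<in> A\<close> by (simp add: restr_def)
    moreover obtain b where "b \<notin> A" "b \<noteq> g" "W i b \<noteq> 0"
      using A W(1)[OF ij(1)] Wg(1) unfolding stress.valid_split_def by blast
    ultimately show ?thesis by (metis restr_def)
  next
    case False
    then have "restr A \<tau> h = 0" for h
      using rexp[of h] \<open>i \<in> A \<longleftrightarrow> j \<in> A\<close> by (simp add: restr_def)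
    moreover obtain b where "b \<in> A" "W i b \<noteq> 0"
      using stress.valid_split_meets[OF A W(1)[OF ij(1)] Wg(1)] by blast
    ultimately show ?thesis using rA(2) by (metis restr_def)
  qed
  then obtain g' where g': "g' \<noteq> g" "W i g' \<noteq> 0" "\<tau> g' = 0" by blast
  then have eq: "W i g * W j g' = W i g' * W j g" using Wg by (simp add: \<tau>_def field_simps)
  then have Wg': "W j g' \<noteq> 0" using g'(2) Wg by auto
  have "U i \<noteq> U j"
  proof
    assume "U i = U j"
    moreover have "W i i \<noteq> 0" "W j i = 0" using W(2) ij by auto
    ultimately show False using Wsupp[of _ i] ij JE by blast
  qed
  then have "\<not> U i \<subseteq> U j" using card_seteq[OF fU(2), of "U i" j] cardU ij by auto
  then obtain a where a: "a \<in> U i" "a \<notin> U j" by blast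
  have "W i g * W j g' \<noteq> W i g' * W j g"
  proof (rule rank_one_ratio_differs[where \<alpha> = "\<alpha> i" and \<kappa> = "- \<kappa> i" and U = "U i" and a = a])
    fix \<omega> assume \<omega>: "\<omega> \<in> ?S" "support \<omega> \<subseteq> support (W i) \<union> support (W j)"
    have "\<omega> l = 0" if "l \<in> J" "l \<noteq> i" "l \<noteq> j" for l
    proof -
      have "W i l = 0" "W j l = 0" using W(2) that ij by auto
      then show ?thesis using \<omega>(2) by (auto simp: support_def)
    qed
    from expand[OF \<omega>(1) this] show "\<exists>x y. \<forall>g. \<omega> g = x * W i g + y * W j g" by blast
  next
    fix h assume "a \<in> h"
    show "W j h = 0"
    proof (rule ccontr)
      assume nz: "W j h \<noteq> 0"
      then have "h \<in> E" using stress.support_E[OF W(1)[OF ij(2)]] by (auto simp: support_def)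
      then show False using Wsupp[OF ij(2)] nz \<open>a \<in> h\<close> a(2) by blast
    qed
  next
    show "(\<Sum>v\<in>U i. \<alpha> i v) = 0" using dep[OF ij(1), of d] by (simp add: affine_fun_def)
    show "(\<Sum>v\<in>U i. \<alpha> i v * q v k) = 0" if "k < d" for k
      using dep[OF ij(1), of k] that by (simp add: affine_fun_def)
  qed (use W(1) ij Wk a \<kappa> Wg Wg' g' in \<open>auto simp: U_def\<close>)
  then show False using eq by simp
qed

section \<open>The inequalities and the case of equality\<close>

text \<open>As the rank is \<open>card E - card J\<close>, the first inequality reads
  \<open>card J + d + 1 \<le> card V\<close>, and the second is \<open>rank_bound\<close>.\<close>

lemma rank_inequalities:
  assumes V: "card V \<ge> d + 2"
  defines "r \<equiv> matroid_rank (indep {..<d} q) E"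
  shows "int (card E) \<le> int r + int (card V) - int d - 1"
    and "int r + int (card V) - int d - 1 \<le> (int d + 1) * int (card V) - int ((d + 2) choose 2)"
    and "int (card E) = int r + int (card V) - int d - 1 \<longleftrightarrow> complete_graph (d + 2) V E"
proof -
  obtain J where J: "stress.cobasis {..<d} q J"
    by (rule stress.cobasis_exists[OF subset_refl stress.zero_on_E])
  have JE: "J \<subseteq> E" "finite J" using J finite_E finite_subset by (auto simp: stress.cobasis_def)
  have r: "int r = int (card E) - int (card J)"
    using stress.cobasis_rank[OF J] card_mono[OF finite_E JE(1)] by (simp add: r_def of_nat_diff)
  have count: "card J + Suc d \<le> card V" using V by (intro cobasis_card[OF J]) simp
  then show "int (card E) \<le> int r + int (card V) - int d - 1" using r by simp
  have "card (E - J) + (Suc d choose 2) \<le> d * card V"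
    using V J by (intro rank_bound) (auto simp: stress.cobasis_def)
  moreover have "int (card (E - J)) = int r"
    using r JE card_mono[OF finite_E JE(1)] by (simp add: card_Diff_subset of_nat_diff)
  ultimately have "int r + int (Suc d choose 2) \<le> int d * int (card V)"
    by (metis of_nat_add of_nat_le_iff of_nat_mult)
  moreover have "int ((d + 2) choose 2) = int (Suc d choose 2) + int d + 1"
    by (simp add: numeral_2_eq_2)
  ultimately show "int r + int (card V) - int d - 1 \<le> (int d + 1) * int (card V) - int ((d + 2) choose 2)"
    by (simp add: algebra_simps)
  show "int (card E) = int r + int (card V) - int d - 1 \<longleftrightarrow> complete_graph (d + 2) V E"
  proof
    assume "int (card E) = int r + int (card V) - int d - 1"
    then have tight: "card J + Suc d = card V" using r by simp
    have "\<not> card J \<ge> 2" using tight_imp_small[OF J tight] by blast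
    then have "card J = 1" using V tight by linarith
    then have card: "card V = d + 2" and "J \<noteq> {}" using tight by auto
    then obtain j where "j \<in> J" by blast
    then have "\<not> indep {..<d} q (insert j (E - J))" using J by (simp add: stress.cobasis_def)
    then obtain \<omega> where "\<omega> \<in> stresses {..<d} q" "support \<omega> \<noteq> {}"
      by (auto simp: stress.ind_def)
    then show "complete_graph (d + 2) V E" using complete_if_stress card by blast
  next
    assume c: "complete_graph (d + 2) V E"
    then have card: "card V = d + 2" and E: "E = {e. e \<subseteq> V \<and> card e = 2}" by (auto simp: complete_graph_def)
    have "\<exists>\<omega>\<in>stresses {..<d} q. support \<omega> \<noteq> {}"
      using card by (intro complete_stress_exists[of V]) (auto simp: E)
    then have "J \<noteq> {}" using J stress.support_E by (auto simp: stress.cobasis_def stress.ind_def)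
    then have "card J \<ge> 1" using JE(2) by (simp add: Suc_le_eq card_gt_0_iff)
    then show "int (card E) = int r + int (card V) - int d - 1" using r count card by simp
  qed
qed

end

section \<open>Subgraphs and the link to rigidity components\<close>

text \<open>Stresses of the subgraph are the stresses of the graph supported in \<open>E'\<close>,
  so each split may be intersected with \<open>E'\<close>.\<close>

lemma split_graph_subgraph:
  assumes "split_graph V E d q" "subgraph V' E' V E"
  shows "split_graph V' E' d q"
proof -
  interpret split_graph V E d q by (rule assms(1))
  have sub: "simple_graph V' E'" "V' \<subseteq> V" "E' \<subseteq> E" using assms(2) by (auto simp: subgraph_def)
  interpret G: generic_graph V' E' d q
  proof
    show "simple_graph V' E'" by (rule sub(1))
    show "1 \<le> d" by (rule d_pos)
    have "V' \<times> {..<Suc d} \<subseteq> V \<times> {..<Suc d}" using sub(2) by blast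
    then show "generic_framework (Suc d) V' q"
      using generic unfolding generic_framework_def algebraically_independent_over_rat_def
      by (meson subset_trans)
  qed
  have "graph V E" "graph V' E'" by unfold_locales
  note iff = subgraph_stresses[OF this sub(2,3)]
  show ?thesis
  proof
    show "G.stress.splittable {..<d} q"
      unfolding G.stress.splittable_def
    proof (intro ballI allI impI)
      fix \<omega> e assume \<omega>: "\<omega> \<in> G.stresses {..<d} q" "\<omega> e \<noteq> 0"
      then obtain A where A: "stress.valid_split {..<d} q e A"
        using splittable iff unfolding stress.splittable_def by blast
      have "restr (A \<inter> E') \<tau> \<in> G.stresses {..<d} q" if \<tau>: "\<tau> \<in> G.stresses {..<d} q" "\<tau> e = 0" for \<tau>
      proof -
        have "restr (A \<inter> E') \<tau> = restr A \<tau>"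
          using \<tau>(1) iff by (auto simp: restr_def support_def fun_eq_iff)
        moreover have "restr A \<tau> \<in> stresses {..<d} q" using A \<tau> iff by (auto simp: stress.valid_split_def)
        moreover have "support (restr A \<tau>) \<subseteq> E'" using \<tau>(1) iff by (auto simp: restr_def support_def)
        ultimately show ?thesis using iff by simp
      qed
      moreover have "(\<exists>a\<in>A \<inter> E'. \<tau> a \<noteq> 0) \<and> (\<exists>b. b \<notin> A \<inter> E' \<and> b \<noteq> e \<and> \<tau> b \<noteq> 0)"
        if \<tau>: "\<tau> \<in> G.stresses {..<d} q" "\<tau> e \<noteq> 0" for \<tau>
      proof -
        have "\<tau> \<in> stresses {..<d} q" and supp: "support \<tau> \<subseteq> E'" using \<tau>(1) iff by auto
        then obtain a b where "a \<in> A" "\<tau> a \<noteq> 0" "b \<notin> A" "b \<noteq> e" "\<tau> b \<noteq> 0"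
          using A \<tau>(2) unfolding stress.valid_split_def by blast
        then show ?thesis using supp by (auto simp: support_def)
      qed
      ultimately have "G.stress.valid_split {..<d} q e (A \<inter> E')"
        using A unfolding G.stress.valid_split_def by (auto simp: stress.valid_split_def)
      then show "\<exists>A. G.stress.valid_split {..<d} q e A" by blast
    qed
  qed
qed

text \<open>Columns of vertices outside \<open>W\<close> are zero. This is needed because components
  come with the vertices they span.\<close>

lemma rigidity_indep_vertices:
  assumes "W \<subseteq> V" "\<Union>F \<subseteq> W"
  shows "rigidity_indep k p W F \<longleftrightarrow> rigidity_indep k p V F"
proof -
  have "(\<Sum>e\<in>F. c e * rigidity_matrix p e (v, i)) = 0" if "v \<notin> W" for c v i
    using assms(2) that by (intro sum.neutral) (auto simp: rigidity_matrix_def)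
  then have "(\<forall>j\<in>W \<times> {..<k}. (\<Sum>e\<in>F. c e * rigidity_matrix p e j) = 0) \<longleftrightarrow>
      (\<forall>j\<in>V \<times> {..<k}. (\<Sum>e\<in>F. c e * rigidity_matrix p e j) = 0)" for c
    using assms(1) by blast
  then show ?thesis by (simp add: rigidity_indep_def)
qed

lemma (in generic_graph) split_graph_if_minimally_connected:
  assumes p: "generic_framework d V p"
    and comp: "\<forall>(W, C)\<in>rigidity_components d p V E.
      card C \<ge> 2 \<longrightarrow> minimally_rigidity_connected d p W C"
  shows "split_graph V E d q"
proof
  let ?ind = "indep {..<d} q"
  have same: "rigidity_indep d p V F \<longleftrightarrow> ?ind F" if F: "F \<subseteq> E" for F
  proof
    assume "rigidity_indep d p V F"
    then show "?ind F" using rigidity_indep_iff[OF F] indep_front[OF F] by blast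
  next
    assume "?ind F"
    then have "indep {..<d} p F" by (intro generic_indep[OF p F, where \<sigma> = id]) auto
    then show "rigidity_indep d p V F" using rigidity_indep_iff[OF F] by blast
  qed
  show "stress.splittable {..<d} q"
  proof (rule stress.splittable_if_minimally_connected)
    show "\<exists>f. f \<noteq> e \<and> \<omega> f \<noteq> 0" if \<omega>: "\<omega> \<in> stresses {..<d} q" "\<omega> e \<noteq> 0" for \<omega> e
    proof -
      have "e \<in> E" using stress.support_E[OF \<omega>(1)] \<omega>(2) by (auto simp: support_def)
      then obtain v where "v \<in> e" by (elim edge_pair) blast
      from stress_touches[OF \<omega> this] show ?thesis by blast
    qed
    fix e assume e: "e \<in> E" and card: "card (circuit_class ?ind E e) \<ge> 2"
    let ?X = "circuit_class ?ind E e"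
    have XE: "?X \<subseteq> E" using e by (auto simp: circuit_class_def matroid_circuit_def)
    have eX: "e \<in> ?X" by (simp add: circuit_class_def)
    have circ: "matroid_circuit (rigidity_indep d p V) E C \<longleftrightarrow> matroid_circuit ?ind E C" for C
      by (rule matroid_circuit_cong) (rule same)
    let ?R = "{(e, f). e \<in> E \<and> f \<in> E \<and>
        (e = f \<or> (\<exists>C. matroid_circuit (rigidity_indep d p V) E C \<and> e \<in> C \<and> f \<in> C))}"
    have "C \<subseteq> E" if "matroid_circuit ?ind E C" for C using that by (simp add: matroid_circuit_def)
    then have RX: "?R `` {e} = ?X" unfolding circ circuit_class_def using e by blast
    have "?X \<in> matroid_components (rigidity_indep d p V) E"
      using quotientI[OF e, of ?R] unfolding RX matroid_components_def .
    then have "(\<Union>?X, ?X) \<in> rigidity_components d p V E"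
      unfolding rigidity_components_def by (rule rev_image_eqI) simp
    then have min: "minimally_rigidity_connected d p (\<Union>?X) ?X" using comp card by blast
    have XV: "\<Union>?X \<subseteq> V" using XE edge_subset by blast
    have sameX: "rigidity_indep d p (\<Union>?X) F \<longleftrightarrow> ?ind F" if "F \<subseteq> ?X" for F
      using rigidity_indep_vertices[OF XV, of F] same[of F] that XE by blast
    have "matroid_connected ?ind ?X"
      using min matroid_connected_cong[of ?X "rigidity_indep d p (\<Union>?X)" ?ind, OF sameX]
      by (simp add: minimally_rigidity_connected_def rigidity_connected_def)
    moreover have "\<not> matroid_connected ?ind (?X - {e})"
    proof
      assume "matroid_connected ?ind (?X - {e})"
      then have "matroid_connected (rigidity_indep d p (\<Union>?X)) (?X - {e})"
        using matroid_connected_cong[of "?X - {e}" "rigidity_indep d p (\<Union>?X)" ?ind] sameX by blast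
      \<comment> \<open>No vertex becomes isolated, so what the deletion of \<open>e\<close>
        destroys is the connectivity of the matroid.\<close>
      moreover have "\<exists>g\<in>?X - {e}. v \<in> g" if v: "v \<in> \<Union>?X" for v
      proof (cases "v \<in> e")
        case False
        then show ?thesis using v by blast
      next
        case True
        have "\<not> ?X \<subseteq> {e}" using card card_mono[of "{e}" ?X] by auto
        then obtain C where C: "matroid_circuit ?ind E C" "e \<in> C" by (auto simp: circuit_class_def)
        obtain \<tau> where \<tau>: "\<tau> \<in> stresses {..<d} q" "support \<tau> = C"
          using C(1) by (rule stress.circuit_stress)
        have "\<tau> e \<noteq> 0" using C(2) \<tau>(2) by (auto simp: support_def)
        from stress_touches[OF \<tau>(1) this True] obtain g where g: "g \<noteq> e" "v \<in> g" "\<tau> g \<noteq> 0" by blast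
        then have "g \<in> C" using \<tau>(2) by (auto simp: support_def)
        then have "g \<in> ?X" using C by (auto simp: circuit_class_def)
        then show ?thesis using g by blast
      qed
      ultimately have "rigidity_connected d p (\<Union>?X) (?X - {e})"
        by (simp add: rigidity_connected_def)
      then show False using min eX by (simp add: minimally_rigidity_connected_def)
    qed
    ultimately show "matroid_connected ?ind ?X \<and> \<not> matroid_connected ?ind (?X - {e})" ..
  qed
qed

theorem theorem5p2:
  fixes d :: nat and V :: "'a set" and E :: "'a set set"
    and p q :: "'a \<Rightarrow> nat \<Rightarrow> real"
  assumes "d \<ge> 1"
    and "simple_graph V E"
    and "generic_framework d V p"
    and "generic_framework (d + 1) V q"
    and "\<forall>(W, C) \<in> rigidity_components d p V E.
           card C \<ge> 2 \<longrightarrow> minimally_rigidity_connected d p W C"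
  shows "rigidity_indep (d + 1) q V E \<and>
    (\<forall>V' E'. subgraph V' E' V E \<and> card V' \<ge> d + 2 \<longrightarrow>
       int (card E') \<le> int (rigidity_rank d p V' E') + int (card V') - int d - 1 \<and>
       int (rigidity_rank d p V' E') + int (card V') - int d - 1
         \<le> (int d + 1) * int (card V') - int ((d + 2) choose 2) \<and>
       (int (card E') = int (rigidity_rank d p V' E') + int (card V') - int d - 1
         \<longleftrightarrow> complete_graph (d + 2) V' E'))"
proof -
  interpret G: generic_graph V E d q
    using assms(1,2,4) by unfold_locales simp_all
  interpret G: split_graph V E d q
    using assms(3,5) by (rule G.split_graph_if_minimally_connected)
  show ?thesis
  proof (intro conjI allI impI)
    have "G.indep {..d} q E" using G.no_big_stress by (auto simp: G.stress.ind_def)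
    then show "rigidity_indep (d + 1) q V E"
      using G.rigidity_indep_iff[OF subset_refl, of "d + 1" q] by (simp add: lessThan_Suc_atMost)
  next
    fix V' E' assume "subgraph V' E' V E \<and> card V' \<ge> d + 2"
    then have sub: "subgraph V' E' V E" and card: "card V' \<ge> d + 2" by auto
    interpret H: split_graph V' E' d q
      using G.split_graph_axioms sub by (rule split_graph_subgraph)
    have "V' \<subseteq> V" using sub by (simp add: subgraph_def)
    then have pV': "generic_framework d V' p"
      using assms(3) unfolding generic_framework_def algebraically_independent_over_rat_def
      by (meson Sigma_mono subset_refl subset_trans)
    have "rigidity_indep d p V' F \<longleftrightarrow> H.indep {..<d} q F" if F: "F \<subseteq> E'" for F
    proof
      assume "rigidity_indep d p V' F"
      then show "H.indep {..<d} q F"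
        using H.rigidity_indep_iff[OF F] H.indep_front[OF F] by blast
    next
      assume "H.indep {..<d} q F"
      then have "H.indep {..<d} p F" by (intro H.generic_indep[OF pV' F, where \<sigma> = id]) auto
      then show "rigidity_indep d p V' F" using H.rigidity_indep_iff[OF F] by blast
    qed
    then have "rigidity_rank d p V' E' = matroid_rank (H.indep {..<d} q) E'"
      unfolding rigidity_rank_def by (rule matroid_rank_cong)
    then show "int (card E') \<le> int (rigidity_rank d p V' E') + int (card V') - int d - 1"
      "int (rigidity_rank d p V' E') + int (card V') - int d - 1
         \<le> (int d + 1) * int (card V') - int ((d + 2) choose 2)"
      "int (card E') = int (rigidity_rank d p V' E') + int (card V') - int d - 1
         \<longleftrightarrow> complete_graph (d + 2) V' E'"
      using H.rank_inequalities[OF card] by simp_all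
  qed
qed

end
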